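(* Let $L$ be a cycle in a $2$-connected graph $G$ and let $T_1, T_2, \ldots, T_s$ be all the $L$-bridges of $G$, where these are pairwise vertex-disjoint, induce a tree in the overlap graph $O_G(L)$, and each $T_i$ is a tree. Then there exists a subfamily $\mathcal{C}\subseteq\mathcal{C}(G)$ such that: (C1) $|\mathcal{C}_e|=2$ for every $e\in E(L)$ and $|\mathcal{C}_e|\ge 4$ for every $e\in E(G)\setminus E(L)$; (C2) for each dicycle in $\mathcal{C}$ with underlying graph $C$, $L\triangle C$ is a cycle; (C3) every dicycle in $\mathcal{C}$ contains either no or exactly two attachments of each $L$-bridge; (C4) for any $ij\in\mathbb{Z}_2^2$ and any vertex $x$ which is an attachment of some $L$-bridge, there is exactly one dicycle in $\mathcal{C}$ which is of type $ij$ with respect to $x$.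
   Context: For a subgraph $H$ of a graph $G$, an $H$-bridge of $G$ is either (i) an edge in $E(G)\setminus E(H)$ with both endpoints in $V(H)$, or (ii) a subgraph consisting of a component $D$ of $G-V(H)$ together with all edges between $V(D)$ and $V(H)$. The attachments of an $H$-bridge $B$ are the vertices in $V(H)\cap V(B)$. For a cycle $L$, two $L$-bridges $B_1,B_2$ overlap if $L$ cannot be partitioned into two subpaths $L_1,L_2$ such that the attachments of $B_i$ lie entirely on $L_i$ for $i=1,2$. The overlap graph $O_G(L)$ has the $L$-bridges as vertices, two being adjacent iff they overlap; "induce a tree" means the induced subgraph of $O_G(L)$ on these vertices is a tree. For subgraphs $H_1,H_2$, $H_1\triangle H_2$ is the subgraph induced by $E(H_1)\triangle E(H_2)$. A dicycle is a directed cycle; $\mathcal{C}(G)$ denotes the family of all dicycles of $G$ (orientations of cycles of $G$), and for $\mathcal{C}\subseteq\mathcal{C}(G)$ and $e\in E(G)$, $\mathcal{C}_e$ is the set of dicycles in $\mathcal{C}$ whose underlying cycle contains $e$. Fix a cyclic order of the vertices of $L$; for $v\in V(L)$, $v^+$ and $v^-$ denote the next and previous vertex of $v$ on $L$. Let $C$ be a cycle of $G$ containing an edge $ab$ with $a\in V(L)$ and $b\notin V(L)$. An orientation $\vec C$ of $C$ is of type $00$ with respect to $a$ if it contains arcs $(b,a)$ and $(a,a^+)$; of type $01$ if it contains $(a,b)$ and $(a^+,a)$; of type $10$ if it contains $(b,a)$ and $(a,a^-)$; of type $11$ if it contains $(a,b)$ and $(a^-,a)$.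
   Formalization: In the definition of type ij, the condition that b is not in V(L) is replaced by: ab is an edge of G not in E(L). Otherwise (C4) fails at the ends of a chord (e.g. a 4-cycle L plus one chord); for attachments of non-chord bridges nothing changes. *)

theory Defs
  imports "HOL-Library.Z2"
begin

text \<open>
  Graphs are finite and simple: a pair of a vertex set and a set of two-element edges.
\<close>

type_synonym 'a graph = "'a set \<times> 'a set set"

abbreviation verts :: "'a graph \<Rightarrow> 'a set" where "verts \<equiv> fst"
abbreviation edges :: "'a graph \<Rightarrow> 'a set set" where "edges \<equiv> snd"

definition is_graph :: "'a graph \<Rightarrow> bool" where
  "is_graph G \<longleftrightarrow> finite (verts G) \<and> (\<forall>e\<in>edges G. e \<subseteq> verts G \<and> card e = 2)"

definition subgraph :: "'a graph \<Rightarrow> 'a graph \<Rightarrow> bool" where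
  "subgraph H G \<longleftrightarrow> is_graph H \<and> verts H \<subseteq> verts G \<and> edges H \<subseteq> edges G"

definition induced_subgraph :: "'a graph \<Rightarrow> 'a set \<Rightarrow> 'a graph" where
  "induced_subgraph G X = (verts G \<inter> X, {e \<in> edges G. e \<subseteq> X})"

definition delete_verts :: "'a graph \<Rightarrow> 'a set \<Rightarrow> 'a graph" where
  "delete_verts G X = induced_subgraph G (verts G - X)"

definition edge_induced :: "'a set set \<Rightarrow> 'a graph" where
  "edge_induced F = (\<Union>F, F)"

definition sym_diff_graph :: "'a graph \<Rightarrow> 'a graph \<Rightarrow> 'a graph" where
  "sym_diff_graph H1 H2 = edge_induced ((edges H1 - edges H2) \<union> (edges H2 - edges H1))"

definition adj :: "'a graph \<Rightarrow> ('a \<times> 'a) set" where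
  "adj G = {(u, v). {u, v} \<in> edges G}"

definition connected_graph :: "'a graph \<Rightarrow> bool" where
  "connected_graph G \<longleftrightarrow>
     is_graph G \<and> verts G \<noteq> {} \<and> (\<forall>u\<in>verts G. \<forall>v\<in>verts G. (u, v) \<in> (adj G)\<^sup>*)"

definition two_connected :: "'a graph \<Rightarrow> bool" where
  "two_connected G \<longleftrightarrow>
     card (verts G) > 2 \<and> connected_graph G \<and>
     (\<forall>v\<in>verts G. connected_graph (delete_verts G {v}))"

definition component :: "'a graph \<Rightarrow> 'a graph \<Rightarrow> bool" where
  "component D G \<longleftrightarrow>
     subgraph D G \<and> connected_graph D \<and>
     (\<forall>D'. subgraph D' G \<and> connected_graph D' \<and> subgraph D D' \<longrightarrow> D' = D)"

text \<open>A directed cycle is represented by its set of arcs, which determines its vertices.\<close>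

definition is_dicycle :: "('a \<times> 'a) set \<Rightarrow> bool" where
  "is_dicycle A \<longleftrightarrow>
     (\<exists>xs. distinct xs \<and> length xs \<ge> 3 \<and>
           A = {(xs ! i, xs ! (Suc i mod length xs)) | i. i < length xs})"

definition underlying :: "('a \<times> 'a) set \<Rightarrow> 'a graph" where
  "underlying A = (Field A, {{u, v} | u v. (u, v) \<in> A})"

definition is_cycle :: "'a graph \<Rightarrow> bool" where
  "is_cycle C \<longleftrightarrow> (\<exists>A. is_dicycle A \<and> underlying A = C)"

definition orientation_of_cycle :: "('a \<times> 'a) set \<Rightarrow> 'a graph \<Rightarrow> bool" where
  "orientation_of_cycle A C \<longleftrightarrow> is_dicycle A \<and> underlying A = C"

definition dicycles :: "'a graph \<Rightarrow> ('a \<times> 'a) set set" where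
  "dicycles G = {A. is_dicycle A \<and> subgraph (underlying A) G}"

definition dicycles_through ::
    "('a \<times> 'a) set set \<Rightarrow> 'a set \<Rightarrow> ('a \<times> 'a) set set" where
  "dicycles_through \<C> e = {A \<in> \<C>. e \<in> edges (underlying A)}"

definition is_path :: "'a graph \<Rightarrow> bool" where
  "is_path P \<longleftrightarrow>
     (\<exists>xs. xs \<noteq> [] \<and> distinct xs \<and>
           P = (set xs, {{xs ! i, xs ! Suc i} | i. Suc i < length xs}))"

definition is_tree :: "'a graph \<Rightarrow> bool" where
  "is_tree G \<longleftrightarrow> connected_graph G \<and> (\<nexists>C. is_cycle C \<and> subgraph C G)"

definition bridges :: "'a graph \<Rightarrow> 'a graph \<Rightarrow> 'a graph set" where
  "bridges G H =
     {({u, v}, {{u, v}}) | u v. {u, v} \<in> edges G - edges H \<and> u \<in> verts H \<and> v \<in> verts H} \<union>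
     {(verts D \<union> \<Union>F, edges D \<union> F) | D F.
        component D (delete_verts G (verts H)) \<and>
        F = {e \<in> edges G. e \<inter> verts D \<noteq> {} \<and> e \<inter> verts H \<noteq> {}}}"

definition attachments :: "'a graph \<Rightarrow> 'a graph \<Rightarrow> 'a set" where
  "attachments H B = verts H \<inter> verts B"

text \<open>
  A partition of a cycle into two subpaths is a partition of its edge set; the two subpaths
  share their end vertices.
\<close>

definition overlap :: "'a graph \<Rightarrow> 'a graph \<Rightarrow> 'a graph \<Rightarrow> bool" where
  "overlap L B1 B2 \<longleftrightarrow>
     \<not> (\<exists>L1 L2. is_path L1 \<and> is_path L2 \<and> subgraph L1 L \<and> subgraph L2 L \<and>
          edges L1 \<union> edges L2 = edges L \<and> edges L1 \<inter> edges L2 = {} \<and>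
          attachments L B1 \<subseteq> verts L1 \<and> attachments L B2 \<subseteq> verts L2)"

definition overlap_graph :: "'a graph \<Rightarrow> 'a graph \<Rightarrow> 'a graph graph" where
  "overlap_graph G L =
     (bridges G L,
      {{B1, B2} | B1 B2. B1 \<in> bridges G L \<and> B2 \<in> bridges G L \<and> B1 \<noteq> B2 \<and> overlap L B1 B2})"

text \<open>A cyclic order of the vertices of a cycle is given by an orientation \<open>R\<close> of the cycle.\<close>

definition next_vert :: "('a \<times> 'a) set \<Rightarrow> 'a \<Rightarrow> 'a" where
  "next_vert R v = (THE w. (v, w) \<in> R)"

definition prev_vert :: "('a \<times> 'a) set \<Rightarrow> 'a \<Rightarrow> 'a" where
  "prev_vert R v = (THE w. (w, v) \<in> R)"

text \<open>
  Type \<open>ij\<close> of a dicycle \<open>A\<close> with respect to a vertex \<open>a\<close> of the cycle underlying \<open>R\<close>.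
  The edge \<open>ab\<close> by which the dicycle leaves this cycle is only required not to be an edge of
  the cycle, so that \<open>ab\<close> may also be a chord; requiring \<open>b\<close> to lie off the cycle would leave
  the type undefined at the ends of chords.  The two conditions are equivalent if \<open>ab\<close>
  is not a chord.
\<close>

definition has_type ::
    "'a graph \<Rightarrow> ('a \<times> 'a) set \<Rightarrow> bit \<Rightarrow> bit \<Rightarrow> 'a \<Rightarrow> ('a \<times> 'a) set \<Rightarrow> bool" where
  "has_type G R i j a A \<longleftrightarrow>
     a \<in> verts (underlying R) \<and>
     (\<exists>b. {a, b} \<in> edges G - edges (underlying R) \<and>
        (i = 0 \<and> j = 0 \<and> (b, a) \<in> A \<and> (a, next_vert R a) \<in> A \<or>
         i = 0 \<and> j = 1 \<and> (a, b) \<in> A \<and> (next_vert R a, a) \<in> A \<or>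
         i = 1 \<and> j = 0 \<and> (b, a) \<in> A \<and> (a, prev_vert R a) \<in> A \<or>
         i = 1 \<and> j = 1 \<and> (a, b) \<in> A \<and> (prev_vert R a, a) \<in> A))"

end

(*
The attachments cut L into segments. We look for a partition of the two orientations of all segments into
closed lists in which consecutive segments are joined by a chord inside one bridge and every bridge is used
at most once; a chord is realised by a path of the bridge. Counting orientations gives (C1) on L and (C4).
For an edge e of a bridge, the attachments on one side of e are left by at least two chords and entered by at
least two chords, and these all belong to different dicycles; this gives the second part of (C1).

Such a partition is built by induction on the cyclic word of bridges read off at the attachments. A leaf s of
the overlap tree with neighbour r, chosen with a shortest interval covering the attachments of s, has only
attachments of s and r in that interval. Hence the word contains two equal adjacent letters, or s r s r s,
or s r s with no further s; in each case some attachments can be removed, and a partition for the smaller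
word extends by an explicit local substitution.
*)

theory Submission
  imports Defs "HOL-Library.Sublist"
begin

section \<open>Cyclic lists\<close>

text \<open>(C2) does not follow from the local rules for chords. Each circuit is therefore carried
  through the induction with a second closed traversal, of the remaining segments through the same
  chords in either direction; the substitutions have to be chosen so that this traversal survives.
  Passing each bridge at most once gives (C3) and, with the disjointness of the bridges, makes the
  realising paths disjoint.

  The bound 4 cannot be carried as a count of dicycles through an edge, because the edges of the
  bridges are absent from the induction. It is carried as a statement on all cuts of the attachments
  of a bridge: a new attachment of an old bridge subdivides two chords, which lowers no cut, and a
  new bridge starts with two chords in each direction. An edge of a tree bridge is a cut of the
  bridge, 2-connectedness puts attachments on both sides, and every path between the sides contains
  the edge.

  Vertices of \<open>L\<close> that are no attachments are kept as classes of one vertex, so that in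
  the end a segment is a single edge of \<open>L\<close>.\<close>

definition cpairs :: "'a list \<Rightarrow> ('a \<times> 'a) list" where
  "cpairs w = zip w (tl w @ [hd w])"

lemma cpairs_Nil [simp]: "cpairs [] = []"
  by (simp add: cpairs_def)

lemma cpairs_single [simp]: "cpairs [x] = [(x, x)]"
  by (simp add: cpairs_def)

lemma zip_tl_snoc: "xs \<noteq> [] \<Longrightarrow> zip xs (tl xs @ [y]) = zip xs (tl xs) @ [(last xs, y)]"
proof (induction xs)
  case (Cons a xs)
  then show ?case by (cases xs) auto
qed simp

lemma cpairs_eq: "w \<noteq> [] \<Longrightarrow> cpairs w = zip w (tl w) @ [(last w, hd w)]"
  by (simp add: cpairs_def zip_tl_snoc)

lemma zip_tl_append:
  "xs \<noteq> [] \<Longrightarrow> ys \<noteq> [] \<Longrightarrow>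
     zip (xs @ ys) (tl (xs @ ys)) = zip xs (tl xs) @ (last xs, hd ys) # zip ys (tl ys)"
proof (induction xs)
  case (Cons a xs)
  then show ?case by (cases xs; cases ys) auto
qed simp

lemma cpairs_append:
  "xs \<noteq> [] \<Longrightarrow> ys \<noteq> [] \<Longrightarrow>
     cpairs (xs @ ys) = zip xs (tl xs) @ (last xs, hd ys) # zip ys (tl ys) @ [(last ys, hd xs)]"
  using zip_tl_append[of xs ys] by (simp add: cpairs_eq)

lemma cpairs_Cons:
  "R \<noteq> [] \<Longrightarrow> cpairs (t # R) = (t, hd R) # zip R (tl R) @ [(last R, t)]"
  using cpairs_append[of "[t]" R] by simp

lemma set_cpairs_commute: "set (cpairs (xs @ ys)) = set (cpairs (ys @ xs))"
proof (cases "xs = [] \<or> ys = []")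
  case False
  then show ?thesis by (auto simp: cpairs_append)
qed auto

lemma set_cpairs_rotate [simp]: "set (cpairs (rotate n w)) = set (cpairs w)"
  by (metis append_take_drop_id rotate_drop_take set_cpairs_commute)

lemma length_cpairs [simp]: "length (cpairs w) = length w"
  by (cases w) (auto simp: cpairs_def)

lemma map_fst_cpairs [simp]: "map fst (cpairs w) = w"
  by (cases w) (auto simp: cpairs_def)

lemma map_snd_cpairs: "w \<noteq> [] \<Longrightarrow> map snd (cpairs w) = tl w @ [hd w]"
  by (cases w) (auto simp: cpairs_def)

lemma cpairs_nth: "i < length w \<Longrightarrow> cpairs w ! i = (w ! i, w ! (Suc i mod length w))"
  by (cases w) (auto simp: cpairs_def nth_append mod_Suc nth_tl less_Suc_eq)

lemma set_cpairs_conv_nth: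
  "set (cpairs w) = {(w ! i, w ! (Suc i mod length w)) | i. i < length w}"
  by (force simp: set_conv_nth cpairs_nth)

lemma cpairs_mem: "(a, b) \<in> set (cpairs w) \<Longrightarrow> a \<in> set w \<and> b \<in> set w"
  by (cases w) (auto simp: cpairs_def dest: set_zip_leftD set_zip_rightD)

lemma cpairs_succ: "a \<in> set w \<Longrightarrow> \<exists>b. (a, b) \<in> set (cpairs w)"
proof -
  assume "a \<in> set w"
  moreover have "set w = fst ` set (cpairs w)"
    by (metis map_fst_cpairs list.set_map)
  ultimately show ?thesis by force
qed

lemma cpairs_pred: "b \<in> set w \<Longrightarrow> \<exists>a. (a, b) \<in> set (cpairs w)"
proof -
  assume b: "b \<in> set w"
  then have "w \<noteq> []" by auto
  then have "snd ` set (cpairs w) = set w"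
    using map_snd_cpairs[of w] by (metis rotate1_hd_tl list.set_map set_rotate1)
  then show ?thesis using b by force
qed

text \<open>The map \<open>f\<close> is there because circuits are distinct even after passing to
  the owners of the ends: the owner of an end alone determines the successor.\<close>

lemma cpairs_unique_succ:
  assumes "distinct (map f w)" "(a, b) \<in> set (cpairs w)" "(a', b') \<in> set (cpairs w)" "f a = f a'"
  shows "a = a' \<and> b = b'"
proof -
  have "map (f \<circ> fst) (cpairs w) = map f w"
    by (simp flip: map_map)
  then have "distinct (map (f \<circ> fst) (cpairs w))"
    using assms(1) by simp
  then show ?thesis using assms(2-4) by (fastforce simp: distinct_map inj_on_def)
qed

lemma cpairs_unique_pred:
  assumes "distinct (map f w)" "(a, b) \<in> set (cpairs w)" "(a', b') \<in> set (cpairs w)" "f b = f b'"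
  shows "a = a' \<and> b = b'"
proof -
  have ne: "w \<noteq> []" using assms(2) by auto
  have "map (f \<circ> snd) (cpairs w) = map f (rotate1 w)"
    using ne by (simp add: rotate1_hd_tl map_snd_cpairs flip: map_map)
  then have "distinct (map (f \<circ> snd) (cpairs w))"
    using assms(1) by (simp add: rotate1_map[symmetric])
  then show ?thesis using assms(2-4) by (fastforce simp: distinct_map inj_on_def)
qed

lemma zip_tl_concat:
  assumes "\<forall>b\<in>set bs. b \<noteq> []"
  shows "set (zip (concat bs) (tl (concat bs))) =
    (\<Union>b\<in>set bs. set (zip b (tl b))) \<union> (\<lambda>(b, b'). (last b, hd b')) ` set (zip bs (tl bs))"
  using assms
proof (induction bs)
  case (Cons b bs)
  show ?case
  proof (cases bs)
    case (Cons b' bs')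
    then have "b \<noteq> []" "concat bs \<noteq> []" "hd (concat bs) = hd b'"
      using Cons.prems by auto
    then show ?thesis using Cons.IH Cons.prems Cons zip_tl_append[of b "concat bs"] by auto
  qed auto
qed simp

text \<open>Serves two purposes: replacing segments of a circuit by lists, and joining paths to a
  dicycle.\<close>

lemma set_cpairs_concat:
  assumes "\<forall>b\<in>set bs. b \<noteq> []"
  shows "set (cpairs (concat bs)) =
    (\<Union>b\<in>set bs. set (zip b (tl b))) \<union> (\<lambda>(b, b'). (last b, hd b')) ` set (cpairs bs)"
proof (cases "bs = []")
  case False
  have l: "concat bs \<noteq> [] \<and> last (concat bs) = last (last bs) \<and> hd (concat bs) = hd (hd bs)"
    using assms False
  proof (induction bs)
    case (Cons b bs)
    then show ?case by (cases bs) auto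
  qed simp
  show ?thesis
    using zip_tl_concat[OF assms] l False by (auto simp: cpairs_eq)
qed simp

lemma cpairs_map: "cpairs (map f w) = map (\<lambda>(a, b). (f a, f b)) (cpairs w)"
proof (cases w)
  case (Cons a xs)
  have "cpairs (map f w) = zip (map f w) (map f (xs @ [a]))"
    by (simp add: Cons cpairs_def)
  also have "\<dots> = map (\<lambda>(a, b). (f a, f b)) (zip w (xs @ [a]))"
    by (rule zip_map_map)
  finally show ?thesis by (simp add: Cons cpairs_def)
qed simp

lemma distinct_map_concat:
  assumes "distinct xs" "\<And>x. x \<in> set xs \<Longrightarrow> distinct (map h (\<sigma> x))"
    "\<And>x y a b. x \<in> set xs \<Longrightarrow> y \<in> set xs \<Longrightarrow> x \<noteq> y \<Longrightarrow> a \<in> set (\<sigma> x) \<Longrightarrow> b \<in> set (\<sigma> y) \<Longrightarrow> h a \<noteq> h b"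
  shows "distinct (map h (concat (map \<sigma> xs)))"
  using assms
proof (induction xs)
  case (Cons x xs)
  have "distinct (map h (concat (map \<sigma> xs)))"
  proof (rule Cons.IH)
    show "distinct xs" using Cons.prems(1) by simp
    show "distinct (map h (\<sigma> z))" if "z \<in> set xs" for z using Cons.prems(2) that by simp
    show "h a \<noteq> h b" if "z \<in> set xs" "y \<in> set xs" "z \<noteq> y" "a \<in> set (\<sigma> z)" "b \<in> set (\<sigma> y)"
      for z y a b using Cons.prems(3)[of z y a b] that by simp
  qed
  moreover have "h a \<noteq> h b" if "a \<in> set (\<sigma> x)" "y \<in> set xs" "b \<in> set (\<sigma> y)" for a b y
    using Cons.prems(1) Cons.prems(3)[of x y a b] that by auto
  then have "h ` set (\<sigma> x) \<inter> h ` set (concat (map \<sigma> xs)) = {}" by auto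
  ultimately show ?case using Cons.prems(2)[of x] by simp
qed simp

section \<open>Families of circuits\<close>

text \<open>The direction is kept apart from the segment, since the two orientations go to different
  circuits while a cocircuit only has to cover segments.\<close>

type_synonym 'a dirseg = "('a \<times> 'a) \<times> bool"

definition src :: "'a dirseg \<Rightarrow> 'a" where "src d = (if snd d then fst (fst d) else snd (fst d))"
definition tgt :: "'a dirseg \<Rightarrow> 'a" where "tgt d = (if snd d then snd (fst d) else fst (fst d))"
definition flip :: "'a dirseg \<Rightarrow> 'a dirseg" where "flip d = (fst d, \<not> snd d)"

lemma src_simps [simp]: "src ((a, b), True) = a" "src ((a, b), False) = b"
  by (auto simp: src_def)

lemma tgt_simps [simp]: "tgt ((a, b), True) = b" "tgt ((a, b), False) = a"
  by (auto simp: tgt_def)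

lemma flip_simps [simp]: "src (flip d) = tgt d" "tgt (flip d) = src d" "fst (flip d) = fst d"
  by (auto simp: src_def tgt_def flip_def)

definition chords :: "'a dirseg list \<Rightarrow> ('a \<times> 'a) set" where
  "chords xs = (\<lambda>(d, d'). (tgt d, src d')) ` set (cpairs xs)"

text \<open>A list of directed segments is closed up by chords: a segment is followed by one that starts at
  another vertex of the same class, or at the same vertex if this vertex is not an attachment.\<close>

definition lnk :: "('a \<Rightarrow> 'b) \<Rightarrow> 'a set \<Rightarrow> 'a \<Rightarrow> 'a \<Rightarrow> bool" where
  "lnk own A u v \<longleftrightarrow> own u = own v \<and> (u = v \<longleftrightarrow> u \<notin> A)"

text \<open>Some chord must be proper, since otherwise the cycle would never be left. Distinct
  owners of the ends mean that a class is passed at most once; distinct segments mean that no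
  segment is traversed in both directions.\<close>

definition circ :: "('a \<Rightarrow> 'b) \<Rightarrow> 'a set \<Rightarrow> 'a dirseg list \<Rightarrow> bool" where
  "circ own A xs \<longleftrightarrow> (\<forall>(u, v)\<in>chords xs. lnk own A u v) \<and> (\<exists>(u, v)\<in>chords xs. u \<noteq> v) \<and>
     distinct (map (own \<circ> tgt) xs) \<and> distinct (map fst xs)"

text \<open>Chords may be taken in both directions, as the symmetric difference is an undirected
  cycle. Equality stands for going straight on.\<close>

definition zlnk :: "('a \<times> 'a) set \<Rightarrow> 'a \<Rightarrow> 'a \<Rightarrow> bool" where
  "zlnk K u v \<longleftrightarrow> u = v \<or> (u, v) \<in> K \<or> (v, u) \<in> K"

text \<open>The symmetric difference of the cycle with a circuit, traversed as a closed walk.\<close>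

definition cocirc :: "('a \<times> 'a) set \<Rightarrow> 'a dirseg list \<Rightarrow> 'a dirseg list \<Rightarrow> bool" where
  "cocirc E xs zs \<longleftrightarrow> zs \<noteq> [] \<and> distinct (map fst zs) \<and> fst ` set zs = E - fst ` set xs \<and>
     (\<forall>(u, v)\<in>chords zs. zlnk (chords xs) u v)"

text \<open>At least two chords leave every proper nonempty part of a class. Since as many chords enter as leave,
  applying this to the complement gives the four dicycles through an edge of a bridge.\<close>

definition spread :: "'a set \<Rightarrow> ('a dirseg \<times> 'a dirseg) set \<Rightarrow> bool" where
  "spread U P \<longleftrightarrow> (\<forall>X. U \<inter> X \<noteq> {} \<longrightarrow> \<not> U \<subseteq> X \<longrightarrow>
     (\<exists>p\<in>P. \<exists>p'\<in>P. p \<noteq> p' \<and> tgt (fst p) \<in> X \<and> src (snd p) \<notin> X \<and>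
        tgt (fst p') \<in> X \<and> src (snd p') \<notin> X))"

text \<open>Pairs of directed segments and not chords, so that parallel chords are counted
  separately.\<close>

definition links :: "'a dirseg list set \<Rightarrow> ('a dirseg \<times> 'a dirseg) set" where
  "links F = (\<Union>xs\<in>F. set (cpairs xs))"

text \<open>\<open>A\<close> stays fixed during the induction; \<open>Field E \<inter> A\<close> are
  the attachments present on the current, possibly shortened, cycle.\<close>

definition family ::
    "('a \<Rightarrow> 'b) \<Rightarrow> 'a set \<Rightarrow> ('a \<times> 'a) set \<Rightarrow> 'a dirseg list set \<Rightarrow> bool" where
  "family own A E F \<longleftrightarrow>
     (\<forall>xs\<in>F. circ own A xs \<and> (\<exists>zs. cocirc E xs zs)) \<and> (\<Union>xs\<in>F. set xs) = E \<times> UNIV \<and>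
     (\<forall>xs\<in>F. \<forall>ys\<in>F. xs \<noteq> ys \<longrightarrow> set xs \<inter> set ys = {}) \<and>
     (\<forall>i. spread {v \<in> Field E \<inter> A. own v = i} {p \<in> links F. own (tgt (fst p)) = i})"

section \<open>Single visits of circuits\<close>

lemma chordsI: "(d, d') \<in> set (cpairs xs) \<Longrightarrow> (tgt d, src d') \<in> chords xs"
  by (force simp: chords_def)

lemma circ_lnk: "circ own A xs \<Longrightarrow> (d, d') \<in> set (cpairs xs) \<Longrightarrow> lnk own A (tgt d) (src d')"
  using chordsI[of d d' xs] by (auto simp: circ_def)

lemma circ_tgt_inj:
  "circ own A xs \<Longrightarrow> d \<in> set xs \<Longrightarrow> d' \<in> set xs \<Longrightarrow> own (tgt d) = own (tgt d') \<Longrightarrow> d = d'"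
  by (auto simp: circ_def distinct_map inj_on_def)

lemma circ_distinct: "circ own A xs \<Longrightarrow> distinct xs"
  by (auto simp: circ_def distinct_map)

text \<open>The preceding end has the same owner, so uniqueness carries over from ends to
  starts.\<close>

lemma circ_src_inj:
  assumes c: "circ own A xs" and d: "d \<in> set xs" "d' \<in> set xs" "own (src d) = own (src d')"
  shows "d = d'"
proof -
  obtain e e' where e: "(e, d) \<in> set (cpairs xs)" "(e', d') \<in> set (cpairs xs)"
    using cpairs_pred d by metis
  then have "own (tgt e) = own (tgt e')"
    using circ_lnk[OF c] d(3) unfolding lnk_def by metis
  moreover have "distinct (map (own \<circ> tgt) xs)" using c by (simp add: circ_def)
  ultimately show ?thesis using cpairs_unique_succ[of "own \<circ> tgt" xs e d e' d'] e by simp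
qed

text \<open>At an attachment the circuit has to take a chord to another vertex. Using both segments
  at \<open>t\<close> would mean one chord ending and another one starting at \<open>t\<close>,
  hence two passes through its class.\<close>

lemma circ_one_visit:
  assumes c: "circ own A xs" and d: "d \<in> set xs" "d' \<in> set xs" and t: "t \<in> A"
    "t = src d \<or> t = tgt d" "t = src d' \<or> t = tgt d'"
  shows "d = d'"
proof -
  have *: False if "e \<in> set xs" "e' \<in> set xs" "t = src e" "t = tgt e'" for e e'
  proof -
    obtain e0 where e0: "(e0, e) \<in> set (cpairs xs)" using cpairs_pred \<open>e \<in> set xs\<close> by metis
    then have l: "lnk own A (tgt e0) t" "e0 \<in> set xs" using circ_lnk[OF c] that cpairs_mem by metis+
    then have "own (tgt e0) = own (tgt e')" using that by (auto simp: lnk_def)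
    then have "e0 = e'" using circ_tgt_inj[OF c l(2)] that by simp
    then show False using l(1) that t(1) by (simp add: lnk_def)
  qed
  then show ?thesis using circ_src_inj[OF c d] circ_tgt_inj[OF c d] * d t by metis
qed

section \<open>Substitution in circuits and cocircuits\<close>

lemma subst_cpairs:
  assumes "\<forall>d\<in>set xs. \<sigma> d \<noteq> []"
  shows "set (cpairs (concat (map \<sigma> xs))) = (\<Union>d\<in>set xs. set (zip (\<sigma> d) (tl (\<sigma> d)))) \<union>
    (\<lambda>(d, d'). (last (\<sigma> d), hd (\<sigma> d'))) ` set (cpairs xs)"
  using set_cpairs_concat[of "map \<sigma> xs"] assms by (auto simp: cpairs_map image_image split_def)

definition inner :: "'a dirseg list \<Rightarrow> ('a \<times> 'a) set" where
  "inner ds = (\<lambda>(d, d'). (tgt d, src d')) ` set (zip ds (tl ds))"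

lemma inner_simps [simp]:
  "inner [d] = {}" "inner (d # e # ds) = insert (tgt d, src e) (inner (e # ds))"
  by (auto simp: inner_def)

lemma chords_subst:
  assumes "\<forall>d\<in>set xs. \<sigma> d \<noteq> []"
  shows "chords (concat (map \<sigma> xs)) = (\<Union>d\<in>set xs. inner (\<sigma> d)) \<union>
    (\<lambda>(d, d'). (tgt (last (\<sigma> d)), src (hd (\<sigma> d')))) ` set (cpairs xs)"
  unfolding chords_def subst_cpairs[OF assms] inner_def
  by (simp add: image_Un image_UN image_image split_def)

lemma inner_append:
  "xs \<noteq> [] \<Longrightarrow> ys \<noteq> [] \<Longrightarrow>
    inner (xs @ ys) = inner xs \<union> insert (tgt (last xs), src (hd ys)) (inner ys)"
  unfolding inner_def using zip_tl_append[of xs ys] by (auto simp del: tl_append2)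

lemma chords_inner: "xs \<noteq> [] \<Longrightarrow> chords xs = insert (tgt (last xs), src (hd xs)) (inner xs)"
  by (auto simp: chords_def inner_def cpairs_eq)

lemma circ_subst:
  assumes "circ own A xs"
    and ne: "\<And>d. d \<in> set xs \<Longrightarrow> \<sigma> d \<noteq> []"
    and "\<And>d u v. d \<in> set xs \<Longrightarrow> (u, v) \<in> inner (\<sigma> d) \<Longrightarrow> lnk own A u v"
    and "\<And>d d'. (d, d') \<in> set (cpairs xs) \<Longrightarrow> lnk own A (tgt (last (\<sigma> d))) (src (hd (\<sigma> d')))"
    and nt: "\<And>d d'. (d, d') \<in> set (cpairs xs) \<Longrightarrow> tgt d \<noteq> src d' \<Longrightarrow>
       tgt (last (\<sigma> d)) \<noteq> src (hd (\<sigma> d'))"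
    and "\<And>d. d \<in> set xs \<Longrightarrow> distinct (map (own \<circ> tgt) (\<sigma> d)) \<and> distinct (map fst (\<sigma> d))"
    and "\<And>d d' e e'. d \<in> set xs \<Longrightarrow> d' \<in> set xs \<Longrightarrow> d \<noteq> d' \<Longrightarrow> e \<in> set (\<sigma> d) \<Longrightarrow> e' \<in> set (\<sigma> d') \<Longrightarrow>
       own (tgt e) \<noteq> own (tgt e') \<and> fst e \<noteq> fst e'"
  shows "circ own A (concat (map \<sigma> xs))"
proof -
  have ch: "chords (concat (map \<sigma> xs)) = (\<Union>d\<in>set xs. inner (\<sigma> d)) \<union>
    (\<lambda>(d, d'). (tgt (last (\<sigma> d)), src (hd (\<sigma> d')))) ` set (cpairs xs)"
    by (rule chords_subst) (use ne in blast)
  have 1: "\<forall>(u, v)\<in>chords (concat (map \<sigma> xs)). lnk own A u v"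
    unfolding ch using assms(3,4) by auto
  obtain d d' where d: "(d, d') \<in> set (cpairs xs)" "tgt d \<noteq> src d'"
    using assms(1) by (auto simp: circ_def chords_def)
  have "(tgt (last (\<sigma> d)), src (hd (\<sigma> d'))) \<in> chords (concat (map \<sigma> xs))"
    unfolding ch using d(1) by (force simp: image_iff)
  then have 2: "\<exists>(u, v)\<in>chords (concat (map \<sigma> xs)). u \<noteq> v"
    using nt[OF d] by blast
  have dx: "distinct xs" using assms(1) circ_distinct by blast
  have 3: "distinct (map (own \<circ> tgt) (concat (map \<sigma> xs)))"
    using distinct_map_concat[OF dx, of "own \<circ> tgt" \<sigma>] assms(6,7) by simp
  have 4: "distinct (map fst (concat (map \<sigma> xs)))"
    using distinct_map_concat[OF dx, of fst \<sigma>] assms(6,7) by simp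
  show ?thesis using 1 2 3 4 by (simp add: circ_def)
qed

text \<open>Replacements are prescribed for forward segments only; a cocircuit that runs backwards
  over a segment needs the reversed list.\<close>

definition ori :: "('a \<times> 'a \<Rightarrow> 'a dirseg list) \<Rightarrow> 'a dirseg \<Rightarrow> 'a dirseg list" where
  "ori \<zeta> d = (if snd d then \<zeta> (fst d) else rev (map flip (\<zeta> (fst d))))"

lemma inner_flip: "inner (rev (map flip ds)) = (inner ds)\<inverse>"
proof (induction ds)
  case (Cons d ds)
  show ?case
  proof (cases "ds = []")
    case False
    then have "rev (map flip ds) \<noteq> []" "last (rev (map flip ds)) = flip (hd ds)"
      by (auto simp: last_rev hd_map)
    moreover have "inner (d # ds) = insert (tgt d, src (hd ds)) (inner ds)"
      using False by (cases ds) auto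
    ultimately show ?thesis using Cons inner_append[of "rev (map flip ds)" "[flip d]"] by auto
  qed (simp add: inner_def)
qed (simp add: inner_def)

text \<open>A cocircuit of the new circuit arises by replacing each unused segment by a directed walk;
  \<open>\<tau>\<close> records where the ends of chords have moved.\<close>

lemma cocirc_subst:
  fixes \<zeta> :: "'a \<times> 'a \<Rightarrow> 'a dirseg list"
  assumes c: "cocirc E xs zs"
    and z: "\<And>a b. (a, b) \<in> E - fst ` set xs \<Longrightarrow> \<zeta> (a, b) \<noteq> [] \<and> src (hd (\<zeta> (a, b))) = \<tau> a \<and>
       tgt (last (\<zeta> (a, b))) = \<tau> b \<and> distinct (map fst (\<zeta> (a, b))) \<and>
       (\<forall>(u, v)\<in>inner (\<zeta> (a, b)). zlnk (chords xs') u v)"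
    and dj: "\<And>e e' d d'. e \<in> E - fst ` set xs \<Longrightarrow> e' \<in> E - fst ` set xs \<Longrightarrow> e \<noteq> e' \<Longrightarrow>
       d \<in> set (\<zeta> e) \<Longrightarrow> d' \<in> set (\<zeta> e') \<Longrightarrow> fst d \<noteq> fst d'"
    and cover: "(\<Union>e\<in>E - fst ` set xs. fst ` set (\<zeta> e)) = E' - fst ` set xs'"
    and ch: "\<And>d d'. (d, d') \<in> set (cpairs xs) \<Longrightarrow> (\<tau> (tgt d), \<tau> (src d')) \<in> chords xs'"
  shows "\<exists>zs'. cocirc E' xs' zs'"
proof -
  let ?zs = "concat (map (ori \<zeta>) zs)"
  have fz: "fst ` set zs = E - fst ` set xs" using c by (simp add: cocirc_def)
  then have mem: "fst d \<in> E - fst ` set xs" if "d \<in> set zs" for d using that by auto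
  have z': "\<zeta> (fst d) \<noteq> [] \<and> src (hd (\<zeta> (fst d))) = \<tau> (fst (fst d)) \<and>
       tgt (last (\<zeta> (fst d))) = \<tau> (snd (fst d)) \<and> distinct (map fst (\<zeta> (fst d))) \<and>
       (\<forall>(u, v)\<in>inner (\<zeta> (fst d)). zlnk (chords xs') u v)" if "d \<in> set zs" for d
    using z[of "fst (fst d)" "snd (fst d)"] mem[OF that] by simp
  have ne: "\<forall>d\<in>set zs. ori \<zeta> d \<noteq> []" using z' by (auto simp: ori_def)
  have ends: "src (hd (ori \<zeta> d)) = \<tau> (src d) \<and> tgt (last (ori \<zeta> d)) = \<tau> (tgt d)"
    if "d \<in> set zs" for d
    using z'[OF that]
    by (cases d; cases "fst d"; cases "snd d") (auto simp: ori_def hd_rev last_rev hd_map last_map)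
  have sets: "fst ` set (ori \<zeta> d) = fst ` set (\<zeta> (fst d))" for d
    by (auto simp: ori_def image_image)
  have "zlnk (chords xs') u v" if "(u, v) \<in> chords ?zs" for u v
  proof -
    consider d where "d \<in> set zs" "(u, v) \<in> inner (ori \<zeta> d)"
      | d d' where "(d, d') \<in> set (cpairs zs)" "u = tgt (last (ori \<zeta> d))" "v = src (hd (ori \<zeta> d'))"
      using \<open>(u, v) \<in> chords ?zs\<close> unfolding chords_subst[OF ne] by auto
    then show ?thesis
    proof cases
      case 1
      then show ?thesis using z'[OF 1(1)]
        by (auto simp: ori_def inner_flip zlnk_def split: if_splits)
    next
      case 2
      then have uv: "u = \<tau> (tgt d)" "v = \<tau> (src d')" using ends cpairs_mem[OF 2(1)] by auto
      have "zlnk (chords xs) (tgt d) (src d')"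
        using c chordsI[OF 2(1)] by (auto simp: cocirc_def)
      moreover have "(\<tau> a, \<tau> b) \<in> chords xs'" if "(a, b) \<in> chords xs" for a b
        using that ch by (auto simp: chords_def[of xs])
      ultimately show ?thesis using uv by (auto simp: zlnk_def)
    qed
  qed
  moreover have "?zs \<noteq> []" using c ne by (cases zs) (auto simp: cocirc_def)
  moreover have "distinct (map fst ?zs)"
  proof (rule distinct_map_concat)
    show "distinct zs" using c by (auto simp: cocirc_def distinct_map)
    show "distinct (map fst (ori \<zeta> d))" if "d \<in> set zs" for d
      using z'[OF that] by (auto simp: ori_def rev_map[symmetric] comp_def)
    show "fst a \<noteq> fst b" if "x \<in> set zs" "y \<in> set zs" "x \<noteq> y" "a \<in> set (ori \<zeta> x)" "b \<in> set (ori \<zeta> y)"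
      for x y a b
    proof -
      have "fst x \<noteq> fst y" using c that by (auto simp: cocirc_def distinct_map inj_on_def)
      moreover have "fst a \<in> fst ` set (\<zeta> (fst x))" "fst b \<in> fst ` set (\<zeta> (fst y))"
        using that(4,5) sets by blast+
      then obtain a' b' where "a' \<in> set (\<zeta> (fst x))" "b' \<in> set (\<zeta> (fst y))"
          "fst a = fst a'" "fst b = fst b'" by auto
      ultimately show ?thesis using dj[OF mem[OF that(1)] mem[OF that(2)]] by metis
    qed
  qed
  moreover have "fst ` set ?zs = E' - fst ` set xs'"
    by (simp add: image_UN sets cover[symmetric] fz[symmetric])
  ultimately have "cocirc E' xs' ?zs" by (auto simp: cocirc_def)
  then show ?thesis ..
qed

section \<open>Cuts and families under substitution\<close>

lemma spread_map:
  assumes "spread U P" "inj_on g P" "g ` P \<subseteq> P'"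
    "\<And>p. p \<in> P \<Longrightarrow> tgt (fst (g p)) = tgt (fst p) \<and> src (snd (g p)) = src (snd p)"
  shows "spread U P'"
  unfolding spread_def
proof (intro allI impI)
  fix X assume "U \<inter> X \<noteq> {}" "\<not> U \<subseteq> X"
  then obtain p p' where p: "p \<in> P" "p' \<in> P" "p \<noteq> p'" "tgt (fst p) \<in> X" "src (snd p) \<notin> X"
    "tgt (fst p') \<in> X" "src (snd p') \<notin> X"
    using assms(1) unfolding spread_def by blast
  then have "g p \<noteq> g p'" "g p \<in> P'" "g p' \<in> P'" using assms(2,3) by (auto simp: inj_on_def)
  then show "\<exists>p\<in>P'. \<exists>p'\<in>P'. p \<noteq> p' \<and> tgt (fst p) \<in> X \<and> src (snd p) \<notin> X \<and>
      tgt (fst p') \<in> X \<and> src (snd p') \<notin> X"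
    using p assms(4)[OF p(1)] assms(4)[OF p(2)]
    by (intro bexI[of _ "g p"] bexI[of _ "g p'"]) auto
qed

text \<open>The chords within one class form a multigraph; here \<open>f\<close> and \<open>g\<close> map a chord subdivided by \<open>n\<close>
  to its first and second half.\<close>

lemma spread_subdivide:
  assumes s: "spread U P" and p12: "p1 \<in> P" "p2 \<in> P" "p1 \<noteq> p2"
    and U: "src (snd p1) \<in> U" "src (snd p2) \<in> U" "tgt (fst p1) \<in> U" "tgt (fst p2) \<in> U"
    and inj: "inj_on f P" "inj_on g P" "f ` P \<subseteq> P'" "g ` P \<subseteq> P'"
    and fg: "\<And>p. p \<in> P \<Longrightarrow> tgt (fst (f p)) = tgt (fst p) \<and> src (snd (g p)) = src (snd p)"
    and n: "\<And>p. p \<in> {p1, p2} \<Longrightarrow> src (snd (f p)) = n \<and> tgt (fst (g p)) = n"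
    and same: "\<And>p. p \<in> P \<Longrightarrow> p \<notin> {p1, p2} \<Longrightarrow> f p = g p"
  shows "spread (insert n U) P'"
  unfolding spread_def
proof (intro allI impI)
  fix X assume X: "insert n U \<inter> X \<noteq> {}" "\<not> insert n U \<subseteq> X"
  \<comment> \<open>A subdivided chord from \<open>X\<close> to its complement crosses in its second
    half if \<open>n\<close> is in \<open>X\<close>, and in its first half otherwise.\<close>
  define h where "h = (if n \<in> X then g else f)"
  have "\<exists>p\<in>P. \<exists>p'\<in>P. p \<noteq> p' \<and> tgt (fst (h p)) \<in> X \<and> src (snd (h p)) \<notin> X \<and>
      tgt (fst (h p')) \<in> X \<and> src (snd (h p')) \<notin> X"
  proof (cases "U \<inter> X \<noteq> {} \<and> \<not> U \<subseteq> X")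
    case True
    then obtain p p' where p: "p \<in> P" "p' \<in> P" "p \<noteq> p'" "tgt (fst p) \<in> X" "src (snd p) \<notin> X"
      "tgt (fst p') \<in> X" "src (snd p') \<notin> X"
      using s unfolding spread_def by blast
    have "tgt (fst (h q)) \<in> X \<and> src (snd (h q)) \<notin> X" if "q \<in> P" "tgt (fst q) \<in> X" "src (snd q) \<notin> X" for q
      using fg[OF that(1)] n[of q] same[OF that(1)] that by (cases "q \<in> {p1, p2}") (auto simp: h_def)
    then show ?thesis using p by metis
  next
    \<comment> \<open>Now \<open>X\<close> separates \<open>n\<close> from all of \<open>U\<close>,
      so the halves of \<open>p1\<close> and \<open>p2\<close> on the proper side of
      \<open>n\<close> cross.\<close>
    case False
    then have "tgt (fst (h q)) \<in> X \<and> src (snd (h q)) \<notin> X" if "q \<in> {p1, p2}" for q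
      using X n[OF that] fg[of q] that p12 U by (auto simp: h_def)
    then show ?thesis using p12 by blast
  qed
  then obtain p p' where p: "p \<in> P" "p' \<in> P" "p \<noteq> p'" "tgt (fst (h p)) \<in> X" "src (snd (h p)) \<notin> X"
      "tgt (fst (h p')) \<in> X" "src (snd (h p')) \<notin> X" by blast
  moreover have "inj_on h P" "h ` P \<subseteq> P'" using inj by (auto simp: h_def)
  ultimately have "h p \<noteq> h p'" "h p \<in> P'" "h p' \<in> P'" by (auto simp: inj_on_def)
  then show "\<exists>p\<in>P'. \<exists>p'\<in>P'. p \<noteq> p' \<and> tgt (fst p) \<in> X \<and> src (snd p) \<notin> X \<and>
      tgt (fst p') \<in> X \<and> src (snd p') \<notin> X" using p by blast
qed

text \<open>The set in the last hypothesis consists of the links of the new family, sorted by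
  origin: old links between the outer ends of the lists, links inside a list, and links of the
  circuits in \<open>N\<close>.\<close>

lemma family_subst:
  assumes F: "family own A E F"
    and ne: "\<And>d. d \<in> E \<times> UNIV \<Longrightarrow> \<sigma> d \<noteq> []"
    and old: "\<And>xs. xs \<in> F \<Longrightarrow> circ own A (concat (map \<sigma> xs)) \<and> (\<exists>zs. cocirc E' (concat (map \<sigma> xs)) zs)"
    and new: "\<And>xs. xs \<in> N \<Longrightarrow> circ own A xs \<and> (\<exists>zs. cocirc E' xs zs)"
    and cover: "(\<Union>d\<in>E \<times> UNIV. set (\<sigma> d)) \<union> (\<Union>xs\<in>N. set xs) = E' \<times> UNIV"
    and dj: "\<And>d d'. d \<in> E \<times> UNIV \<Longrightarrow> d' \<in> E \<times> UNIV \<Longrightarrow> d \<noteq> d' \<Longrightarrow> set (\<sigma> d) \<inter> set (\<sigma> d') = {}"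
    and djN: "\<And>d xs. d \<in> E \<times> UNIV \<Longrightarrow> xs \<in> N \<Longrightarrow> set (\<sigma> d) \<inter> set xs = {}"
      "\<And>xs ys. xs \<in> N \<Longrightarrow> ys \<in> N \<Longrightarrow> xs \<noteq> ys \<Longrightarrow> set xs \<inter> set ys = {}"
    and spr: "\<And>i. spread {v \<in> Field E' \<inter> A. own v = i}
       {p \<in> (\<lambda>(d, d'). (last (\<sigma> d), hd (\<sigma> d'))) ` links F \<union>
             (\<Union>d\<in>E \<times> UNIV. set (zip (\<sigma> d) (tl (\<sigma> d)))) \<union> links N. own (tgt (fst p)) = i}"
  shows "\<exists>F'. family own A E' F'"
proof -
  let ?S = "\<lambda>xs. concat (map \<sigma> xs)"
  let ?F = "?S ` F \<union> N"
  have cov: "(\<Union>xs\<in>F. set xs) = E \<times> UNIV" and djF: "\<And>xs ys. xs \<in> F \<Longrightarrow> ys \<in> F \<Longrightarrow> xs \<noteq> ys \<Longrightarrow> set xs \<inter> set ys = {}"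
    using F unfolding family_def by blast+
  have mem: "d \<in> E \<times> UNIV" if "xs \<in> F" "d \<in> set xs" for d xs using cov that by blast
  have a: "\<forall>xs\<in>?F. circ own A xs \<and> (\<exists>zs. cocirc E' xs zs)" using old new by auto
  have "(\<Union>xs\<in>?F. set xs) = (\<Union>d\<in>(\<Union>xs\<in>F. set xs). set (\<sigma> d)) \<union> (\<Union>xs\<in>N. set xs)" by auto
  then have b: "(\<Union>xs\<in>?F. set xs) = E' \<times> UNIV" using cover cov by simp
  have c1: "set (?S xs) \<inter> set (?S ys) = {}" if "xs \<in> F" "ys \<in> F" "xs \<noteq> ys" for xs ys
  proof -
    have "set (\<sigma> d) \<inter> set (\<sigma> d') = {}" if "d \<in> set xs" "d' \<in> set ys" for d d'
      using dj[of d d'] djF[of xs ys] mem \<open>xs \<in> F\<close> \<open>ys \<in> F\<close> \<open>xs \<noteq> ys\<close> that by blast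
    then have "(\<Union>d\<in>set xs. set (\<sigma> d)) \<inter> (\<Union>d\<in>set ys. set (\<sigma> d)) = {}" by blast
    then show ?thesis by simp
  qed
  have c2: "set (?S xs) \<inter> set ys = {}" if "xs \<in> F" "ys \<in> N" for xs ys
    using djN(1) mem that by fastforce
  have c: "\<forall>xs\<in>?F. \<forall>ys\<in>?F. xs \<noteq> ys \<longrightarrow> set xs \<inter> set ys = {}"
  proof (intro ballI impI)
    fix as bs assume ab: "as \<in> ?F" "bs \<in> ?F" "as \<noteq> bs"
    consider xs ys where "as = ?S xs" "bs = ?S ys" "xs \<in> F" "ys \<in> F"
      | xs where "as = ?S xs" "xs \<in> F" "bs \<in> N" | ys where "as \<in> N" "bs = ?S ys" "ys \<in> F"
      | "as \<in> N" "bs \<in> N"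
      using ab(1,2) by blast
    then show "set as \<inter> set bs = {}"
    proof cases
      case 1
      then have "xs \<noteq> ys" using ab(3) by blast
      then show ?thesis using c1 1 by metis
    next
      case 2
      then show ?thesis using c2 by metis
    next
      case 3
      then show ?thesis using c2[of ys as] by (metis Int_commute)
    next
      case 4
      then show ?thesis using djN(2) ab(3) by metis
    qed
  qed
  have "links ?F = (\<Union>xs\<in>F. set (cpairs (?S xs))) \<union> links N" by (auto simp: links_def)
  also have "(\<Union>xs\<in>F. set (cpairs (?S xs))) = (\<Union>xs\<in>F. (\<Union>d\<in>set xs. set (zip (\<sigma> d) (tl (\<sigma> d)))) \<union>
    (\<lambda>(d, d'). (last (\<sigma> d), hd (\<sigma> d'))) ` set (cpairs xs))"
    by (intro SUP_cong refl subst_cpairs ballI ne) (use mem in blast)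
  also have "\<dots> = (\<lambda>(d, d'). (last (\<sigma> d), hd (\<sigma> d'))) ` links F \<union>
      (\<Union>d\<in>E \<times> UNIV. set (zip (\<sigma> d) (tl (\<sigma> d))))"
    unfolding cov[symmetric] links_def by blast
  finally have "family own A E' ?F" unfolding family_def using a b c spr by simp
  then show ?thesis ..
qed

lemma family_circ: "family own A E F \<Longrightarrow> xs \<in> F \<Longrightarrow> circ own A xs"
  by (simp add: family_def)

lemma family_cocirc: "family own A E F \<Longrightarrow> xs \<in> F \<Longrightarrow> \<exists>zs. cocirc E xs zs"
  by (simp add: family_def)

lemma family_Union: "family own A E F \<Longrightarrow> (\<Union>xs\<in>F. set xs) = E \<times> UNIV"
  by (simp add: family_def)

lemma family_mem: "family own A E F \<Longrightarrow> xs \<in> F \<Longrightarrow> d \<in> set xs \<Longrightarrow> d \<in> E \<times> UNIV"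
  using family_Union[of own A E F] by blast

lemma links_mem:
  assumes F: "family own A E F" and "(d, d') \<in> links F"
  shows "d \<in> E \<times> UNIV \<and> d' \<in> E \<times> UNIV"
proof -
  obtain xs where xs: "xs \<in> F" "(d, d') \<in> set (cpairs xs)" using assms(2) by (auto simp: links_def)
  then show ?thesis using family_mem[OF F xs(1)] cpairs_mem[OF xs(2)] by blast
qed

lemma links_lnk:
  assumes F: "family own A E F" and "(d, d') \<in> links F"
  shows "lnk own A (tgt d) (src d')"
proof -
  obtain xs where xs: "xs \<in> F" "(d, d') \<in> set (cpairs xs)" using assms(2) by (auto simp: links_def)
  then show ?thesis using family_circ[OF F xs(1)] circ_lnk by metis
qed

lemma links_succ: "family own A E F \<Longrightarrow> d \<in> E \<times> UNIV \<Longrightarrow> \<exists>d'. (d, d') \<in> links F"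
  unfolding family_def links_def using cpairs_succ by (metis (no_types, lifting) UN_iff)

lemma links_pred: "family own A E F \<Longrightarrow> d \<in> E \<times> UNIV \<Longrightarrow> \<exists>d'. (d', d) \<in> links F"
  unfolding family_def links_def using cpairs_pred by (metis (no_types, lifting) UN_iff)

lemma links_inj:
  assumes F: "family own A E F" and l: "(d, a) \<in> links F" "(e, b) \<in> links F"
  shows "d = e \<longleftrightarrow> a = b"
proof -
  obtain xs ys where x: "xs \<in> F" "(d, a) \<in> set (cpairs xs)" "ys \<in> F" "(e, b) \<in> set (cpairs ys)"
    using l by (auto simp: links_def)
  have dj: "xs \<noteq> ys \<Longrightarrow> set xs \<inter> set ys = {}" using F x unfolding family_def by blast
  have eq: "xs = ys" if "d = e \<or> a = b"
    using dj that cpairs_mem[OF x(2)] cpairs_mem[OF x(4)] by blast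
  have "distinct (map id xs)" using F x(1) circ_distinct unfolding family_def by fastforce
  then show ?thesis
    using cpairs_unique_succ[of id xs d a e b] cpairs_unique_pred[of id xs d a e b] eq x by fastforce
qed

section \<open>The cycle of two attachments, and cuts of one class under relabelling\<close>

lemma spread_empty: "spread {} P"
  by (simp add: spread_def)

text \<open>Each of the four directed segments is a circuit of its own, closed by the chord back to
  its start; the other segment is its cocircuit.\<close>

lemma family_base:
  assumes "p \<noteq> q" "own p = own q" "p \<in> A" "q \<in> A"
  shows "\<exists>F. family own A (set (cpairs [p, q])) F"
proof -
  let ?E = "{(p, q), (q, p)}"
  let ?F = "(\<lambda>d. [d]) ` (?E \<times> UNIV)"
  have E: "set (cpairs [p, q]) = ?E" by (simp add: cpairs_def)
  have l: "links ?F = (\<lambda>d. (d, d)) ` (?E \<times> UNIV)" by (auto simp: links_def)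
  have circ: "circ own A [d] \<and> (\<exists>zs. cocirc ?E [d] zs)" if "d \<in> ?E \<times> UNIV" for d
  proof -
    obtain a b c where d: "d = ((a, b), c)" by (metis surj_pair)
    have "circ own A [d]"
      using that assms by (cases c) (auto simp: d circ_def chords_def lnk_def)
    moreover have "cocirc ?E [d] [((b, a), True)]"
      using that assms by (cases c) (auto simp: d cocirc_def chords_def zlnk_def)
    ultimately show ?thesis by blast
  qed
  have "spread {v \<in> {p, q}. own v = i} {x \<in> links ?F. own (tgt (fst x)) = i}" for i
  proof (cases "i = own p")
    case True
    have "{v \<in> {p, q}. own v = i} = {p, q}" using True assms by auto
    moreover have "{x \<in> links ?F. own (tgt (fst x)) = i} = links ?F"
      using True assms unfolding l by (auto simp: tgt_def)
    moreover have "spread {p, q} (links ?F)"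
      unfolding spread_def
    proof (intro allI impI)
      fix X assume "{p, q} \<inter> X \<noteq> {}" "\<not> {p, q} \<subseteq> X"
      then obtain a b where ab: "(a, b) \<in> ?E" "a \<in> X" "b \<notin> X" by auto
      \<comment> \<open>Both circuits run from \<open>b\<close> to \<open>a\<close>, so both close
        with a chord from \<open>a\<close> to \<open>b\<close>.\<close>
      let ?x = "((a, b), False)" and ?y = "((b, a), True)"
      have "(?x, ?x) \<in> links ?F" "(?y, ?y) \<in> links ?F" using ab unfolding l by auto
      then show "\<exists>x\<in>links ?F. \<exists>y\<in>links ?F. x \<noteq> y \<and> tgt (fst x) \<in> X \<and> src (snd x) \<notin> X \<and>
          tgt (fst y) \<in> X \<and> src (snd y) \<notin> X"
        using ab by (intro bexI[of _ "(?x, ?x)"] bexI[of _ "(?y, ?y)"]) auto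
    qed
    ultimately show ?thesis by simp
  next
    case False
    then have "{v \<in> {p, q}. own v = i} = {}" using assms by auto
    then show ?thesis by (simp only: spread_empty)
  qed
  moreover have "Field ?E \<inter> A = {p, q}" using assms by (auto simp: Field_def)
  ultimately have "family own A ?E ?F"
    unfolding family_def using circ by auto
  then show ?thesis unfolding E by blast
qed

text \<open>When all ends are attachments, every junction is a proper chord, and the condition that
  proper chords stay proper comes for free.\<close>

lemma circ_subst_att:
  assumes "circ own A xs"
    and "\<And>d. d \<in> set xs \<Longrightarrow> \<sigma> d \<noteq> [] \<and> tgt (last (\<sigma> d)) \<in> A"
    and "\<And>d u v. d \<in> set xs \<Longrightarrow> (u, v) \<in> inner (\<sigma> d) \<Longrightarrow> lnk own A u v"
    and "\<And>d d'. (d, d') \<in> set (cpairs xs) \<Longrightarrow> lnk own A (tgt (last (\<sigma> d))) (src (hd (\<sigma> d')))"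
    and "\<And>d. d \<in> set xs \<Longrightarrow> distinct (map (own \<circ> tgt) (\<sigma> d)) \<and> distinct (map fst (\<sigma> d))"
    and "\<And>d d' e e'. d \<in> set xs \<Longrightarrow> d' \<in> set xs \<Longrightarrow> d \<noteq> d' \<Longrightarrow> e \<in> set (\<sigma> d) \<Longrightarrow> e' \<in> set (\<sigma> d') \<Longrightarrow>
       own (tgt e) \<noteq> own (tgt e') \<and> fst e \<noteq> fst e'"
  shows "circ own A (concat (map \<sigma> xs))"
proof (rule circ_subst[OF assms(1)])
  show "tgt (last (\<sigma> d)) \<noteq> src (hd (\<sigma> d'))" if "(d, d') \<in> set (cpairs xs)" "tgt d \<noteq> src d'" for d d'
    using assms(2)[of d] assms(4)[OF that(1)] cpairs_mem[OF that(1)] by (auto simp: lnk_def)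
  show "\<sigma> d \<noteq> []" if "d \<in> set xs" for d using assms(2)[OF that] by simp
qed (fact assms)+

text \<open>Meant for a class that gains no vertex, where relabelling keeps the ends of all
  chords.\<close>

lemma spread_class_map:
  assumes F: "family own A E F"
    and s: "inj_on s (E \<times> UNIV)" "(\<lambda>(d, d'). (s d, s d')) ` links F \<subseteq> Q"
    and U: "U = {v \<in> Field E \<inter> A. own v = i}"
    and same: "\<And>d d'. (d, d') \<in> links F \<Longrightarrow> own (tgt d) = i \<Longrightarrow> tgt (s d) = tgt d \<and> src (s d') = src d'"
  shows "spread U {p \<in> Q. own (tgt (fst p)) = i}"
proof (rule spread_map)
  let ?P = "{p \<in> links F. own (tgt (fst p)) = i}"
  show "spread U ?P" using F unfolding family_def U by blast
  show "inj_on (\<lambda>(d, d'). (s d, s d')) ?P"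
  proof (rule inj_onI)
    fix x y assume a: "x \<in> ?P" "y \<in> ?P" "(\<lambda>(d, d'). (s d, s d')) x = (\<lambda>(d, d'). (s d, s d')) y"
    obtain d d' e e' where x: "x = (d, d')" "y = (e, e')" by (cases x; cases y)
    then have "(d, d') \<in> links F" "(e, e') \<in> links F" "s d = s e" "s d' = s e'" using a by auto
    then show "x = y" using s(1) links_mem[OF F] unfolding x by (metis inj_onD)
  qed
  show "(\<lambda>(d, d'). (s d, s d')) ` ?P \<subseteq> {p \<in> Q. own (tgt (fst p)) = i}"
    using s(2) same by fastforce
qed (use same in auto)

text \<open>Meant for the class that gains \<open>n\<close>; \<open>a1\<close>, \<open>b1\<close>
  and \<open>a2\<close>, \<open>b2\<close> are the halves of the two subdivided chords. A half is
  either the relabelled old link or begins with a directed segment outside the range of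
  \<open>s\<close>, which keeps the halves apart from all other relabelled links.\<close>

lemma spread_class_subdivide:
  assumes F: "family own A E F" and E: "Field E \<subseteq> A"
    and s: "inj_on s (E \<times> UNIV)" "(\<lambda>(d, d'). (s d, s d')) ` links F \<subseteq> Q"
    and U: "U = insert n {v \<in> Field E \<inter> A. own v = i}" and n: "own n = i"
    and p: "(d1, d1') \<in> links F" "(d2, d2') \<in> links F" "(d1, d1') \<noteq> (d2, d2')"
      "own (tgt d1) = i" "own (tgt d2) = i"
    and ab: "\<And>x. x \<in> {a1, b1} \<Longrightarrow> x = (s d1, s d1') \<or> fst x \<notin> s ` (E \<times> UNIV)"
      "\<And>x. x \<in> {a2, b2} \<Longrightarrow> x = (s d2, s d2') \<or> fst x \<notin> s ` (E \<times> UNIV)"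
      "a1 \<noteq> a2" "b1 \<noteq> b2" "{a1, b1, a2, b2} \<subseteq> Q"
    and a: "tgt (fst a1) = tgt d1" "src (snd a1) = n" "tgt (fst a2) = tgt d2" "src (snd a2) = n"
    and b: "tgt (fst b1) = n" "src (snd b1) = src d1'" "tgt (fst b2) = n" "src (snd b2) = src d2'"
    and same: "\<And>d d'. (d, d') \<in> links F \<Longrightarrow> own (tgt d) = i \<Longrightarrow> (d, d') \<noteq> (d1, d1') \<Longrightarrow>
       (d, d') \<noteq> (d2, d2') \<Longrightarrow> tgt (s d) = tgt d \<and> src (s d') = src d'"
  shows "spread U {p \<in> Q. own (tgt (fst p)) = i}"
proof -
  let ?P = "{p \<in> links F. own (tgt (fst p)) = i}"
  let ?U = "{v \<in> Field E \<inter> A. own v = i}"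
  define m where "m = (\<lambda>(d, d'). (s d, s d'))"
  define f where "f = (\<lambda>p. if p = (d1, d1') then a1 else if p = (d2, d2') then a2 else m p)"
  define g where "g = (\<lambda>p. if p = (d1, d1') then b1 else if p = (d2, d2') then b2 else m p)"
  have minj: "m x = m y \<Longrightarrow> x = y" if "x \<in> links F" "y \<in> links F" for x y
  proof -
    assume e: "m x = m y"
    obtain d d' e e' where x: "x = (d, d')" "y = (e, e')" by (cases x; cases y)
    then have "(d, d') \<in> links F" "(e, e') \<in> links F" "s d = s e" "s d' = s e'"
      using that e by (auto simp: m_def)
    then show "x = y" using s(1) links_mem[OF F] unfolding x by (metis inj_onD)
  qed
  have mfst: "fst (m x) \<in> s ` (E \<times> UNIV)" if "x \<in> links F" for x
    using links_mem[OF F] that unfolding m_def by (cases x) auto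
  have fld: "src d \<in> Field E \<and> tgt d \<in> Field E" if "d \<in> E \<times> UNIV" for d
    using that by (cases d; cases "fst d"; cases "snd d") (auto simp: Field_def)
  have i': "own (src d') = i" if "(d, d') \<in> links F" "own (tgt d) = i" for d d'
    using links_lnk[OF F that(1)] that(2) by (simp add: lnk_def)
  have "spread (insert n ?U) {p \<in> Q. own (tgt (fst p)) = i}"
  proof (rule spread_subdivide[where ?p1.0 = "(d1, d1')" and ?p2.0 = "(d2, d2')" and f = f and g = g and n = n])
    show "spread ?U ?P" using F unfolding family_def by blast
    show "(d1, d1') \<in> ?P" "(d2, d2') \<in> ?P" "(d1, d1') \<noteq> (d2, d2')" using p by auto
    show "src (snd (d1, d1')) \<in> ?U" "src (snd (d2, d2')) \<in> ?U" "tgt (fst (d1, d1')) \<in> ?U"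
      "tgt (fst (d2, d2')) \<in> ?U"
    proof -
      have "d1 \<in> E \<times> UNIV" "d1' \<in> E \<times> UNIV" "d2 \<in> E \<times> UNIV" "d2' \<in> E \<times> UNIV"
        using links_mem[OF F p(1)] links_mem[OF F p(2)] by blast+
      then have "tgt d1 \<in> Field E" "src d1' \<in> Field E" "tgt d2 \<in> Field E" "src d2' \<in> Field E"
        using fld by blast+
      then show "src (snd (d1, d1')) \<in> ?U" "src (snd (d2, d2')) \<in> ?U" "tgt (fst (d1, d1')) \<in> ?U"
        "tgt (fst (d2, d2')) \<in> ?U"
        using p i'[OF p(1)] i'[OF p(2)] E by auto
    qed
    have m12: "(s d1, s d1') = m (d1, d1')" "(s d2, s d2') = m (d2, d2')" by (auto simp: m_def)
    have A: "a1 \<noteq> m y" if "y \<in> links F" "y \<noteq> (d1, d1')" for y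
      using ab(1)[of a1] minj[OF p(1) that(1)] that(2) mfst[OF that(1)] m12 by fastforce
    have B: "b1 \<noteq> m y" if "y \<in> links F" "y \<noteq> (d1, d1')" for y
      using ab(1)[of b1] minj[OF p(1) that(1)] that(2) mfst[OF that(1)] m12 by fastforce
    have C: "a2 \<noteq> m y" if "y \<in> links F" "y \<noteq> (d2, d2')" for y
      using ab(2)[of a2] minj[OF p(2) that(1)] that(2) mfst[OF that(1)] m12 by fastforce
    have D: "b2 \<noteq> m y" if "y \<in> links F" "y \<noteq> (d2, d2')" for y
      using ab(2)[of b2] minj[OF p(2) that(1)] that(2) mfst[OF that(1)] m12 by fastforce
    show "inj_on f ?P"
    proof (rule inj_onI)
      fix x y assume "x \<in> ?P" "y \<in> ?P" and e: "f x = f y"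
      then have "x \<in> links F" "y \<in> links F" by auto
      then show "x = y"
        using A[of x] A[of y] C[of x] C[of y] e ab(3) minj[of x y] by (simp add: f_def split: if_splits)
    qed
    show "inj_on g ?P"
    proof (rule inj_onI)
      fix x y assume "x \<in> ?P" "y \<in> ?P" and e: "g x = g y"
      then have "x \<in> links F" "y \<in> links F" by auto
      then show "x = y"
        using B[of x] B[of y] D[of x] D[of y] e ab(4) minj[of x y] by (simp add: g_def split: if_splits)
    qed
    have q: "m x \<in> Q \<and> own (tgt (fst (m x))) = i" if "x \<in> ?P" "x \<noteq> (d1, d1')" "x \<noteq> (d2, d2')" for x
    proof -
      obtain d d' where x: "x = (d, d')" by (cases x)
      have "m x \<in> Q" using s(2) that(1) unfolding m_def by blast
      then show ?thesis using same[of d d'] that by (auto simp: x m_def)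
    qed
    show "f ` ?P \<subseteq> {p \<in> Q. own (tgt (fst p)) = i}"
      using q ab(5) a p by (auto simp: f_def)
    show "g ` ?P \<subseteq> {p \<in> Q. own (tgt (fst p)) = i}"
      using q ab(5) b n by (auto simp: g_def)
    show "tgt (fst (f x)) = tgt (fst x) \<and> src (snd (g x)) = src (snd x)" if "x \<in> ?P" for x
      using same[of "fst x" "snd x"] that a b by (auto simp: f_def g_def m_def split: prod.splits)
    show "src (snd (f x)) = n \<and> tgt (fst (g x)) = n" if "x \<in> {(d1, d1'), (d2, d2')}" for x
      using that a b by (auto simp: f_def g_def)
    show "f x = g x" if "x \<in> ?P" "x \<notin> {(d1, d1'), (d2, d2')}" for x
      using that by (simp add: f_def g_def)
  qed
  then show ?thesis using U by simp
qed

section \<open>Local modifications\<close>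

abbreviation segs :: "'a list \<Rightarrow> ('a \<times> 'a) set" where
  "segs R \<equiv> set (zip R (tl R))"

lemma segs_mem: "(a, b) \<in> segs R \<Longrightarrow> a \<in> set R \<and> b \<in> set R"
  by (cases R) (auto dest: set_zip_leftD set_zip_rightD)

lemma Field_cpairs: "Field (set (cpairs w)) = set w"
proof (intro equalityI subsetI)
  fix x assume "x \<in> Field (set (cpairs w))"
  then show "x \<in> set w" by (auto simp: Field_def dest: cpairs_mem)
next
  fix x assume "x \<in> set w"
  then obtain b where "(x, b) \<in> set (cpairs w)" using cpairs_succ by metis
  then show "x \<in> Field (set (cpairs w))" by (auto simp: Field_def)
qed

definition straight :: "'a list \<Rightarrow> 'a dirseg list" where
  "straight R = map (\<lambda>e. (e, True)) (zip R (tl R))"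

lemma straight_Cons: "straight (a # b # R) = ((a, b), True) # straight (b # R)"
  by (simp add: straight_def)

lemma straight_props:
  "length R \<ge> 2 \<Longrightarrow> straight R \<noteq> [] \<and> src (hd (straight R)) = hd R \<and> tgt (last (straight R)) = last R \<and>
     inner (straight R) \<subseteq> Id"
proof (induction R)
  case (Cons a R)
  then obtain b R' where R: "R = b # R'" by (cases R) auto
  show ?case
  proof (cases R')
    case Nil
    then show ?thesis by (simp add: R straight_def)
  next
    case (Cons c R'')
    then have "straight R \<noteq> [] \<and> src (hd (straight R)) = hd R \<and> tgt (last (straight R)) = last R \<and>
      inner (straight R) \<subseteq> Id" using Cons.IH R by simp
    moreover have "straight (a # R) = [((a, b), True)] @ straight R" by (simp add: R straight_Cons)
    ultimately show ?thesis using inner_append[of "[((a, b), True)]" "straight R"] R by simp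
  qed
qed simp

lemma fst_straight: "fst ` set (straight R) = segs R"
  by (force simp: straight_def)

lemma distinct_straight: "distinct R \<Longrightarrow> distinct (map fst (straight R))"
  by (simp add: straight_def comp_def distinct_zipI1)

lemma chords_straight_append:
  assumes "R \<noteq> []" "ys \<noteq> []" "length R \<ge> 2 \<or> src (hd ys) = last R"
  shows "chords (straight R @ ys) \<subseteq> Id \<union> inner ys \<union> {(last R, src (hd ys)), (tgt (last ys), hd R)}"
proof (cases "length R \<ge> 2")
  case True
  note s = straight_props[OF True]
  then show ?thesis
    using chords_inner[of "straight R @ ys"] inner_append[of "straight R" ys] assms(2) by auto
next
  case False
  then obtain p where "R = [p]" using assms(1) by (cases R; cases "tl R") auto
  then show ?thesis using chords_inner[of ys] assms by (simp add: straight_def) blast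
qed

text \<open>The cocircuit of a new circuit runs along the untouched part \<open>R\<close> and then
  through \<open>ys\<close> near the modification. If \<open>R\<close> is one vertex it has no
  segment, and \<open>ys\<close> itself must start there.\<close>

lemma cocirc_straight:
  assumes "R \<noteq> []" "ys \<noteq> []" "length R \<ge> 2 \<or> src (hd ys) = last R" "distinct R"
    and "distinct (map fst ys)" "fst ` set ys \<inter> segs R = {}" "segs R \<union> fst ` set ys = E - fst ` set xs"
    and "\<forall>(u, v)\<in>inner ys \<union> {(last R, src (hd ys)), (tgt (last ys), hd R)}. zlnk (chords xs) u v"
  shows "\<exists>zs. cocirc E xs zs"
proof -
  have "zlnk (chords xs) u v" if "(u, v) \<in> chords (straight R @ ys)" for u v
  proof -
    have "u = v \<or> (u, v) \<in> inner ys \<union> {(last R, src (hd ys)), (tgt (last ys), hd R)}"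
      using chords_straight_append[OF assms(1-3)] that by blast
    then show ?thesis using assms(8) by (auto simp: zlnk_def)
  qed
  then have "cocirc E xs (straight R @ ys)"
    unfolding cocirc_def
    using assms distinct_straight[OF assms(4)] fst_straight[of R] by (auto simp: image_Un)
  then show ?thesis ..
qed

lemma chords_subst_mem:
  assumes "(d, d') \<in> set (cpairs xs)" "\<And>d. d \<in> set xs \<Longrightarrow> \<sigma> d \<noteq> []"
    "\<And>d. d \<in> set xs \<Longrightarrow> tgt (last (\<sigma> d)) = \<tau> (tgt d) \<and> src (hd (\<sigma> d)) = \<tau> (src d)"
  shows "(\<tau> (tgt d), \<tau> (src d')) \<in> chords (concat (map \<sigma> xs))"
proof -
  have "d \<in> set xs" "d' \<in> set xs" using cpairs_mem[OF assms(1)] by auto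
  then have "(\<tau> (tgt d), \<tau> (src d')) = (tgt (last (\<sigma> d)), src (hd (\<sigma> d')))" using assms(3) by simp
  then show ?thesis
    using chords_subst[of xs \<sigma>] assms(1,2) by (force simp: image_iff)
qed

lemma lnk_irrefl: "t \<in> A \<Longrightarrow> \<not> lnk own A t t"
  by (simp add: lnk_def)

lemma concat_singletons: "(\<And>x. x \<in> set xs \<Longrightarrow> f x = [x]) \<Longrightarrow> concat (map f xs) = xs"
  by (induction xs) auto

section \<open>A second attachment next to one of the same bridge\<close>

lemma UN_replace:
  "a \<notin> Y \<Longrightarrow> (\<Union>e\<in>insert a Y. fst ` set (if e = a then L else [(e, True)])) = fst ` set L \<union> Y"
  by (auto split: if_splits)

lemma image_replace: "a \<in> X \<Longrightarrow> (\<lambda>e. if e = a then b else e) ` X = insert b (X - {a})"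
  by (auto simp: image_iff)

text \<open>The new attachment \<open>t'\<close> takes over the segment from \<open>t\<close> to
  \<open>q\<close>. Each orientation of the new segment from \<open>t\<close> to \<open>t'\<close>
  becomes a circuit of its own, closed by a chord between its ends.\<close>

lemma family_duplicate:
  assumes F: "family own A (set (cpairs (t # R))) F" and w: "distinct (t # R)" "R \<noteq> []" "set (t # R) \<subseteq> A"
    and t': "t' \<notin> set (t # R)" "t' \<in> A" "own t' = own t"
  shows "\<exists>F'. family own A (set (cpairs (t # t' # R))) F'"
proof -
  define p where "p = last R"
  define q where "q = hd R"
  let ?E = "set (cpairs (t # R))" and ?E' = "set (cpairs (t # t' # R))"
  have pq: "p \<in> set R" "q \<in> set R" using w(2) by (auto simp: p_def q_def)
  have ne: "t \<noteq> p" "t \<noteq> q" "t' \<noteq> p" "t' \<noteq> q" "t \<noteq> t'" using pq w t' by auto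
  have E: "?E = insert (t, q) (insert (p, t) (segs R))"
    using w(2) by (auto simp: cpairs_Cons p_def q_def)
  have E': "?E' = insert (t, t') (insert (t', q) (insert (p, t) (segs R)))"
    using w(2) by (cases R) (auto simp: cpairs_Cons p_def q_def)
  have I: "a \<noteq> t \<and> a \<noteq> t' \<and> b \<noteq> t \<and> b \<noteq> t' \<and> a \<in> A \<and> b \<in> A" if "(a, b) \<in> segs R" for a b
    using segs_mem[OF that] w t' by auto
  have I' [simp]: "(t, x) \<notin> segs R" "(x, t) \<notin> segs R" "(t', x) \<notin> segs R" "(x, t') \<notin> segs R" for x
    using I by blast+
  define s :: "'a dirseg \<Rightarrow> 'a dirseg" where "s = (\<lambda>d. if fst d = (t, q) then ((t', q), snd d) else d)"
  define \<sigma> where "\<sigma> = (\<lambda>d. [s d])"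
  let ?N = "{[((t, t'), True)], [((t, t'), False)]}"
  have s_simps [simp]: "s ((t, q), c) = ((t', q), c)" "s ((p, t), c) = ((p, t), c)"
    "(a, b) \<in> segs R \<Longrightarrow> s ((a, b), c) = ((a, b), c)" for a b c
    using ne I[of a b] by (auto simp: s_def)
  have st: "tgt (s d) = (if d = ((t, q), False) then t' else tgt d)"
    "src (s d) = (if d = ((t, q), True) then t' else src d)" for d
    by (cases d; cases "fst d"; cases "snd d"; auto simp: s_def)+
  have ownst: "own (tgt (s d)) = own (tgt d)" for d unfolding st using t'(3) by simp
  have s_inj: "inj_on s (?E \<times> UNIV)" unfolding inj_on_def E using ne I by (auto simp: s_def)
  have s_inj2: "fst (s d) = fst (s e) \<Longrightarrow> fst d = fst e" if "d \<in> ?E \<times> UNIV" "e \<in> ?E \<times> UNIV" for d e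
    using that ne unfolding E by (auto simp: s_def dest: I split: if_splits)
  have A: "tgt d \<in> A" "src d \<in> A" if "d \<in> ?E \<times> UNIV" for d
    using that w pq I unfolding E by (auto simp: tgt_def src_def)
  have new_t': "tgt d \<noteq> t'" "src d \<noteq> t'" if "d \<in> ?E \<times> UNIV" for d
    using that ne I unfolding E by (auto simp: tgt_def src_def)
  have lnk': "lnk own A (tgt (s d)) (src (s d'))"
    if "lnk own A (tgt d) (src d')" "d \<in> ?E \<times> UNIV" "d' \<in> ?E \<times> UNIV" for d d'
    using that A[OF that(2)] A[OF that(3)] t' new_t'[OF that(2)] new_t'[OF that(3)]
    unfolding st lnk_def by auto
  have notin: "((t, t'), c) \<notin> s ` (?E \<times> UNIV)" for c
  proof
    assume "((t, t'), c) \<in> s ` (?E \<times> UNIV)"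
    then obtain d where d: "d \<in> ?E \<times> UNIV" "s d = ((t, t'), c)" by (metis imageE)
    then show False using ne unfolding E by (cases "fst d = (t, q)") (auto simp: s_def)
  qed
  show ?thesis
  proof (rule family_subst[OF F, of \<sigma> ?E' ?N])
    show "set (\<sigma> d) \<inter> set xs = {}" if "d \<in> ?E \<times> UNIV" "xs \<in> ?N" for d xs
    proof -
      have "s d \<noteq> ((t, t'), c)" for c using notin[of c] imageI[OF that(1), of s] by metis
      then show ?thesis using that(2) by (auto simp: \<sigma>_def)
    qed
  next
    fix xs assume xs: "xs \<in> F"
    note c = family_circ[OF F xs] and mem = family_mem[OF F xs]
    obtain zs where zs: "cocirc ?E xs zs" using family_cocirc[OF F xs] by blast
    have memp: "d \<in> ?E \<times> UNIV \<and> d' \<in> ?E \<times> UNIV" if "(d, d') \<in> set (cpairs xs)" for d d'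
      using cpairs_mem[OF that] mem by blast
    let ?xs = "concat (map \<sigma> xs)"
    have fx: "fst ` set ?xs = (fst \<circ> s) ` set xs" by (auto simp: \<sigma>_def image_image)
    have "circ own A ?xs"
    proof (rule circ_subst_att[OF c])
      show "own (tgt e) \<noteq> own (tgt e') \<and> fst e \<noteq> fst e'" 
        if d: "d \<in> set xs" "d' \<in> set xs" "d \<noteq> d'" "e \<in> set (\<sigma> d)" "e' \<in> set (\<sigma> d')" for d d' e e'
      proof -
        have "fst d \<noteq> fst d'" using c d by (auto simp: circ_def distinct_map inj_on_def)
        then show ?thesis
          using circ_tgt_inj[OF c d(1,2)] s_inj2[OF mem mem, OF d(1,2)] d(3-5) ownst by (auto simp: \<sigma>_def)
      qed
    qed (use lnk' circ_lnk[OF c] memp A[OF mem] t' in \<open>auto simp: \<sigma>_def st\<close>)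
    moreover have "\<exists>zs. cocirc ?E' ?xs zs"
    proof (cases "(t, q) \<in> fst ` set xs")
      case True
      then obtain d0 where d0: "d0 \<in> set xs" "fst d0 = (t, q)" by auto
      have uniq: "d = d0" if "d \<in> set xs" "src d = t \<or> tgt d = t" for d
        using circ_one_visit[OF c that(1) d0(1), of t] that(2) d0(2) w(3) by (auto simp: src_def tgt_def)
      \<comment> \<open>The circuit has only one segment at \<open>t\<close>, so all its chord ends
        at \<open>t\<close> move to \<open>t'\<close>. The cocircuit has to meet the moved chord,
        hence its segment from \<open>p\<close> to \<open>t\<close> is prolonged to
        \<open>t'\<close>.\<close>
      define \<tau> where "\<tau> = (\<lambda>v. if v = t then t' else v)"
      have tau: "tgt (s d) = \<tau> (tgt d) \<and> src (s d) = \<tau> (src d)" if "d \<in> set xs" for d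
        using uniq[OF that] d0(2) ne unfolding st \<tau>_def by (cases d; cases "snd d") auto
      have pt: "(p, t) \<notin> fst ` set xs"
        using uniq d0(2) ne by (auto simp: src_def tgt_def split: if_splits)
      have fx2: "fst ` set ?xs = insert (t', q) (fst ` set xs - {(t, q)})"
      proof -
        have "(fst \<circ> s) ` set xs = (\<lambda>e. if e = (t, q) then (t', q) else e) ` fst ` set xs"
          unfolding image_image by (rule image_cong) (simp_all add: s_def)
        then show ?thesis unfolding fx image_replace[OF True] .
      qed
      let ?\<zeta> = "\<lambda>e. if e = (p, t) then [((p, t), True), ((t, t'), True)] else [(e, True)]"
      show ?thesis
      proof (rule cocirc_subst[OF zs, of ?\<zeta> \<tau>])
        show "(\<tau> (tgt d), \<tau> (src d')) \<in> chords ?xs" if "(d, d') \<in> set (cpairs xs)" for d d'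
          by (rule chords_subst_mem[OF that]) (auto simp: \<sigma>_def tau)
        show "(\<Union>e\<in>?E - fst ` set xs. fst ` set (?\<zeta> e)) = ?E' - fst ` set ?xs"
        proof -
          define X where "X = fst ` set xs"
          have "?E - X = insert (p, t) (segs R - X)" unfolding E using True pt by (auto simp: X_def)
          moreover have "insert (t', q) (X - {(t, q)}) \<subseteq> insert (t', q) ?E" using mem by (auto simp: X_def)
          moreover have "?E' - insert (t', q) (X - {(t, q)}) = {(t, t'), (p, t)} \<union> (segs R - X)"
            unfolding E' using True pt ne calculation(2) unfolding E by (auto simp: X_def[symmetric])
          moreover have "(p, t) \<notin> segs R - X" by simp
          note UN_replace[OF this, of "[((p, t), True), ((t, t'), True)]"]
          ultimately show ?thesis unfolding fx2 X_def[symmetric] by auto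
        qed
      qed (use True E I ne in \<open>auto simp: \<tau>_def zlnk_def\<close>)
    next
      \<comment> \<open>The circuit stays as it is, and its cocircuit goes straight through
        \<open>t'\<close>.\<close>
      case False
      have "s d = d" if "d \<in> set xs" for d using False that by (force simp: s_def)
      then have xs': "?xs = xs" by (intro concat_singletons) (simp add: \<sigma>_def)
      let ?\<zeta> = "\<lambda>e. if e = (t, q) then [((t, t'), True), ((t', q), True)] else [(e, True)]"
      have mem': "(p, t) \<in> ?E \<and> (t, q) \<in> ?E \<and> segs R \<subseteq> ?E" unfolding E by blast
      show ?thesis unfolding xs'
      proof (rule cocirc_subst[OF zs, of ?\<zeta> id])
        show "(id (tgt d), id (src d')) \<in> chords xs" if "(d, d') \<in> set (cpairs xs)" for d d'
          using chordsI[OF that] by simp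
        show "(\<Union>e\<in>?E - fst ` set xs. fst ` set (?\<zeta> e)) = ?E' - fst ` set xs"
        proof -
          define X where "X = fst ` set xs"
          have "X \<subseteq> ?E" using mem by (auto simp: X_def)
          then have "(t, t') \<notin> X" "(t', q) \<notin> X" unfolding E using ne by auto
          moreover have "(t, q) \<notin> X" using False by (simp add: X_def)
          then have "?E - X = insert (t, q) (insert (p, t) (segs R) - X)" unfolding E by auto
          moreover have "(t, q) \<notin> insert (p, t) (segs R) - X" using ne by simp
          note UN_replace[OF this, of "[((t, t'), True), ((t', q), True)]"]
          moreover have "?E' - X = {(t, t'), (t', q)} \<union> (insert (p, t) (segs R) - X)"
            unfolding E' using \<open>(t, t') \<notin> X\<close> \<open>(t', q) \<notin> X\<close> by blast
          ultimately show ?thesis unfolding X_def[symmetric] by simp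
        qed
      qed (use False E I ne in \<open>auto simp: zlnk_def\<close>)
    qed
    ultimately show "circ own A ?xs \<and> (\<exists>zs. cocirc ?E' ?xs zs)" ..
  next
    show "circ own A xs \<and> (\<exists>zs. cocirc ?E' xs zs)" if "xs \<in> ?N" for xs
    proof
      from that obtain c where xs: "xs = [((t, t'), c)]" by blast
      show "circ own A xs" using w t' ne by (cases c) (auto simp: xs circ_def chords_def lnk_def)
      \<comment> \<open>Left over are the old segments: along \<open>R\<close> and on to
        \<open>t\<close>, over the chord to \<open>t'\<close>, and back to \<open>R\<close>.\<close>
      show "\<exists>zs. cocirc ?E' xs zs"
        by (rule cocirc_straight[of R "[((p, t), True), ((t', q), True)]"])
          (use w ne I in \<open>cases c; auto simp: xs E' p_def q_def zlnk_def chords_def dest: segs_mem\<close>)+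
    qed
  next
    show "(\<Union>d\<in>?E \<times> UNIV. set (\<sigma> d)) \<union> (\<Union>xs\<in>?N. set xs) = ?E' \<times> UNIV" (is "?L = _")
    proof -
      have "?L = s ` (?E \<times> UNIV) \<union> {(t, t')} \<times> UNIV" unfolding \<sigma>_def by auto
      also have "s ` (?E \<times> UNIV) = ({(t', q), (p, t)} \<union> segs R) \<times> UNIV"
        unfolding E using ne I by (force simp: s_def image_iff split: if_splits)
      finally show ?thesis unfolding E' by auto
    qed
  next
    fix i
    let ?Q = "(\<lambda>(d, d'). (last (\<sigma> d), hd (\<sigma> d'))) ` links F \<union>
      (\<Union>d\<in>?E \<times> UNIV. set (zip (\<sigma> d) (tl (\<sigma> d)))) \<union> links ?N"
    show "spread {v \<in> Field ?E' \<inter> A. own v = i} {p \<in> ?Q. own (tgt (fst p)) = i}"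
    proof (cases "i = own t")
      case False
      show ?thesis
      proof (rule spread_class_map[OF F s_inj])
        show "{v \<in> Field ?E' \<inter> A. own v = i} = {v \<in> Field ?E \<inter> A. own v = i}"
          unfolding Field_cpairs using False t' by auto
        show "tgt (s d) = tgt d \<and> src (s d') = src d'" if "(d, d') \<in> links F" "own (tgt d) = i" for d d'
          using links_lnk[OF F that(1)] that(2) False unfolding st by (auto simp: lnk_def)
      qed (auto simp: \<sigma>_def)
    next
      case True
      \<comment> \<open>The two chords subdivided by \<open>t'\<close>: the one into
        \<open>t\<close> in front of the forward segment, and the one out of \<open>t\<close> behind
        the backward segment.\<close>
      obtain d1 where d1: "(d1, ((t, q), True)) \<in> links F"
        using links_pred[OF F, of "((t, q), True)"] E by auto
      obtain d2 where d2: "(((t, q), False), d2) \<in> links F"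
        using links_succ[OF F, of "((t, q), False)"] E by auto
      have l: "lnk own A (tgt d1) t" "lnk own A t (src d2)"
        using links_lnk[OF F d1] links_lnk[OF F d2] by auto
      have tA: "t \<in> A" using w by simp
      have d12: "d1 \<noteq> ((t, q), False)" "d2 \<noteq> ((t, q), True)"
        using l lnk_irrefl[OF tA] by (metis tgt_simps(2), metis src_simps(1))
      have mQ: "(s d, s d') \<in> ?Q" if "(d, d') \<in> links F" for d d'
        using imageI[OF that, of "\<lambda>(d, d'). (last (\<sigma> d), hd (\<sigma> d'))"] by (simp add: \<sigma>_def)
      have nQ: "(((t, t'), c), ((t, t'), c)) \<in> ?Q" for c
        by (cases c) (auto simp: links_def)
      show ?thesis
      proof (rule spread_class_subdivide[OF F _ s_inj, where n = t' and ?a1.0 = "(s d1, ((t', q), True))"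
            and ?b1.0 = "(((t, t'), True), ((t, t'), True))" and ?a2.0 = "(((t, t'), False), ((t, t'), False))"
            and ?b2.0 = "(((t', q), False), s d2)", OF _ _ _ _ d1 d2])
        show "tgt (s d) = tgt d \<and> src (s d') = src d'"
          if "(d, d') \<in> links F" "(d, d') \<noteq> (d1, ((t, q), True))" "(d, d') \<noteq> (((t, q), False), d2)" for d d'
          using links_inj[OF F that(1) d1] links_inj[OF F that(1) d2] that unfolding st by auto
        show "{v \<in> Field ?E' \<inter> A. own v = i} = insert t' {v \<in> Field ?E \<inter> A. own v = i}"
          unfolding Field_cpairs using True t' by auto
        show "{(s d1, ((t', q), True)), (((t, t'), True), ((t, t'), True)),
           (((t, t'), False), ((t, t'), False)), (((t', q), False), s d2)} \<subseteq> ?Q"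
          using mQ[OF d1] mQ[OF d2] nQ by simp
        show "x = (s d1, s ((t, q), True)) \<or> fst x \<notin> s ` (?E \<times> UNIV)"
          if "x \<in> {(s d1, ((t', q), True)), (((t, t'), True), ((t, t'), True))}" for x
          using that notin[of True] by (elim insertE emptyE) simp_all
        show "x = (s ((t, q), False), s d2) \<or> fst x \<notin> s ` (?E \<times> UNIV)"
          if "x \<in> {(((t, t'), False), ((t, t'), False)), (((t', q), False), s d2)}" for x
          using that notin[of False] by (elim insertE emptyE) simp_all
        show "(s d1, ((t', q), True)) \<noteq> (((t, t'), False), ((t, t'), False))"
          "(((t, t'), True), ((t, t'), True)) \<noteq> (((t', q), False), s d2)" using ne by auto
        show "(\<lambda>(d, d'). (s d, s d')) ` links F \<subseteq> ?Q" by (auto simp: \<sigma>_def)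
      qed (use d1 d2 d12 l w True t' ne in \<open>auto simp: Field_cpairs lnk_def st\<close>)
    qed
  qed (use s_inj in \<open>auto simp: \<sigma>_def inj_on_def\<close>)
qed

section \<open>Two further alternating attachments\<close>

lemma circ_fst_inj:
  "circ own A xs \<Longrightarrow> d \<in> set xs \<Longrightarrow> d' \<in> set xs \<Longrightarrow> fst d = fst d' \<Longrightarrow> d = d'"
  by (auto simp: circ_def distinct_map inj_on_def)

text \<open>Substitution by single segments with all ends at attachments. The circuits in
  \<open>N\<close> take up the directed segments outside the range of \<open>s\<close>.\<close>

lemma family_relabel:
  assumes F: "family own A E F"
    and s_inj: "inj_on s (E \<times> UNIV)"
    and s_fst: "\<And>d e. d \<in> E \<times> UNIV \<Longrightarrow> e \<in> E \<times> UNIV \<Longrightarrow> fst (s d) = fst (s e) \<Longrightarrow> fst d = fst e"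
    and own: "\<And>d. own (tgt (s d)) = own (tgt d)"
    and att: "\<And>d. d \<in> E \<times> UNIV \<Longrightarrow> tgt (s d) \<in> A"
    and lnk': "\<And>d d'. lnk own A (tgt d) (src d') \<Longrightarrow> d \<in> E \<times> UNIV \<Longrightarrow> d' \<in> E \<times> UNIV \<Longrightarrow>
       lnk own A (tgt (s d)) (src (s d'))"
    and co: "\<And>xs. xs \<in> F \<Longrightarrow> \<exists>zs. cocirc E' (map s xs) zs"
    and N: "\<And>xs. xs \<in> N \<Longrightarrow> circ own A xs \<and> (\<exists>zs. cocirc E' xs zs)"
    and cover: "s ` (E \<times> UNIV) \<union> (\<Union>xs\<in>N. set xs) = E' \<times> UNIV"
    and dj: "\<And>d. d \<in> (\<Union>xs\<in>N. set xs) \<Longrightarrow> d \<notin> s ` (E \<times> UNIV)"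
      "\<And>xs ys. xs \<in> N \<Longrightarrow> ys \<in> N \<Longrightarrow> xs \<noteq> ys \<Longrightarrow> set xs \<inter> set ys = {}"
    and spr: "\<And>i. spread {v \<in> Field E' \<inter> A. own v = i}
       {p \<in> (\<lambda>(d, d'). (s d, s d')) ` links F \<union> links N. own (tgt (fst p)) = i}"
  shows "\<exists>F'. family own A E' F'"
proof (rule family_subst[OF F, of "\<lambda>d. [s d]" E' N])
  have cm: "concat (map (\<lambda>d. [s d]) xs) = map s xs" for xs by (induction xs) auto
  fix xs assume xs: "xs \<in> F"
  note c = family_circ[OF F xs] and mem = family_mem[OF F xs]
  have "circ own A (concat (map (\<lambda>d. [s d]) xs))"
  proof (rule circ_subst_att[OF c])
    show "lnk own A (tgt (last [s d])) (src (hd [s d']))" if "(d, d') \<in> set (cpairs xs)" for d d'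
      using lnk'[OF circ_lnk[OF c that]] cpairs_mem[OF that] mem by simp
    show "own (tgt e) \<noteq> own (tgt e') \<and> fst e \<noteq> fst e'"
      if d: "d \<in> set xs" "d' \<in> set xs" "d \<noteq> d'" "e \<in> set [s d]" "e' \<in> set [s d']" for d d' e e'
    proof -
      have "fst d \<noteq> fst d'" using c d by (auto simp: circ_def distinct_map inj_on_def)
      then show ?thesis
        using circ_tgt_inj[OF c d(1,2)] s_fst[OF mem mem, OF d(1,2)] d(3-5) own by auto
    qed
  qed (use att[OF mem] in auto)
  then show "circ own A (concat (map (\<lambda>d. [s d]) xs)) \<and>
      (\<exists>zs. cocirc E' (concat (map (\<lambda>d. [s d]) xs)) zs)"
    using co[OF xs] unfolding cm by simp
next
  show "(\<Union>d\<in>E \<times> UNIV. set [s d]) \<union> (\<Union>xs\<in>N. set xs) = E' \<times> UNIV"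
    unfolding cover[symmetric] by auto
  show "set [s d] \<inter> set xs = {}" if "d \<in> E \<times> UNIV" "xs \<in> N" for d xs
  proof -
    have "s d \<in> s ` (E \<times> UNIV)" using that(1) by (rule imageI)
    then have "s d \<notin> set xs" using dj(1) that(2) by blast
    then show ?thesis by simp
  qed
  show "set [s d] \<inter> set [s d'] = {}" if "d \<in> E \<times> UNIV" "d' \<in> E \<times> UNIV" "d \<noteq> d'" for d d'
    using inj_onD[OF s_inj _ that(1,2)] that(3) by auto
  have Q: "(\<lambda>(d, d'). (last [s d], hd [s d'])) ` links F \<union> (\<Union>d\<in>E \<times> UNIV. set (zip [s d] (tl [s d]))) \<union>
      links N = (\<lambda>(d, d'). (s d, s d')) ` links F \<union> links N" by simp
  show "spread {v \<in> Field E' \<inter> A. own v = i}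
      {p \<in> (\<lambda>(d, d'). (last [s d], hd [s d'])) ` links F \<union> (\<Union>d\<in>E \<times> UNIV. set (zip [s d] (tl [s d]))) \<union>
        links N. own (tgt (fst p)) = i}" for i
    unfolding Q by (rule spr)
qed (use N dj(2) in auto)

lemma chords_map_mem:
  assumes "(d, d') \<in> set (cpairs xs)"
    "\<And>d. d \<in> set xs \<Longrightarrow> tgt (s d) = \<tau> (tgt d) \<and> src (s d) = \<tau> (src d)"
  shows "(\<tau> (tgt d), \<tau> (src d')) \<in> chords (map s xs)"
proof -
  have "d \<in> set xs" "d' \<in> set xs" using cpairs_mem[OF assms(1)] by auto
  moreover have "(s d, s d') \<in> set (cpairs (map s xs))"
    using assms(1) by (force simp: cpairs_map)
  ultimately show ?thesis using assms(2) chordsI[of "s d" "s d'" "map s xs"] by simp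
qed

text \<open>In applications only a few segments, \<open>B\<close>, of the cocircuit are rerouted;
  the others, \<open>Y\<close>, avoid all vertices that \<open>\<tau>\<close> moves.\<close>

lemma cocirc_replace:
  fixes \<zeta> :: "'a \<times> 'a \<Rightarrow> 'a dirseg list"
  assumes zs: "cocirc E xs zs" and EX: "E - fst ` set xs = B \<union> Y" "B \<inter> Y = {}"
    and z: "\<And>a b. (a, b) \<in> B \<Longrightarrow> \<zeta> (a, b) \<noteq> [] \<and> src (hd (\<zeta> (a, b))) = \<tau> a \<and>
       tgt (last (\<zeta> (a, b))) = \<tau> b \<and> distinct (map fst (\<zeta> (a, b))) \<and>
       (\<forall>(u, v)\<in>inner (\<zeta> (a, b)). zlnk (chords xs') u v) \<and> fst ` set (\<zeta> (a, b)) \<inter> Y = {}"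
    and dj: "\<And>e e' d d'. e \<in> B \<Longrightarrow> e' \<in> B \<Longrightarrow> e \<noteq> e' \<Longrightarrow>
       d \<in> set (\<zeta> e) \<Longrightarrow> d' \<in> set (\<zeta> e') \<Longrightarrow> fst d \<noteq> fst d'"
    and Y: "\<And>a b. (a, b) \<in> Y \<Longrightarrow> \<tau> a = a \<and> \<tau> b = b"
    and cover: "E' - fst ` set xs' = (\<Union>e\<in>B. fst ` set (\<zeta> e)) \<union> Y"
    and ch: "\<And>d d'. (d, d') \<in> set (cpairs xs) \<Longrightarrow> (\<tau> (tgt d), \<tau> (src d')) \<in> chords xs'"
  shows "\<exists>zs'. cocirc E' xs' zs'"
proof (rule cocirc_subst[OF zs, of "\<lambda>e. if e \<in> B then \<zeta> e else [(e, True)]" \<tau> xs' E'])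
  let ?\<zeta> = "\<lambda>e. if e \<in> B then \<zeta> e else [(e, True)]"
  fix a b assume ab: "(a, b) \<in> E - fst ` set xs"
  show "?\<zeta> (a, b) \<noteq> [] \<and> src (hd (?\<zeta> (a, b))) = \<tau> a \<and> tgt (last (?\<zeta> (a, b))) = \<tau> b \<and>
      distinct (map fst (?\<zeta> (a, b))) \<and> (\<forall>(u, v)\<in>inner (?\<zeta> (a, b)). zlnk (chords xs') u v)"
  proof (cases "(a, b) \<in> B")
    case True
    then show ?thesis using z[OF True] by simp
  next
    case False
    then have "(a, b) \<in> Y" using ab EX by blast
    then show ?thesis using Y False by simp
  qed
next
  let ?\<zeta> = "\<lambda>e. if e \<in> B then \<zeta> e else [(e, True)]"
  fix e e' d d'
  assume e: "e \<in> E - fst ` set xs" "e' \<in> E - fst ` set xs" "e \<noteq> e'" "d \<in> set (?\<zeta> e)" "d' \<in> set (?\<zeta> e')"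
  have BY: "fst x \<noteq> y" if "b \<in> B" "x \<in> set (\<zeta> b)" "y \<in> Y" for b x y
    using z[of "fst b" "snd b"] that by auto
  have eY: "e \<in> B \<or> e \<in> Y" "e' \<in> B \<or> e' \<in> Y" using e(1,2) EX by blast+
  show "fst d \<noteq> fst d'"
    using e(3-5) eY dj[of e e' d d'] BY[of e d e'] BY[of e' d' e] by (auto split: if_splits)
next
  let ?\<zeta> = "\<lambda>e. if e \<in> B then \<zeta> e else [(e, True)]"
  have "(\<Union>e\<in>Y. fst ` set (?\<zeta> e)) = (\<Union>e\<in>Y. {e})"
    by (rule SUP_cong[OF refl]) (use EX(2) in auto)
  then have "(\<Union>e\<in>B \<union> Y. fst ` set (?\<zeta> e)) = (\<Union>e\<in>B. fst ` set (\<zeta> e)) \<union> Y"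
    by (simp add: UN_Un)
  then show "(\<Union>e\<in>E - fst ` set xs. fst ` set (if e \<in> B then \<zeta> e else [(e, True)])) = E' - fst ` set xs'"
    unfolding EX(1) cover .
qed (rule ch)

text \<open>The order \<open>u1\<close>, \<open>t\<close>, \<open>u3\<close> becomes
  \<open>u1\<close>, \<open>t\<close>, \<open>u2\<close>, \<open>t2\<close>, \<open>u3\<close>. One
  new circuit goes from \<open>t\<close> to \<open>u2\<close>, by a chord to \<open>u3\<close>, to
  \<open>t2\<close>, and by a chord back to \<open>t\<close>; the other one from \<open>u1\<close>
  to \<open>t\<close>, by a chord to \<open>t2\<close>, to \<open>u2\<close>, and by a chord back to
  \<open>u1\<close>. They take four of the eight local directed segments; the other four carry the
  old circuits.\<close>

lemma family_interleave:
  assumes F: "family own A (set (cpairs (t # R))) F"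
    and w: "distinct (t # R)" "length R \<ge> 2" "set (t # R) \<subseteq> A"
    and new: "u2 \<notin> set (t # R)" "t2 \<notin> set (t # R)" "u2 \<noteq> t2" "u2 \<in> A" "t2 \<in> A" "own t2 = own t"
      "own u2 = own (hd R)" "own (last R) = own (hd R)" "own t \<noteq> own (hd R)"
  shows "\<exists>F'. family own A (set (cpairs (t # u2 # t2 # R))) F'"
proof -
  define u1 where "u1 = last R"
  define u3 where "u3 = hd R"
  let ?E = "set (cpairs (t # R))" and ?E' = "set (cpairs (t # u2 # t2 # R))"
  obtain q R1 where R1: "R = u3 # q # R1" using w(2) unfolding u3_def by (cases R; cases "tl R") auto
  have R2: "R = butlast R @ [u1]" using w(2) unfolding u1_def by (cases R) auto
  define p where "p = last (butlast R)"
  have bl: "butlast R \<noteq> []" using R1 by simp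
  have u: "u1 \<in> set R" "u3 \<in> set R" "u1 \<noteq> u3" using R1 w by (auto simp: u1_def)
  have ne: "t \<noteq> u1" "t \<noteq> u3" "t2 \<noteq> u1" "t2 \<noteq> u3" "u2 \<noteq> u1" "u2 \<noteq> u3" "u2 \<noteq> t" "t2 \<noteq> t" "u2 \<noteq> t2" "u1 \<noteq> u3"
    using u w new by auto
  have ow: "own t2 = own t" "own u2 = own u1" "own u3 = own u1" "own t \<noteq> own u1"
    using new by (auto simp: u1_def u3_def)
  have inA: "t \<in> A" "u1 \<in> A" "u3 \<in> A" "u2 \<in> A" "t2 \<in> A" using u w new by auto
  have Rne: "R \<noteq> []" using R1 by simp
  have E: "?E = insert (t, u3) (insert (u1, t) (segs R))"
    using Rne by (auto simp: cpairs_Cons u1_def u3_def)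
  have E': "?E' = insert (t, u2) (insert (u2, t2) (insert (t2, u3) (insert (u1, t) (segs R))))"
    using Rne by (cases R) (auto simp: cpairs_Cons u1_def u3_def)
  have I: "a \<noteq> t \<and> a \<noteq> t2 \<and> a \<noteq> u2 \<and> b \<noteq> t \<and> b \<noteq> t2 \<and> b \<noteq> u2 \<and> a \<in> A \<and> b \<in> A" if "(a, b) \<in> segs R" for a b
    using segs_mem[OF that] w new by auto
  have I' [simp]: "(t, x) \<notin> segs R" "(x, t) \<notin> segs R" "(t2, x) \<notin> segs R" "(x, t2) \<notin> segs R"
    "(u2, x) \<notin> segs R" "(x, u2) \<notin> segs R" for x
    using I by blast+
  have q: "segs R = insert (u3, q) (segs (q # R1))" "u3 \<notin> set (q # R1)" using R1 w by auto
  have q1: "(u3, x) \<in> segs R \<longleftrightarrow> x = q" "(x, u3) \<notin> segs R" for x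
    using q segs_mem[of _ _ "q # R1"] by auto
  have p: "segs R = insert (p, u1) (segs (butlast R))"
  proof -
    have "segs R = segs (butlast R @ [u1])" by (rule arg_cong[OF R2])
    also have "\<dots> = insert (p, u1) (segs (butlast R))"
      using zip_tl_append[OF bl, of "[u1]"] by (simp add: p_def bl)
    finally show ?thesis .
  qed
  have "distinct (butlast R @ [u1])" using R2 w(1) by (metis distinct.simps(2))
  then have "u1 \<notin> set (butlast R)" by simp
  then have p1: "(x, u1) \<in> segs R \<longleftrightarrow> x = p" "(u1, x) \<notin> segs R" for x
    using p segs_mem[of _ _ "butlast R"] last_in_set[OF bl] unfolding p_def by auto
  define s :: "'a dirseg \<Rightarrow> 'a dirseg" where
    "s = (\<lambda>d. if d = ((t, u3), True) then ((t2, u3), True) else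
       if d = ((t, u3), False) then ((t, u2), False) else
       if d = ((u1, t), True) then ((u2, t2), True) else d)"
  let ?N1 = "[((t, u2), True), ((t2, u3), False)]" and ?N2 = "[((u1, t), True), ((u2, t2), False)]"
  let ?N = "{?N1, ?N2}"
  have st: "tgt (s d) = (if d = ((u1, t), True) then t2 else tgt d)"
    "src (s d) = (if d = ((t, u3), True) then t2 else if d = ((t, u3), False) then u2 else
       if d = ((u1, t), True) then u2 else src d)" for d
    by (cases "d = ((t, u3), True)"; cases "d = ((t, u3), False)"; cases "d = ((u1, t), True)";
        simp add: s_def ne)+
  have s_inj: "inj_on s (?E \<times> UNIV)" unfolding inj_on_def E using ne by (auto simp: s_def)
  have s_fst: "fst (s d) = fst (s e) \<Longrightarrow> fst d = fst e" if "d \<in> ?E \<times> UNIV" "e \<in> ?E \<times> UNIV" for d e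
    using that ne unfolding E by (auto simp: s_def split: if_splits)
  have A: "tgt d \<in> A" "src d \<in> A" if "d \<in> ?E \<times> UNIV" for d
    using that inA I unfolding E by (auto simp: tgt_def src_def)
  have old: "tgt d \<noteq> t2" "src d \<noteq> t2" "tgt d \<noteq> u2" "src d \<noteq> u2" if "d \<in> ?E \<times> UNIV" for d
    using that ne I unfolding E by (auto simp: tgt_def src_def)
  have lnk': "lnk own A (tgt (s d)) (src (s d'))"
    if "lnk own A (tgt d) (src d')" "d \<in> ?E \<times> UNIV" "d' \<in> ?E \<times> UNIV" for d d'
    using that A[OF that(2)] A[OF that(3)] inA ow ne old[OF that(2)] old[OF that(3)]
    unfolding st lnk_def by (auto split: if_splits)
  have cover_s: "s ` (?E \<times> UNIV) = {((t2, u3), True), ((t, u2), False), ((u2, t2), True), ((u1, t), False)} \<union>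
      segs R \<times> UNIV"
  proof -
    have "?E \<times> UNIV = {((t, u3), True), ((t, u3), False), ((u1, t), True), ((u1, t), False)} \<union> segs R \<times> UNIV"
      unfolding E by (auto simp: UNIV_bool)
    moreover have "s ` (segs R \<times> UNIV) = segs R \<times> UNIV"
    proof -
      have "s d = d" if "d \<in> segs R \<times> UNIV" for d using that ne by (auto simp: s_def)
      then show ?thesis by simp
    qed
    ultimately show ?thesis using ne by (simp add: image_Un s_def) blast
  qed
  show ?thesis
  proof (rule family_relabel[OF F s_inj s_fst _ _ lnk', of ?E' ?N])
    fix xs assume xs: "xs \<in> F"
    note c = family_circ[OF F xs] and mem = family_mem[OF F xs]
    obtain zs where zs: "cocirc ?E xs zs" using family_cocirc[OF F xs] by blast
    define X where "X = fst ` set xs"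
    have XE: "X \<subseteq> ?E" using mem by (auto simp: X_def)
    have uniq: "d = e" if "d \<in> set xs" "e \<in> set xs" "x \<in> {t, u1, u3}" "src d = x \<or> tgt d = x" "src e = x \<or> tgt e = x" for d e x
    proof -
      have "x \<in> A" using that(3) inA by auto
      then show ?thesis using circ_one_visit[OF c that(1,2)] that(4,5) by metis
    qed
    have X: "fst ` set xs = X" by (simp add: X_def)
    have repl: "fst ` set (map s xs) = insert b (X - {a})"
      if d0: "d0 \<in> set xs" "fst d0 = a" "fst (s d0) = b"
        "\<And>d. d \<in> set xs \<Longrightarrow> d \<noteq> d0 \<Longrightarrow> fst (s d) = fst d" for a b d0
    proof -
      have uq: "d = d0" if "d \<in> set xs" "fst d = a" for d
        using circ_fst_inj[OF c that(1) d0(1)] that(2) d0(2) by simp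
      have sd: "fst (s d) = (if fst d = a then b else fst d)" if "d \<in> set xs" for d
      proof (cases "d = d0")
        case True
        then show ?thesis using d0(2,3) by simp
      next
        case False
        then have "fst d \<noteq> a" using uq[OF that] by blast
        then show ?thesis using d0(4)[OF that False] by simp
      qed
      have "fst ` set (map s xs) = (\<lambda>e. if e = a then b else e) ` X"
      proof -
        have "fst ` set (map s xs) = (\<lambda>d. fst (s d)) ` set xs" by (simp only: set_map image_image)
        also have "\<dots> = (\<lambda>d. if fst d = a then b else fst d) ` set xs" by (rule image_cong[OF refl]) (rule sd)
        also have "\<dots> = (\<lambda>e. if e = a then b else e) ` X" by (simp only: X_def image_image)
        finally show ?thesis .
      qed
      moreover have "a \<in> X" unfolding X_def using imageI[OF d0(1), of fst] d0(2) by simp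
      ultimately show ?thesis by (simp only: image_replace)
    qed
    have only: "s d = d \<and> src d \<noteq> x \<and> tgt d \<noteq> x"
      if "d0 \<in> set xs" "t = src d0 \<or> t = tgt d0" "x = src d0 \<or> x = tgt d0" "x \<in> {t, u1, u3}"
        "d \<in> set xs" "d \<noteq> d0" for d d0 x
    proof -
      have "src d \<noteq> t" "tgt d \<noteq> t" "src d \<noteq> x" "tgt d \<noteq> x"
        using uniq[OF that(5,1), of t] uniq[OF that(5,1), of x] that by auto
      moreover from this have "s d = d" by (auto simp: s_def)
      ultimately show ?thesis by blast
    qed
    have ch: "(\<tau> (tgt d), \<tau> (src d')) \<in> chords (map s xs)"
      if "\<And>d. d \<in> set xs \<Longrightarrow> tgt (s d) = \<tau> (tgt d) \<and> src (s d) = \<tau> (src d)" "(d, d') \<in> set (cpairs xs)"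
      for d d' \<tau> using chords_map_mem[OF that(2,1)] .
    have notX': "(t, u2) \<notin> X" "(u2, t2) \<notin> X" "(t2, u3) \<notin> X"
      using XE ne unfolding E by auto
    have notX: "e \<notin> X" if "d0 \<in> set xs" "fst d0 \<noteq> e" "x \<in> {t, u1, u3}" "src d0 = x \<or> tgt d0 = x"
      "fst e = x \<or> snd e = x" for d0 e x
    proof
      assume "e \<in> X"
      then obtain d where d: "d \<in> set xs" "fst d = e" by (auto simp: X_def)
      then have "src d = x \<or> tgt d = x" using that(5) by (auto simp: src_def tgt_def)
      then show False using uniq[OF d(1) that(1,3)] that(2,4) d(2) by blast
    qed
    \<comment> \<open>The three moved directed segments all meet \<open>t\<close>, and a circuit has
      only one segment there, so it contains at most one of them.\<close>
    consider (A) "((t, u3), False) \<in> set xs" | (B) "((t, u3), True) \<in> set xs"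
      | (C) "((u1, t), True) \<in> set xs"
      | (D) "((t, u3), False) \<notin> set xs" "((t, u3), True) \<notin> set xs" "((u1, t), True) \<notin> set xs" by blast
    then show "\<exists>zs. cocirc ?E' (map s xs) zs"
    proof cases
      case A
      have o: "s d = d \<and> src d \<noteq> u3 \<and> tgt d \<noteq> u3" if "d \<in> set xs" "d \<noteq> ((t, u3), False)" for d
        using only[OF A, of u3] that by simp
      have X': "fst ` set (map s xs) = insert (t, u2) (X - {(t, u3)})"
        by (rule repl[OF A]) (use o ne in \<open>auto simp: s_def\<close>)
      have nX: "(u1, t) \<notin> X" "(u3, q) \<notin> X" "(t, u3) \<in> X"
        using notX[OF A, of "(u1, t)" t] notX[OF A, of "(u3, q)" u3] imageI[OF A, of fst] ne
        unfolding X_def by simp_all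
      \<comment> \<open>The chord end at \<open>u3\<close> moves to \<open>u2\<close>, and the
        segment of the cocircuit from \<open>u3\<close> to \<open>q\<close> is prolonged so that it
        starts at \<open>u2\<close>.\<close>
      define \<tau> where "\<tau> = (\<lambda>v. if v = u3 then u2 else v)"
      have tau: "tgt (s d) = \<tau> (tgt d) \<and> src (s d) = \<tau> (src d)" if "d \<in> set xs" for d
        using o[OF that] ne by (cases "d = ((t, u3), False)") (auto simp: \<tau>_def st)
      define Y where "Y = insert (u1, t) (segs R) - {(u3, q)} - X"
      have Y: "?E - X = insert (u3, q) Y" unfolding E Y_def using nX q1 by auto
      let ?L = "[((u2, t2), True), ((t2, u3), True), ((u3, q), True)]"
      have E'Y: "?E' - fst ` set (map s xs) = fst ` set ?L \<union> Y"
        unfolding X' E' Y_def using nX notX' ne q1 by auto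
      have qne: "q \<noteq> u3" using q(2) by auto
      have UN: "(u3, q) \<notin> Y" by (simp add: Y_def)
      have Yp: "fst e \<noteq> u3 \<and> snd e \<noteq> u3 \<and> fst ` set ?L \<inter> {e} = {}" if "e \<in> Y" for e
        using that ne q1 unfolding Y_def by (cases e) auto
      show ?thesis
      proof (rule cocirc_replace[OF zs, of "{(u3, q)}" Y "\<lambda>e. ?L" \<tau>])
        show "(\<tau> (tgt d), \<tau> (src d')) \<in> chords (map s xs)" if "(d, d') \<in> set (cpairs xs)" for d d'
          using ch[OF tau that] .
        show "?E - fst ` set xs = {(u3, q)} \<union> Y" unfolding X Y by blast
        show "{(u3, q)} \<inter> Y = {}" using UN by blast
        show "?E' - fst ` set (map s xs) = (\<Union>e\<in>{(u3, q)}. fst ` set ((\<lambda>e. ?L) e)) \<union> Y"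
          unfolding E'Y using UN by auto
        show "\<tau> a = a \<and> \<tau> b = b" if "(a, b) \<in> Y" for a b
          using Yp[OF that] by (simp add: \<tau>_def)
      qed (use Yp ne qne in \<open>auto simp: \<tau>_def zlnk_def\<close>)
    next
      case B
      have o: "s d = d \<and> src d \<noteq> t \<and> tgt d \<noteq> t" if "d \<in> set xs" "d \<noteq> ((t, u3), True)" for d
        using only[OF B, of t] that by simp
      have X': "fst ` set (map s xs) = insert (t2, u3) (X - {(t, u3)})"
        by (rule repl[OF B]) (use o ne in \<open>auto simp: s_def\<close>)
      have nX: "(u1, t) \<notin> X" "(t, u3) \<in> X"
        using notX[OF B, of "(u1, t)" t] imageI[OF B, of fst] ne
        unfolding X_def by simp_all
      \<comment> \<open>The chord end at \<open>t\<close> moves to \<open>t2\<close>; the segment of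
        the cocircuit from \<open>u1\<close> to \<open>t\<close> is prolonged through
        \<open>u2\<close> to \<open>t2\<close>.\<close>
      define \<tau> where "\<tau> = (\<lambda>v. if v = t then t2 else v)"
      have tau: "tgt (s d) = \<tau> (tgt d) \<and> src (s d) = \<tau> (src d)" if "d \<in> set xs" for d
        using o[OF that] ne by (cases "d = ((t, u3), True)") (auto simp: \<tau>_def st)
      define Y where "Y = segs R - X"
      have Y: "?E - X = insert (u1, t) Y" unfolding E Y_def using nX by auto
      let ?L = "[((u1, t), True), ((t, u2), True), ((u2, t2), True)]"
      have E'Y: "?E' - fst ` set (map s xs) = fst ` set ?L \<union> Y"
        unfolding X' E' Y_def using nX notX' ne by auto
      have UN: "(u1, t) \<notin> Y" by (simp add: Y_def)
      have Yp: "fst e \<noteq> t \<and> snd e \<noteq> t \<and> fst ` set ?L \<inter> {e} = {}" if "e \<in> Y" for e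
        using that ne unfolding Y_def by (cases e) auto
      show ?thesis
      proof (rule cocirc_replace[OF zs, of "{(u1, t)}" Y "\<lambda>e. ?L" \<tau>])
        show "(\<tau> (tgt d), \<tau> (src d')) \<in> chords (map s xs)" if "(d, d') \<in> set (cpairs xs)" for d d'
          using ch[OF tau that] .
        show "?E - fst ` set xs = {(u1, t)} \<union> Y" unfolding X Y by blast
        show "{(u1, t)} \<inter> Y = {}" using UN by blast
        show "?E' - fst ` set (map s xs) = (\<Union>e\<in>{(u1, t)}. fst ` set ((\<lambda>e. ?L) e)) \<union> Y"
          unfolding E'Y using UN by auto
        show "\<tau> a = a \<and> \<tau> b = b" if "(a, b) \<in> Y" for a b
          using Yp[OF that] by (simp add: \<tau>_def)
      qed (use Yp ne in \<open>auto simp: \<tau>_def zlnk_def\<close>)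
    next
      case C
      have o: "s d = d \<and> src d \<noteq> t \<and> tgt d \<noteq> t \<and> src d \<noteq> u1 \<and> tgt d \<noteq> u1"
        if "d \<in> set xs" "d \<noteq> ((u1, t), True)" for d
        using only[OF C, of t] only[OF C, of u1] that by simp
      have X': "fst ` set (map s xs) = insert (u2, t2) (X - {(u1, t)})"
        by (rule repl[OF C]) (use o ne in \<open>auto simp: s_def\<close>)
      have nX: "(t, u3) \<notin> X" "(p, u1) \<notin> X" "(u1, t) \<in> X"
        using notX[OF C, of "(t, u3)" t] notX[OF C, of "(p, u1)" u1] imageI[OF C, of fst] ne
        unfolding X_def by simp_all
      \<comment> \<open>Both ends move. In the cocircuit the segment from \<open>t\<close> to
        \<open>u3\<close> shrinks to start at \<open>t2\<close>, and the one from \<open>p\<close>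
        to \<open>u1\<close> is prolonged through \<open>t\<close> to \<open>u2\<close>.\<close>
      define \<tau> where "\<tau> = (\<lambda>v. if v = u1 then u2 else if v = t then t2 else v)"
      have tau: "tgt (s d) = \<tau> (tgt d) \<and> src (s d) = \<tau> (src d)" if "d \<in> set xs" for d
        using o[OF that] ne by (cases "d = ((u1, t), True)") (auto simp: \<tau>_def st)
      define Y where "Y = segs R - {(p, u1)} - X"
      have Y: "?E - X = insert (t, u3) (insert (p, u1) Y)" unfolding E Y_def using nX p1 by auto
      let ?L = "[((t2, u3), True)]" and ?L' = "[((p, u1), True), ((u1, t), True), ((t, u2), True)]"
      have E'Y: "?E' - fst ` set (map s xs) = fst ` set ?L \<union> fst ` set ?L' \<union> Y"
        unfolding X' E' Y_def using nX notX' ne p1 by auto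
      have pne: "p \<noteq> t" "p \<noteq> t2" "p \<noteq> u2" "p \<noteq> u1" using I[of p u1] p1[of p] p1(2)[of u1] by auto
      have UN: "(t, u3) \<notin> Y" "(p, u1) \<notin> Y" "(t, u3) \<noteq> (p, u1)" using pne by (auto simp: Y_def)
      have Yp: "fst e \<noteq> t \<and> snd e \<noteq> t \<and> fst e \<noteq> u1 \<and> snd e \<noteq> u1 \<and> fst ` set ?L \<inter> {e} = {} \<and> fst ` set ?L' \<inter> {e} = {}"
        if "e \<in> Y" for e
        using that ne p1 unfolding Y_def by (cases e) auto
      show ?thesis
      proof (rule cocirc_replace[OF zs, of "{(t, u3), (p, u1)}" Y "\<lambda>e. if e = (t, u3) then ?L else ?L'" \<tau>])
        show "(\<tau> (tgt d), \<tau> (src d')) \<in> chords (map s xs)" if "(d, d') \<in> set (cpairs xs)" for d d'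
          using ch[OF tau that] .
        show "?E - fst ` set xs = {(t, u3), (p, u1)} \<union> Y" unfolding X Y by blast
        show "{(t, u3), (p, u1)} \<inter> Y = {}" using UN by blast
        show "?E' - fst ` set (map s xs) = (\<Union>e\<in>{(t, u3), (p, u1)}. fst ` set ((\<lambda>e. if e = (t, u3) then ?L else ?L') e)) \<union> Y"
          unfolding E'Y using UN by auto
        show "\<tau> a = a \<and> \<tau> b = b" if "(a, b) \<in> Y" for a b
          using Yp[OF that] by (simp add: \<tau>_def)
      qed (use Yp ne pne in \<open>auto simp: \<tau>_def zlnk_def\<close>)
    next
      case D
      \<comment> \<open>No segment of the circuit moves, and the cocircuit goes straight through
        \<open>u2\<close> and \<open>t2\<close>.\<close>
      have o: "s d = d" if "d \<in> set xs" for d using D that by (auto simp: s_def)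
      then have sxs: "map s xs = xs" by (simp add: map_idI)
      have nX: "(t, u3) \<notin> X" using D(1,2) unfolding X_def by (auto simp: all_bool_eq) (metis (full_types))
      define Y where "Y = insert (u1, t) (segs R) - X"
      have Y: "?E - X = insert (t, u3) Y" unfolding E Y_def using nX by auto
      let ?L = "[((t, u2), True), ((u2, t2), True), ((t2, u3), True)]"
      have E'Y: "?E' - X = fst ` set ?L \<union> Y"
        unfolding E' Y_def using nX notX' ne by auto
      have UN: "(t, u3) \<notin> Y" using ne by (simp add: Y_def)
      have Yp: "fst ` set ?L \<inter> {e} = {}" if "e \<in> Y" for e
        using that ne unfolding Y_def by (cases e) auto
      show ?thesis unfolding sxs
      proof (rule cocirc_replace[OF zs, of "{(t, u3)}" Y "\<lambda>e. ?L" id])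
        show "(id (tgt d), id (src d')) \<in> chords xs" if "(d, d') \<in> set (cpairs xs)" for d d'
          using chordsI[OF that] by simp
        show "?E - fst ` set xs = {(t, u3)} \<union> Y" unfolding X Y by blast
        show "{(t, u3)} \<inter> Y = {}" using UN by blast
        show "?E' - fst ` set (xs) = (\<Union>e\<in>{(t, u3)}. fst ` set ((\<lambda>e. ?L) e)) \<union> Y"
          unfolding X E'Y using UN by auto
        show "id a = a \<and> id b = b" if "(a, b) \<in> Y" for a b
          using Yp[OF that] by simp
      qed (use Yp ne in \<open>auto simp: zlnk_def\<close>)
    qed
  next
    show "circ own A xs \<and> (\<exists>zs. cocirc ?E' xs zs)" if "xs \<in> ?N" for xs
    proof -
      have dR: "distinct R" "last R = u1" "hd R = u3" using w by (auto simp: u1_def u3_def)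
      have 1: "circ own A ?N1" "circ own A ?N2"
        using ow inA ne by (auto simp: circ_def chords_def lnk_def cpairs_def)
      have chN: "chords ?N1 = {(u2, u3), (t2, t)}" "chords ?N2 = {(t, t2), (u2, u1)}"
        by (auto simp: chords_def cpairs_def)
      \<comment> \<open>Off \<open>R\<close>, each of the two new circuits leaves exactly the two
        segments of the other one.\<close>
      have 2: "\<exists>zs. cocirc ?E' ?N1 zs"
        by (rule cocirc_straight[of R "[((u1, t), True), ((u2, t2), False)]"])
          (use dR Rne w ne in \<open>auto simp: E' zlnk_def chN\<close>)
      have 3: "\<exists>zs. cocirc ?E' ?N2 zs"
        by (rule cocirc_straight[of R "[((t, u2), False), ((t2, u3), True)]"])
          (use dR Rne w ne in \<open>auto simp: E' zlnk_def chN\<close>)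
      show ?thesis using that 1 2 3 by blast
    qed
  next
    show "s ` (?E \<times> UNIV) \<union> (\<Union>xs\<in>?N. set xs) = ?E' \<times> UNIV"
      unfolding cover_s E' by (auto simp: UNIV_bool)
    show "d \<notin> s ` (?E \<times> UNIV)" if "d \<in> (\<Union>xs\<in>?N. set xs)" for d
      unfolding cover_s using that ne by auto
    show "set xs \<inter> set ys = {}" if "xs \<in> ?N" "ys \<in> ?N" "xs \<noteq> ys" for xs ys
      using that ne by auto
  next
    fix i
    let ?Q = "(\<lambda>(d, d'). (s d, s d')) ` links F \<union> links ?N"
    have mQ: "(s d, s d') \<in> ?Q" if "(d, d') \<in> links F" for d d'
      using imageI[OF that, of "\<lambda>(d, d'). (s d, s d')"] by simp
    have sub: "(\<lambda>(d, d'). (s d, s d')) ` links F \<subseteq> ?Q" by blast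
    have NQ: "(((t, u2), True), ((t2, u3), False)) \<in> ?Q" "(((t2, u3), False), ((t, u2), True)) \<in> ?Q"
      "(((u1, t), True), ((u2, t2), False)) \<in> ?Q" "(((u2, t2), False), ((u1, t), True)) \<in> ?Q"
      by (auto simp: links_def cpairs_def)
    have notin: "((t, u2), True) \<notin> s ` (?E \<times> UNIV)" "((t2, u3), False) \<notin> s ` (?E \<times> UNIV)"
      "((u1, t), True) \<notin> s ` (?E \<times> UNIV)" "((u2, t2), False) \<notin> s ` (?E \<times> UNIV)"
      unfolding cover_s using ne by auto
    have sv: "s ((t, u3), True) = ((t2, u3), True)" "s ((t, u3), False) = ((t, u2), False)"
      "s ((u1, t), True) = ((u2, t2), True)" using ne by (auto simp: s_def)
    have FE: "Field ?E \<subseteq> A" unfolding Field_cpairs using w by simp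
    obtain d1 where d1: "(d1, ((t, u3), True)) \<in> links F"
      using links_pred[OF F, of "((t, u3), True)"] E by auto
    obtain d2 where d2: "(((u1, t), True), d2) \<in> links F"
      using links_succ[OF F, of "((u1, t), True)"] E by auto
    obtain d3 where d3: "(d3, ((t, u3), False)) \<in> links F"
      using links_pred[OF F, of "((t, u3), False)"] E by auto
    obtain d4 where d4: "(d4, ((u1, t), True)) \<in> links F"
      using links_pred[OF F, of "((u1, t), True)"] E by auto
    have l: "lnk own A (tgt d1) t" "lnk own A t (src d2)" "lnk own A (tgt d3) u3" "lnk own A (tgt d4) u1"
      using links_lnk[OF F d1] links_lnk[OF F d2] links_lnk[OF F d3] links_lnk[OF F d4] by auto
    have owl: "own (tgt d1) = own t" "own (src d2) = own t" "own (tgt d3) = own u1" "own (tgt d4) = own u1"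
      using l ow by (auto simp: lnk_def)
    have dne: "d1 \<noteq> ((u1, t), True)" "d3 \<noteq> ((u1, t), True)" "d4 \<noteq> ((u1, t), True)"
        "d2 \<noteq> ((t, u3), True)" "d2 \<noteq> ((t, u3), False)" "d2 \<noteq> ((u1, t), True)"
      using l lnk_irrefl[OF inA(1)] owl ow by force+
    show "spread {v \<in> Field ?E' \<inter> A. own v = i} {p \<in> ?Q. own (tgt (fst p)) = i}"
    proof -
      consider "i = own t" | "i = own u1" | "i \<noteq> own t" "i \<noteq> own u1" by blast
      then show ?thesis
      proof cases
        \<comment> \<open>\<open>t2\<close> subdivides the chord into \<open>t\<close> in front of
          \<open>((t, u3), True)\<close> and the chord out of \<open>t\<close> behind
          \<open>((u1, t), True)\<close>. The missing halves are supplied by one link of each new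
          circuit.\<close>
        case 1
        show ?thesis
        proof (rule spread_class_subdivide[OF F FE s_inj sub, where n = t2
              and ?a1.0 = "(s d1, ((t2, u3), True))" and ?b1.0 = "(((t2, u3), False), ((t, u2), True))"
              and ?a2.0 = "(((u1, t), True), ((u2, t2), False))" and ?b2.0 = "(((u2, t2), True), s d2)",
              OF _ _ d1 d2])
          show "{v \<in> Field ?E' \<inter> A. own v = i} = insert t2 {v \<in> Field ?E \<inter> A. own v = i}"
            unfolding Field_cpairs using 1 ow inA by auto
          show "tgt (s d) = tgt d \<and> src (s d') = src d'"
            if "(d, d') \<in> links F" "own (tgt d) = i" "(d, d') \<noteq> (d1, ((t, u3), True))"
              "(d, d') \<noteq> (((u1, t), True), d2)" for d d'
          proof -
            have "own (src d') = own t" using links_lnk[OF F that(1)] that(2) 1 by (simp add: lnk_def)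
            then have "d' \<noteq> ((t, u3), False)" "d' \<noteq> ((u1, t), True)" using ow by auto
            then show ?thesis
              using links_inj[OF F that(1) d1] links_inj[OF F that(1) d2] that unfolding st by auto
          qed
          show "x = (s d1, s ((t, u3), True)) \<or> fst x \<notin> s ` (?E \<times> UNIV)"
            if "x \<in> {(s d1, ((t2, u3), True)), (((t2, u3), False), ((t, u2), True))}" for x
            using that notin sv by (elim insertE emptyE) simp_all
          show "x = (s ((u1, t), True), s d2) \<or> fst x \<notin> s ` (?E \<times> UNIV)"
            if "x \<in> {(((u1, t), True), ((u2, t2), False)), (((u2, t2), True), s d2)}" for x
            using that notin sv by (elim insertE emptyE) simp_all
          show "{(s d1, ((t2, u3), True)), (((t2, u3), False), ((t, u2), True)),
             (((u1, t), True), ((u2, t2), False)), (((u2, t2), True), s d2)} \<subseteq> ?Q"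
            using mQ[OF d1] mQ[OF d2] NQ sv by simp
        qed (use 1 owl ow ne dne in \<open>auto simp: st\<close>)
      next
        \<comment> \<open>\<open>u2\<close> subdivides the chord into \<open>u3\<close> in front of
          \<open>((t, u3), False)\<close> and the chord into \<open>u1\<close> in front of
          \<open>((u1, t), True)\<close>.\<close>
        case 2
        show ?thesis
        proof (rule spread_class_subdivide[OF F FE s_inj sub, where n = u2
              and ?a1.0 = "(s d3, ((t, u2), False))" and ?b1.0 = "(((t, u2), True), ((t2, u3), False))"
              and ?a2.0 = "(s d4, ((u2, t2), True))" and ?b2.0 = "(((u2, t2), False), ((u1, t), True))",
              OF _ _ d3 d4])
          show "{v \<in> Field ?E' \<inter> A. own v = i} = insert u2 {v \<in> Field ?E \<inter> A. own v = i}"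
            unfolding Field_cpairs using 2 ow inA by auto
          show "tgt (s d) = tgt d \<and> src (s d') = src d'"
            if "(d, d') \<in> links F" "own (tgt d) = i" "(d, d') \<noteq> (d3, ((t, u3), False))"
              "(d, d') \<noteq> (d4, ((u1, t), True))" for d d'
          proof -
            have "own (src d') = own u1" using links_lnk[OF F that(1)] that(2) 2 by (simp add: lnk_def)
            then have "d' \<noteq> ((t, u3), True)" "d \<noteq> ((u1, t), True)" using ow that(2) 2 by auto
            then show ?thesis
              using links_inj[OF F that(1) d3] links_inj[OF F that(1) d4] that unfolding st by auto
          qed
          show "x = (s d3, s ((t, u3), False)) \<or> fst x \<notin> s ` (?E \<times> UNIV)"
            if "x \<in> {(s d3, ((t, u2), False)), (((t, u2), True), ((t2, u3), False))}" for x
            using that notin sv by (elim insertE emptyE) simp_all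
          show "x = (s d4, s ((u1, t), True)) \<or> fst x \<notin> s ` (?E \<times> UNIV)"
            if "x \<in> {(s d4, ((u2, t2), True)), (((u2, t2), False), ((u1, t), True))}" for x
            using that notin sv by (elim insertE emptyE) simp_all
          show "{(s d3, ((t, u2), False)), (((t, u2), True), ((t2, u3), False)),
             (s d4, ((u2, t2), True)), (((u2, t2), False), ((u1, t), True))} \<subseteq> ?Q"
            using mQ[OF d3] mQ[OF d4] NQ sv by simp
        qed (use 2 owl ow ne dne in \<open>auto simp: st\<close>)
      next
        case 3
        show ?thesis
        proof (rule spread_class_map[OF F s_inj sub])
          show "{v \<in> Field ?E' \<inter> A. own v = i} = {v \<in> Field ?E \<inter> A. own v = i}"
            unfolding Field_cpairs using 3 ow by auto
          show "tgt (s d) = tgt d \<and> src (s d') = src d'" if "(d, d') \<in> links F" "own (tgt d) = i" for d d'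
          proof -
            have "own (src d') = i" using links_lnk[OF F that(1)] that(2) by (simp add: lnk_def)
            then show ?thesis using that(2) 3 ow unfolding st by auto
          qed
        qed
      qed
    qed
  qed (use ow inA A in \<open>auto simp: st\<close>)
qed

text \<open>All ends stay in place, so old junctions remain links. A circuit contains at most one
  segment of \<open>S\<close>, hence meets the new owners at most once. A class that gains vertices
  has to get its cuts from links inside the lists alone.\<close>

lemma family_expand:
  assumes F: "family own A E F"
    and ends: "\<And>d. d \<in> E \<times> UNIV \<Longrightarrow> \<sigma> d \<noteq> [] \<and> src (hd (\<sigma> d)) = src d \<and> tgt (last (\<sigma> d)) = tgt d \<and>
       (\<forall>(u, v)\<in>inner (\<sigma> d). lnk own A u v) \<and> distinct (map (own \<circ> tgt) (\<sigma> d)) \<and> distinct (map fst (\<sigma> d))"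
    and plain: "\<And>d. d \<in> E \<times> UNIV \<Longrightarrow> d \<notin> S \<Longrightarrow> \<sigma> d = [d]"
    and special: "\<And>xs d d'. xs \<in> F \<Longrightarrow> d \<in> set xs \<Longrightarrow> d' \<in> set xs \<Longrightarrow> d \<in> S \<Longrightarrow> d' \<in> S \<Longrightarrow> d = d'"
    and fresh: "\<And>d d' e. d \<in> E \<times> UNIV \<Longrightarrow> d \<in> S \<Longrightarrow> d' \<in> E \<times> UNIV \<Longrightarrow> d' \<notin> S \<Longrightarrow> e \<in> set (\<sigma> d) \<Longrightarrow>
       fst e \<noteq> fst d' \<and> (own (tgt e) = own (tgt d) \<or> own (tgt e) \<noteq> own (tgt d'))"
    and co: "\<And>xs. xs \<in> F \<Longrightarrow> \<exists>zs. cocirc E' (concat (map \<sigma> xs)) zs"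
    and cover: "(\<Union>d\<in>E \<times> UNIV. set (\<sigma> d)) = E' \<times> UNIV"
    and dj: "\<And>d d'. d \<in> E \<times> UNIV \<Longrightarrow> d' \<in> E \<times> UNIV \<Longrightarrow> d \<noteq> d' \<Longrightarrow> set (\<sigma> d) \<inter> set (\<sigma> d') = {}"
    and spr: "\<And>i. {v \<in> Field E' \<inter> A. own v = i} = {v \<in> Field E \<inter> A. own v = i} \<or>
       spread {v \<in> Field E' \<inter> A. own v = i}
         {p \<in> (\<Union>d\<in>E \<times> UNIV. set (zip (\<sigma> d) (tl (\<sigma> d)))). own (tgt (fst p)) = i}"
  shows "\<exists>F'. family own A E' F'"
proof (rule family_subst[OF F, of \<sigma> E' "{}"])
  fix xs assume xs: "xs \<in> F"
  note c = family_circ[OF F xs] and mem = family_mem[OF F xs]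
  have memp: "d \<in> E \<times> UNIV \<and> d' \<in> E \<times> UNIV" if "(d, d') \<in> set (cpairs xs)" for d d'
    using cpairs_mem[OF that] mem by blast
  have fr: "own (tgt e) \<noteq> own (tgt d') \<and> fst e \<noteq> fst d'"
    if d: "d \<in> set xs" "d' \<in> set xs" "d \<noteq> d'" "e \<in> set (\<sigma> d)" "d' \<notin> S" for d d' e
  proof (cases "d \<in> S")
    case True
    have "own (tgt d) \<noteq> own (tgt d')" using circ_tgt_inj[OF c d(1,2)] d(3) by blast
    then show ?thesis using fresh[OF mem[OF d(1)] True mem[OF d(2)] d(5,4)] by auto
  next
    case False
    then have "e = d" using plain[OF mem[OF d(1)]] d(4) by simp
    then show ?thesis using circ_tgt_inj[OF c d(1,2)] circ_fst_inj[OF c d(1,2)] d(3) by blast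
  qed
  have "circ own A (concat (map \<sigma> xs))"
  proof (rule circ_subst[OF c])
    show "lnk own A (tgt (last (\<sigma> d))) (src (hd (\<sigma> d')))" if "(d, d') \<in> set (cpairs xs)" for d d'
      using circ_lnk[OF c that] ends memp[OF that] by simp
    show "tgt (last (\<sigma> d)) \<noteq> src (hd (\<sigma> d'))" if "(d, d') \<in> set (cpairs xs)" "tgt d \<noteq> src d'" for d d'
      using that(2) ends memp[OF that(1)] by simp
    show "own (tgt e) \<noteq> own (tgt e') \<and> fst e \<noteq> fst e'"
      if d: "d \<in> set xs" "d' \<in> set xs" "d \<noteq> d'" "e \<in> set (\<sigma> d)" "e' \<in> set (\<sigma> d')" for d d' e e'
    proof (cases "d' \<in> S")
      case False
      then have "e' = d'" using plain[OF mem[OF d(2)]] d(5) by simp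
      then show ?thesis using fr[OF d(1-4) False] by simp
    next
      case True
      then have nS: "d \<notin> S" using special[OF xs d(1,2)] d(3) by blast
      then have "e = d" using plain[OF mem[OF d(1)]] d(4) by simp
      then show ?thesis using fr[OF d(2,1) _ d(5) nS] d(3) by metis
    qed
  qed (use ends mem in fastforce)+
  then show "circ own A (concat (map \<sigma> xs)) \<and> (\<exists>zs. cocirc E' (concat (map \<sigma> xs)) zs)"
    using co[OF xs] by blast
next
  fix i
  let ?I = "\<Union>d\<in>E \<times> UNIV. set (zip (\<sigma> d) (tl (\<sigma> d)))"
  let ?Q = "(\<lambda>(d, d'). (last (\<sigma> d), hd (\<sigma> d'))) ` links F \<union> ?I \<union> links {}"
  let ?U = "{v \<in> Field E' \<inter> A. own v = i}"
  consider "?U = {v \<in> Field E \<inter> A. own v = i}" | "spread ?U {p \<in> ?I. own (tgt (fst p)) = i}"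
    using spr[of i] by blast
  then show "spread ?U {p \<in> ?Q. own (tgt (fst p)) = i}"
  proof cases
    case 1
    let ?g = "\<lambda>(d, d'). (last (\<sigma> d), hd (\<sigma> d'))"
    have inj: "d = e" if "d \<in> E \<times> UNIV" "e \<in> E \<times> UNIV" "last (\<sigma> d) = last (\<sigma> e) \<or> hd (\<sigma> d) = hd (\<sigma> e)" for d e
    proof (rule ccontr)
      assume "d \<noteq> e"
      then have "set (\<sigma> d) \<inter> set (\<sigma> e) = {}" using dj that by blast
      moreover have "\<sigma> d \<noteq> []" "\<sigma> e \<noteq> []" using ends that by blast+
      ultimately show False using that(3) by (metis disjoint_iff hd_in_set last_in_set)
    qed
    show ?thesis
      unfolding 1
    proof (rule spread_map[where g = ?g])
      show "spread {v \<in> Field E \<inter> A. own v = i} {p \<in> links F. own (tgt (fst p)) = i}"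
        using F unfolding family_def by blast
      show "inj_on ?g {p \<in> links F. own (tgt (fst p)) = i}"
      proof (rule inj_onI)
        fix x y assume a: "x \<in> {p \<in> links F. own (tgt (fst p)) = i}" "y \<in> {p \<in> links F. own (tgt (fst p)) = i}"
          "?g x = ?g y"
        obtain d d' e e' where x: "x = (d, d')" "y = (e, e')" by (cases x; cases y)
        then have "(d, d') \<in> links F" "(e, e') \<in> links F" "last (\<sigma> d) = last (\<sigma> e)" "hd (\<sigma> d') = hd (\<sigma> e')"
          using a by auto
        then show "x = y" using inj links_mem[OF F] unfolding x by metis
      qed
      show g: "tgt (fst (?g p)) = tgt (fst p) \<and> src (snd (?g p)) = src (snd p)"
        if "p \<in> {p \<in> links F. own (tgt (fst p)) = i}" for p
        using that ends links_mem[OF F, of "fst p" "snd p"] by (cases p) simp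
      show "?g ` {p \<in> links F. own (tgt (fst p)) = i} \<subseteq> {p \<in> ?Q. own (tgt (fst p)) = i}"
      proof (rule image_subsetI)
        fix p assume p: "p \<in> {p \<in> links F. own (tgt (fst p)) = i}"
        then have "?g p \<in> ?g ` links F" by (intro imageI) simp
        then show "?g p \<in> {p \<in> ?Q. own (tgt (fst p)) = i}" using g[OF p] p by simp
      qed
    qed
  next
    case 2
    then show ?thesis by (rule spread_map[where g = id]) auto
  qed
next
  show "(\<Union>d\<in>E \<times> UNIV. set (\<sigma> d)) \<union> (\<Union>xs\<in>{}. set xs) = E' \<times> UNIV" using cover by simp
qed (use ends dj in blast)+

section \<open>New vertices that are no attachments, and new leaf bridges\<close>

lemma concat_special:
  assumes "d0 \<in> set xs" "\<And>d. d \<in> set xs \<Longrightarrow> d \<noteq> d0 \<Longrightarrow> \<sigma> d = [d]" "distinct (map fst xs)"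
  shows "fst ` set (concat (map \<sigma> xs)) = fst ` set (\<sigma> d0) \<union> (fst ` set xs - {fst d0})"
proof -
  have "set xs = insert d0 (set xs - {d0})" using assms(1) by blast
  then have "(\<Union>d\<in>set xs. fst ` set (\<sigma> d)) = fst ` set (\<sigma> d0) \<union> (\<Union>d\<in>set xs - {d0}. fst ` set (\<sigma> d))"
    by blast
  also have "(\<Union>d\<in>set xs - {d0}. fst ` set (\<sigma> d)) = (\<Union>d\<in>set xs - {d0}. {fst d})"
    by (rule SUP_cong[OF refl]) (use assms(2) in auto)
  also have "\<dots> = fst ` (set xs - {d0})" by auto
  also have "\<dots> = fst ` set xs - {fst d0}"
    using assms(1,3) by (auto simp: distinct_map inj_on_def)
  finally show ?thesis by (simp add: image_UN)
qed

lemma chords_ends: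
  assumes "(d, d') \<in> set (cpairs xs)" "\<And>d. d \<in> set xs \<Longrightarrow> \<sigma> d \<noteq> []"
    "\<And>d. d \<in> set xs \<Longrightarrow> src (hd (\<sigma> d)) = src d \<and> tgt (last (\<sigma> d)) = tgt d"
  shows "(id (tgt d), id (src d')) \<in> chords (concat (map \<sigma> xs))"
  using chords_subst_mem[OF assms(1), of \<sigma> id] assms(2,3) by simp

text \<open>A vertex that is no attachment is alone in its class, so both orientations of the
  subdivided segment may pass straight through it, and the attachments of every class stay the
  same.\<close>

lemma family_insert:
  assumes F: "family own A (set (cpairs (t # R))) F" and w: "distinct (t # R)" "R \<noteq> []"
    and n: "n \<notin> set (t # R)" "n \<notin> A" "own n \<notin> own ` set (t # R)"
  shows "\<exists>F'. family own A (set (cpairs (t # n # R))) F'"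
proof -
  define q where "q = hd R"
  let ?E = "set (cpairs (t # R))" and ?E' = "set (cpairs (t # n # R))"
  define J where "J = insert (last R, t) (segs R)"
  have E: "?E = insert (t, q) J" using w(2) by (auto simp: cpairs_Cons q_def J_def)
  have E': "?E' = insert (t, n) (insert (n, q) J)"
    using w(2) by (cases R) (auto simp: cpairs_Cons q_def J_def)
  have qR: "q \<in> set R" "last R \<in> set R" using w(2) by (auto simp: q_def)
  have ne: "t \<noteq> q" "t \<noteq> n" "q \<noteq> n" using qR w n by auto
  have J: "a \<noteq> n \<and> b \<noteq> n \<and> a \<in> set (t # R) \<and> b \<in> set (t # R)" if "(a, b) \<in> J" for a b
    using that segs_mem[of a b R] n qR by (auto simp: J_def)
  have J': "(t, q) \<notin> J" using segs_mem[of t q R] w qR by (auto simp: J_def)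
  have J'' [simp]: "(x, n) \<notin> J" "(n, x) \<notin> J" for x using J by blast+
  define \<sigma> :: "'a dirseg \<Rightarrow> 'a dirseg list" where
    "\<sigma> = (\<lambda>d. if d = ((t, q), True) then [((t, n), True), ((n, q), True)]
       else if d = ((t, q), False) then [((n, q), False), ((t, n), False)] else [d])"
  have \<sigma>s: "\<sigma> ((t, q), True) = [((t, n), True), ((n, q), True)]"
    "\<sigma> ((t, q), False) = [((n, q), False), ((t, n), False)]" by (auto simp: \<sigma>_def)
  have \<sigma>J: "\<sigma> d = [d]" if "fst d \<noteq> (t, q)" for d using that by (auto simp: \<sigma>_def)
  have ownE: "own (tgt d) \<noteq> own n" if "d \<in> ?E \<times> UNIV" for d
  proof -
    have "tgt d \<in> set (t # R)"
      using that J[of "fst (fst d)" "snd (fst d)"] qR unfolding E by (auto simp: tgt_def)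
    then show ?thesis using n(3) by (metis imageI)
  qed
  have owntq: "own t \<noteq> own n" "own q \<noteq> own n" using n qR by (metis imageI list.set_intros)+
  have ends: "\<sigma> d \<noteq> [] \<and> src (hd (\<sigma> d)) = src d \<and> tgt (last (\<sigma> d)) = tgt d \<and>
       (\<forall>(u, v)\<in>inner (\<sigma> d). lnk own A u v) \<and> distinct (map (own \<circ> tgt) (\<sigma> d)) \<and> distinct (map fst (\<sigma> d))" for d
    using ne n owntq by (auto simp: \<sigma>_def lnk_def)
  show ?thesis
  proof (rule family_expand[OF F, of \<sigma> "{(t, q)} \<times> UNIV" ?E'])
    fix xs assume xs: "xs \<in> F"
    note c = family_circ[OF F xs] and mem = family_mem[OF F xs]
    obtain zs where zs: "cocirc ?E xs zs" using family_cocirc[OF F xs] by blast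
    define X where "X = fst ` set xs"
    have X: "fst ` set xs = X" by (simp add: X_def)
    have XE: "X \<subseteq> ?E" unfolding X_def using mem by force
    have dX: "distinct (map fst xs)" using c by (simp add: circ_def)
    have notX': "(t, n) \<notin> X" "(n, q) \<notin> X" using XE ne unfolding E by auto
    show "\<exists>zs. cocirc ?E' (concat (map \<sigma> xs)) zs"
    proof (cases "(t, q) \<in> X")
      case True
      then obtain d0 where d0: "d0 \<in> set xs" "fst d0 = (t, q)" by (auto simp: X_def)
      have oth: "\<sigma> d = [d]" if "d \<in> set xs" "d \<noteq> d0" for d
        by (rule \<sigma>J) (use circ_fst_inj[OF c that(1) d0(1)] that(2) d0(2) in auto)
      have "fst ` set (\<sigma> d0) = {(t, n), (n, q)}"
        using d0(2) \<sigma>s by (cases d0; cases "snd d0") auto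
      then have X': "fst ` set (concat (map \<sigma> xs)) = {(t, n), (n, q)} \<union> (X - {(t, q)})"
        using concat_special[OF d0(1) oth dX] d0(2) by (simp add: X)
      show ?thesis
      proof (rule cocirc_replace[OF zs, of "{}" "J - X" "\<lambda>e. []" id])
        show "?E - fst ` set xs = {} \<union> (J - X)" unfolding X E using True by auto
        show "?E' - fst ` set (concat (map \<sigma> xs)) = (\<Union>e\<in>{}. fst ` set []) \<union> (J - X)"
          unfolding X' E' using J' by auto
        show "(id (tgt d), id (src d')) \<in> chords (concat (map \<sigma> xs))" if "(d, d') \<in> set (cpairs xs)" for d d'
          by (rule chords_ends[OF that]) (use ends in blast)+
      qed auto
    next
      case False
      have "\<sigma> d = [d]" if "d \<in> set xs" for d
        by (rule \<sigma>J) (use False that in \<open>force simp: X_def\<close>)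
      then have sxs: "concat (map \<sigma> xs) = xs" by (rule concat_singletons)
      show ?thesis
        unfolding sxs
      proof (rule cocirc_replace[OF zs, of "{(t, q)}" "J - X" "\<lambda>e. \<sigma> ((t, q), True)" id])
        show "?E - fst ` set xs = {(t, q)} \<union> (J - X)" unfolding X E using False by auto
        show "?E' - fst ` set xs = (\<Union>e\<in>{(t, q)}. fst ` set (\<sigma> ((t, q), True))) \<union> (J - X)"
          unfolding X E' \<sigma>s using notX' by auto
        show "(id (tgt d), id (src d')) \<in> chords xs" if "(d, d') \<in> set (cpairs xs)" for d d'
          using chordsI[OF that] by simp
      qed (use J' ne in \<open>auto simp: \<sigma>s zlnk_def\<close>)
    qed
  next
    show "fst e \<noteq> fst d' \<and> (own (tgt e) = own (tgt d) \<or> own (tgt e) \<noteq> own (tgt d'))"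
      if "d \<in> ?E \<times> UNIV" "d \<in> {(t, q)} \<times> UNIV" "d' \<in> ?E \<times> UNIV" "d' \<notin> {(t, q)} \<times> UNIV" "e \<in> set (\<sigma> d)" for d d' e
    proof -
      have "fst d' \<in> J" using that(3,4) unfolding E by (cases d') auto
      then have "fst d' \<noteq> (t, n)" "fst d' \<noteq> (n, q)" using J'' by metis+
      moreover have "e \<in> {((t, n), True), ((n, q), True), ((n, q), False), ((t, n), False)}"
        using that(2,5) \<sigma>s by (cases "snd d") auto
      moreover have "own (tgt e) = own (tgt d) \<or> own (tgt e) = own n"
        using that(2,5) \<sigma>s by (cases "snd d") auto
      ultimately show ?thesis using ownE[OF that(3)] by auto
    qed
    show "(\<Union>d\<in>?E \<times> UNIV. set (\<sigma> d)) = ?E' \<times> UNIV"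
    proof -
      have "?E \<times> UNIV = {((t, q), True), ((t, q), False)} \<union> J \<times> UNIV"
        unfolding E by (auto simp: UNIV_bool)
      moreover have "(\<Union>d\<in>J \<times> UNIV. set (\<sigma> d)) = (\<Union>d\<in>J \<times> UNIV. {d})"
      proof (rule SUP_cong[OF refl])
        fix d :: "'a dirseg" assume "d \<in> J \<times> UNIV"
        then have "fst d \<noteq> (t, q)" using J' by auto
        then show "set (\<sigma> d) = {d}" using \<sigma>J by simp
      qed
      ultimately have "(\<Union>d\<in>?E \<times> UNIV. set (\<sigma> d)) =
          set (\<sigma> ((t, q), True)) \<union> set (\<sigma> ((t, q), False)) \<union> J \<times> UNIV" by (simp add: Un_assoc)
      then show ?thesis unfolding E' \<sigma>s by (auto simp: UNIV_bool)
    qed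
    show "set (\<sigma> d) \<inter> set (\<sigma> d') = {}" if "d \<in> ?E \<times> UNIV" "d' \<in> ?E \<times> UNIV" "d \<noteq> d'" for d d'
      using that ne unfolding E by (auto simp: \<sigma>_def)
    show "{v \<in> Field ?E' \<inter> A. own v = i} = {v \<in> Field ?E \<inter> A. own v = i} \<or>
       spread {v \<in> Field ?E' \<inter> A. own v = i}
         {p \<in> (\<Union>d\<in>?E \<times> UNIV. set (zip (\<sigma> d) (tl (\<sigma> d)))). own (tgt (fst p)) = i}" for i
      unfolding Field_cpairs using n by auto
    show "d = d'" if "xs \<in> F" "d \<in> set xs" "d' \<in> set xs" "d \<in> {(t, q)} \<times> UNIV" "d' \<in> {(t, q)} \<times> UNIV" for xs d d'
      using circ_fst_inj[OF family_circ[OF F that(1)] that(2,3)] that(4,5) by auto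
    show "\<sigma> d = [d]" if "d \<in> ?E \<times> UNIV" "d \<notin> {(t, q)} \<times> UNIV" for d
      by (rule \<sigma>J) (use that in \<open>cases d; auto\<close>)
  qed (use ends in auto)
qed

text \<open>The new leaf bridge has its attachments \<open>u1\<close> and \<open>u2\<close> on both
  sides of \<open>t\<close>. Every directed segment at \<open>t\<close> is led over the new chord:
  from \<open>p\<close> to \<open>u1\<close>, by the chord to \<open>u2\<close>, and back to
  \<open>t\<close>, and similarly for the other three. As a circuit has only one segment at
  \<open>t\<close>, it passes the new bridge at most once. The four detours give two chords in each
  direction.\<close>

lemma family_cross:
  assumes F: "family own A (set (cpairs (t # R))) F"
    and w: "distinct (t # R)" "R \<noteq> []" "set (t # R) \<subseteq> A"
    and new: "u1 \<notin> set (t # R)" "u2 \<notin> set (t # R)" "u1 \<noteq> u2" "u1 \<in> A" "u2 \<in> A" "own u2 = own u1"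
      "own u1 \<notin> own ` set (t # R)"
  shows "\<exists>F'. family own A (set (cpairs (t # u2 # R @ [u1]))) F'"
proof -
  define p where "p = last R"
  define q where "q = hd R"
  let ?E = "set (cpairs (t # R))" and ?E' = "set (cpairs (t # u2 # R @ [u1]))"
  have pq: "p \<in> set R" "q \<in> set R" using w(2) by (auto simp: p_def q_def)
  have E: "?E = insert (t, q) (insert (p, t) (segs R))"
    using w(2) by (auto simp: cpairs_Cons p_def q_def)
  have E': "?E' = insert (t, u2) (insert (u2, q) (insert (p, u1) (insert (u1, t) (segs R))))"
    using cpairs_Cons[of "u2 # R @ [u1]" t] zip_tl_append[of "u2 # R" "[u1]"] w(2)
    by (cases R) (auto simp: p_def q_def)
  have ne: "t \<noteq> p" "t \<noteq> q" "u1 \<noteq> p" "u1 \<noteq> q" "u2 \<noteq> p" "u2 \<noteq> q" "t \<noteq> u1" "t \<noteq> u2" "u1 \<noteq> u2"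
    using pq w new by auto
  have I: "a \<noteq> t \<and> a \<noteq> u1 \<and> a \<noteq> u2 \<and> b \<noteq> t \<and> b \<noteq> u1 \<and> b \<noteq> u2 \<and> a \<in> set R \<and> b \<in> set R"
    if "(a, b) \<in> segs R" for a b
    using segs_mem[OF that] w new by auto
  have I' [simp]: "(t, x) \<notin> segs R" "(x, t) \<notin> segs R" "(u1, x) \<notin> segs R" "(x, u1) \<notin> segs R"
    "(u2, x) \<notin> segs R" "(x, u2) \<notin> segs R" for x
    using I by blast+
  define \<sigma> :: "'a dirseg \<Rightarrow> 'a dirseg list" where
    "\<sigma> = (\<lambda>d. if d = ((p, t), True) then [((p, u1), True), ((t, u2), False)]
       else if d = ((p, t), False) then [((t, u2), True), ((p, u1), False)]
       else if d = ((t, q), True) then [((u1, t), False), ((u2, q), True)]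
       else if d = ((t, q), False) then [((u2, q), False), ((u1, t), True)] else [d])"
  have \<sigma>s: "\<sigma> ((p, t), True) = [((p, u1), True), ((t, u2), False)]"
    "\<sigma> ((p, t), False) = [((t, u2), True), ((p, u1), False)]"
    "\<sigma> ((t, q), True) = [((u1, t), False), ((u2, q), True)]"
    "\<sigma> ((t, q), False) = [((u2, q), False), ((u1, t), True)]"
    using ne by (auto simp: \<sigma>_def)
  have \<sigma>I: "\<sigma> d = [d]" if "fst d \<noteq> (p, t)" "fst d \<noteq> (t, q)" for d using that by (auto simp: \<sigma>_def)
  let ?S = "{(p, t), (t, q)} \<times> (UNIV :: bool set)"
  have ownR: "own v \<noteq> own u1" if "v \<in> set (t # R)" for v using that new(7) by (metis imageI)
  have ownE: "own (tgt d) \<noteq> own u1" if "d \<in> ?E \<times> UNIV" for d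
  proof -
    have "tgt d \<in> set (t # R)"
      using that I[of "fst (fst d)" "snd (fst d)"] pq unfolding E by (auto simp: tgt_def)
    then show ?thesis using ownR by blast
  qed
  have owntpq: "own t \<noteq> own u1" "own p \<noteq> own u1" "own q \<noteq> own u1" using ownR pq by simp_all
  have ends: "\<sigma> d \<noteq> [] \<and> src (hd (\<sigma> d)) = src d \<and> tgt (last (\<sigma> d)) = tgt d \<and>
       (\<forall>(u, v)\<in>inner (\<sigma> d). lnk own A u v) \<and> distinct (map (own \<circ> tgt) (\<sigma> d)) \<and> distinct (map fst (\<sigma> d))" for d
    using ne new owntpq by (auto simp: \<sigma>_def lnk_def)
  have in1: "inner (\<sigma> ((p, t), c)) = {(u1, u2)} \<or> inner (\<sigma> ((p, t), c)) = {(u2, u1)}" 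
    "inner (\<sigma> ((t, q), c)) = {(u1, u2)} \<or> inner (\<sigma> ((t, q), c)) = {(u2, u1)}" for c
    by (cases c; simp add: \<sigma>s)+
  have f1: "fst ` set (\<sigma> ((p, t), c)) = {(p, u1), (t, u2)}"
    "fst ` set (\<sigma> ((t, q), c)) = {(u1, t), (u2, q)}" for c
    by (cases c; simp add: \<sigma>s insert_commute)+
  show ?thesis
  proof (rule family_expand[OF F, of \<sigma> ?S ?E'])
    have one: "d = d'" if "xs \<in> F" "d \<in> set xs" "d' \<in> set xs" "d \<in> ?S" "d' \<in> ?S" for xs d d'
    proof -
      have "t \<in> A" using w by simp
      moreover have "t = src d \<or> t = tgt d" "t = src d' \<or> t = tgt d'"
        using that(4,5) by (cases "snd d"; cases "snd d'"; auto simp: src_def tgt_def)+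
      ultimately show ?thesis using circ_one_visit[OF family_circ[OF F that(1)] that(2,3)] by metis
    qed
    show "\<And>xs d d'. xs \<in> F \<Longrightarrow> d \<in> set xs \<Longrightarrow> d' \<in> set xs \<Longrightarrow> d \<in> ?S \<Longrightarrow> d' \<in> ?S \<Longrightarrow> d = d'"
      by (rule one)
    fix xs assume xs: "xs \<in> F"
    note c = family_circ[OF F xs] and mem = family_mem[OF F xs]
    obtain zs where zs: "cocirc ?E xs zs" using family_cocirc[OF F xs] by blast
    define X where "X = fst ` set xs"
    have X: "fst ` set xs = X" by (simp add: X_def)
    have XE: "X \<subseteq> ?E" unfolding X_def using mem by force
    have dX: "distinct (map fst xs)" using c by (simp add: circ_def)
    have notX': "(t, u2) \<notin> X" "(u2, q) \<notin> X" "(p, u1) \<notin> X" "(u1, t) \<notin> X"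
      using XE ne unfolding E by auto
    let ?xs = "concat (map \<sigma> xs)"
    have ch: "(id (tgt d), id (src d')) \<in> chords ?xs" if "(d, d') \<in> set (cpairs xs)" for d d'
      by (rule chords_ends[OF that]) (use ends in blast)+
    have sp: "fst ` set ?xs = fst ` set (\<sigma> d0) \<union> (X - {fst d0}) \<and> (\<forall>e\<in>X. e \<noteq> fst d0 \<longrightarrow> e \<noteq> (p, t) \<and> e \<noteq> (t, q)) \<and>
        inner (\<sigma> d0) \<subseteq> chords ?xs"
      if d0: "d0 \<in> set xs" "d0 \<in> ?S" for d0
    proof -
      have nS: "d \<notin> ?S" if "d \<in> set xs" "d \<noteq> d0" for d using one[OF xs that(1) d0(1) _ d0(2)] that(2) by blast
      have oth: "\<sigma> d = [d]" if "d \<in> set xs" "d \<noteq> d0" for d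
        by (rule \<sigma>I) (use nS[OF that] in \<open>cases d; auto\<close>)+
      have "e \<noteq> (p, t) \<and> e \<noteq> (t, q)" if "e \<in> X" "e \<noteq> fst d0" for e
      proof -
        from that(1) obtain d where d: "d \<in> set xs" "fst d = e" unfolding X_def by blast
        then have "d \<notin> ?S" using nS that(2) by blast
        then show ?thesis using d(2) by (cases d) auto
      qed
      moreover have "inner (\<sigma> d0) \<subseteq> chords ?xs"
        using chords_subst[of xs \<sigma>] ends d0(1) by blast
      ultimately show ?thesis using concat_special[OF d0(1) oth dX] by (simp add: X)
    qed
    define Y where "Y = segs R - X"
    consider c where "((p, t), c) \<in> set xs" | c where "((t, q), c) \<in> set xs" | "(p, t) \<notin> X" "(t, q) \<notin> X"
      unfolding X_def by force
    then show "\<exists>zs. cocirc ?E' ?xs zs"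
    proof cases
      \<comment> \<open>The cocircuit contains the other segment at \<open>t\<close>, which takes
        its detour over the same chord.\<close>
      case (1 c)
      note sp = sp[OF 1]
      have Xm: "(p, t) \<in> X" "(t, q) \<notin> X" using imageI[OF 1, of fst] sp ne by (auto simp: X)
      show ?thesis
      proof (rule cocirc_replace[OF zs, of "{(t, q)}" Y "\<lambda>e. \<sigma> ((t, q), True)" id])
        show "?E - fst ` set xs = {(t, q)} \<union> Y" unfolding X E Y_def using Xm by auto
        show "?E' - fst ` set ?xs = (\<Union>e\<in>{(t, q)}. fst ` set (\<sigma> ((t, q), True))) \<union> Y"
          using sp notX' ne Xm unfolding E' f1 Y_def by auto
        show "(id (tgt d), id (src d')) \<in> chords ?xs" if "(d, d') \<in> set (cpairs xs)" for d d' by (rule ch[OF that])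
      qed (use sp in1(1)[of c] ne in \<open>auto simp: \<sigma>s zlnk_def Y_def\<close>)
    next
      case (2 c)
      note sp = sp[OF 2]
      have Xm: "(p, t) \<notin> X" "(t, q) \<in> X" using imageI[OF 2, of fst] sp ne by (auto simp: X)
      show ?thesis
      proof (rule cocirc_replace[OF zs, of "{(p, t)}" Y "\<lambda>e. \<sigma> ((p, t), True)" id])
        show "?E - fst ` set xs = {(p, t)} \<union> Y" unfolding X E Y_def using Xm by auto
        show "?E' - fst ` set ?xs = (\<Union>e\<in>{(p, t)}. fst ` set (\<sigma> ((p, t), True))) \<union> Y"
          using sp notX' ne Xm unfolding E' f1 Y_def by auto
        show "(id (tgt d), id (src d')) \<in> chords ?xs" if "(d, d') \<in> set (cpairs xs)" for d d' by (rule ch[OF that])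
      qed (use sp in1(2)[of c] ne in \<open>auto simp: \<sigma>s zlnk_def Y_def\<close>)
    next
      case 3
      have "\<sigma> d = [d]" if "d \<in> set xs" for d
        by (rule \<sigma>I) (use 3 imageI[OF that, of fst] in \<open>auto simp: X\<close>)
      then have sxs: "?xs = xs" by (rule concat_singletons)
      \<comment> \<open>The circuit avoids \<open>t\<close>, so no chord of the new bridge is
        available and the cocircuit goes straight through \<open>u1\<close> and
        \<open>u2\<close>.\<close>
      let ?\<zeta> = "\<lambda>e. if e = (p, t) then [((p, u1), True), ((u1, t), True)] else [((t, u2), True), ((u2, q), True)]"
      show ?thesis
        unfolding sxs
      proof (rule cocirc_replace[OF zs, of "{(p, t), (t, q)}" Y ?\<zeta> id])
        show "?E - fst ` set xs = {(p, t), (t, q)} \<union> Y" unfolding X E Y_def using 3 by auto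
        show "?E' - fst ` set xs = (\<Union>e\<in>{(p, t), (t, q)}. fst ` set (?\<zeta> e)) \<union> Y"
          using notX' ne unfolding X E' Y_def by auto
        show "(id (tgt d), id (src d')) \<in> chords xs" if "(d, d') \<in> set (cpairs xs)" for d d'
          using chordsI[OF that] by simp
      qed (use ne in \<open>auto simp: zlnk_def Y_def\<close>)
    qed
  next
    show "fst e \<noteq> fst d' \<and> (own (tgt e) = own (tgt d) \<or> own (tgt e) \<noteq> own (tgt d'))"
      if "d \<in> ?E \<times> UNIV" "d \<in> ?S" "d' \<in> ?E \<times> UNIV" "d' \<notin> ?S" "e \<in> set (\<sigma> d)" for d d' e
    proof -
      have d': "fst d' \<in> segs R" using that(3,4) unfolding E by (cases d') auto
      from that(2) obtain c where "d = ((p, t), c) \<or> d = ((t, q), c)" by auto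
      then have "fst e \<in> {(p, u1), (t, u2), (u1, t), (u2, q)}" "own (tgt e) = own (tgt d) \<or> own (tgt e) = own u1"
        using that(5) \<sigma>s new(6) by (cases c; auto)+
      then show ?thesis using d' ownE[OF that(3)] by auto
    qed
    show "(\<Union>d\<in>?E \<times> UNIV. set (\<sigma> d)) = ?E' \<times> UNIV"
    proof -
      have "?E \<times> UNIV = {((t, q), True), ((t, q), False), ((p, t), True), ((p, t), False)} \<union> segs R \<times> UNIV"
        unfolding E by (auto simp: UNIV_bool)
      moreover have "(\<Union>d\<in>segs R \<times> UNIV. set (\<sigma> d)) = (\<Union>d\<in>segs R \<times> UNIV. {d})"
      proof (rule SUP_cong[OF refl])
        fix d :: "'a dirseg" assume "d \<in> segs R \<times> UNIV"
        then have "fst d \<noteq> (t, q)" "fst d \<noteq> (p, t)" by auto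
        then show "set (\<sigma> d) = {d}" using \<sigma>I by simp
      qed
      ultimately have "(\<Union>d\<in>?E \<times> UNIV. set (\<sigma> d)) =
          set (\<sigma> ((t, q), True)) \<union> set (\<sigma> ((t, q), False)) \<union> set (\<sigma> ((p, t), True)) \<union> set (\<sigma> ((p, t), False)) \<union>
          segs R \<times> UNIV" by (simp add: Un_assoc)
      then show ?thesis unfolding E' \<sigma>s by (auto simp: UNIV_bool)
    qed
    show "set (\<sigma> d) \<inter> set (\<sigma> d') = {}" if "d \<in> ?E \<times> UNIV" "d' \<in> ?E \<times> UNIV" "d \<noteq> d'" for d d'
    proof -
      have *: "\<exists>c. d = ((t, q), c) \<or> d = ((p, t), c) \<or> fst d \<in> segs R \<and> \<sigma> d = [d]" if "d \<in> ?E \<times> UNIV" for d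
        using that \<sigma>I[of d] unfolding E by (cases d) fastforce
      from *[OF that(1)] *[OF that(2)] show ?thesis
        using that(3) ne by (elim exE disjE; simp; hypsubst?) (auto simp: \<sigma>_def split: if_splits)
    qed
    show "{v \<in> Field ?E' \<inter> A. own v = i} = {v \<in> Field ?E \<inter> A. own v = i} \<or>
       spread {v \<in> Field ?E' \<inter> A. own v = i}
         {p \<in> (\<Union>d\<in>?E \<times> UNIV. set (zip (\<sigma> d) (tl (\<sigma> d)))). own (tgt (fst p)) = i}" for i
    proof (cases "i = own u1")
      case False
      then show ?thesis unfolding Field_cpairs using new by auto
    next
      case True
      let ?P = "{p \<in> (\<Union>d\<in>?E \<times> UNIV. set (zip (\<sigma> d) (tl (\<sigma> d)))). own (tgt (fst p)) = i}"
      have U: "{v \<in> Field ?E' \<inter> A. own v = i} = {u1, u2}"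
        unfolding Field_cpairs using True new ownR by auto
      have m: "x \<in> ?P" if "d \<in> {(t, q), (p, t)} \<times> UNIV" "x \<in> set (zip (\<sigma> d) (tl (\<sigma> d)))"
        "own (tgt (fst x)) = i" for d x
        using that unfolding E by blast
      have P: "(((p, u1), True), ((t, u2), False)) \<in> ?P" "(((t, u2), True), ((p, u1), False)) \<in> ?P"
        "(((u1, t), False), ((u2, q), True)) \<in> ?P" "(((u2, q), False), ((u1, t), True)) \<in> ?P"
        using m[of "((p, t), True)"] m[of "((p, t), False)"] m[of "((t, q), True)"] m[of "((t, q), False)"]
          True new(6) by (auto simp: \<sigma>s)
      have "spread {u1, u2} ?P"
        unfolding spread_def
      proof (intro allI impI)
        fix X assume X: "{u1, u2} \<inter> X \<noteq> {}" "\<not> {u1, u2} \<subseteq> X"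
        then consider "u1 \<in> X" "u2 \<notin> X" | "u2 \<in> X" "u1 \<notin> X" by blast
        then show "\<exists>p\<in>?P. \<exists>p'\<in>?P. p \<noteq> p' \<and> tgt (fst p) \<in> X \<and> src (snd p) \<notin> X \<and>
            tgt (fst p') \<in> X \<and> src (snd p') \<notin> X"
        proof cases
          case 1
          then show ?thesis using ne by (intro bexI[OF _ P(1)] bexI[OF _ P(3)]) auto
        next
          case 2
          then show ?thesis using ne by (intro bexI[OF _ P(2)] bexI[OF _ P(4)]) auto
        qed
      qed
      then show ?thesis unfolding U by blast
    qed
    show "\<sigma> d = [d]" if "d \<in> ?E \<times> UNIV" "d \<notin> ?S" for d
      by (rule \<sigma>I) (use that in \<open>cases d; auto\<close>)+
  qed (use ends in auto)
qed

section \<open>Reduction of cyclic words\<close>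

text \<open>For different letters this is interlacing on a circle; both linear patterns are listed
  because rotations exchange them.\<close>

definition alt :: "'b list \<Rightarrow> 'b \<Rightarrow> 'b \<Rightarrow> bool" where
  "alt ws a b \<longleftrightarrow> subseq [a, b, a, b] ws \<or> subseq [b, a, b, a] ws"

lemma alt_commute: "alt ws a b \<longleftrightarrow> alt ws b a"
  by (auto simp: alt_def)

section \<open>Alternation is a cyclic notion\<close>

lemma subseq_set: "subseq xs ys \<Longrightarrow> set xs \<subseteq> set ys"
  by (auto dest: list_emb_set)

lemma alt_mem: "alt ws a b \<Longrightarrow> a \<in> set ws \<and> b \<in> set ws"
  unfolding alt_def using subseq_set by fastforce

lemma not_alt_append:
  assumes "a \<notin> set Y" "b \<notin> set X"
  shows "\<not> alt (X @ Y) a b"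
proof
  assume "alt (X @ Y) a b"
  then consider "subseq [a, b, a, b] (X @ Y)" | "subseq [b, a, b, a] (X @ Y)" unfolding alt_def by blast
  then show False
  proof cases
    case 1
    then obtain x y where "[a, b, a, b] = x @ y" "subseq x X" "subseq y Y" by (rule subseq_appendE)
    then show False using subseq_set[of x X] subseq_set[of y Y] assms by (auto simp: Cons_eq_append_conv)
  next
    case 2
    then obtain x y where "[b, a, b, a] = x @ y" "subseq x X" "subseq y Y" by (rule subseq_appendE)
    then show False using subseq_set[of x X] subseq_set[of y Y] assms by (auto simp: Cons_eq_append_conv)
  qed
qed

text \<open>If the moved letter opens the alternation, it closes the shifted one.\<close>

lemma alt_rotate1_imp:
  assumes "alt (x # xs) a b"
  shows "alt (xs @ [x]) a b"
proof -
  have *: "subseq [c, d, c, d] (xs @ [x]) \<or> subseq [d, c, d, c] (xs @ [x])"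
    if "subseq [c, d, c, d] (x # xs)" for c d
  proof (cases "x = c")
    case True
    then have "subseq [d, c, d] xs" using that by simp
    then have "subseq ([d, c, d] @ [c]) (xs @ [x])" using True by (intro list_emb_append_mono) auto
    then show ?thesis by simp
  next
    case False
    then have "subseq [c, d, c, d] xs" using that by simp
    then show ?thesis using list_emb_append_mono[of "(=)" "[c, d, c, d]" xs "[]" "[x]"] by simp
  qed
  show ?thesis using assms *[of a b] *[of b a] unfolding alt_def by blast
qed

lemma alt_rotate_imp: "alt ws a b \<Longrightarrow> alt (rotate n ws) a b"
proof (induction n)
  case (Suc n)
  then show ?case using alt_rotate1_imp[of "hd (rotate n ws)" "tl (rotate n ws)" a b]
    by (cases "rotate n ws") auto
qed simp

lemma rotate_back: "\<exists>m. rotate m (rotate n ws) = ws"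
proof (cases "ws = []")
  case False
  let ?k = "length ws - n mod length ws"
  have "rotate ?k (rotate n ws) = rotate (?k + n mod length ws) ws"
    by (metis rotate_rotate rotate_conv_mod)
  also have "?k + n mod length ws = length ws" using False by simp
  finally show ?thesis by (metis rotate_length01 rotate_conv_mod mod_self rotate0 id_apply)
qed simp

lemma alt_rotate [simp]: "alt (rotate n ws) a b \<longleftrightarrow> alt ws a b"
  by (metis alt_rotate_imp rotate_back)

lemma alt_append_commute: "alt (X @ Y) a b \<longleftrightarrow> alt (Y @ X) a b"
  by (metis alt_rotate rotate_append)

text \<open>Cyclically \<open>Z @ X\<close> is one interval, which confines \<open>a\<close>, while
  \<open>Y\<close> confines \<open>b\<close>.\<close>

lemma not_alt_block:
  assumes "a \<notin> set Y" "b \<notin> set X" "b \<notin> set Z"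
  shows "\<not> alt (X @ Y @ Z) a b"
proof -
  have "\<not> alt (Y @ Z @ X) b a" using not_alt_append[of b "Z @ X" a Y] assms by simp
  then show ?thesis using alt_append_commute[of X "Y @ Z"] alt_commute by fastforce
qed

text \<open>Cut the circle at an occurrence of \<open>b\<close>. The stretch from the first to the
  last \<open>a\<close> after the cut is free of \<open>b\<close>, since otherwise \<open>b\<close>,
  \<open>a\<close>, \<open>b\<close>, \<open>a\<close> would occur; it becomes
  \<open>X\<close>.\<close>

lemma not_alt_split:
  assumes "a \<noteq> b" "a \<in> set ws" "b \<in> set ws" "\<not> alt ws a b"
  shows "\<exists>n X Y. rotate n ws = X @ Y \<and> b \<notin> set X \<and> a \<notin> set Y"
proof -
  obtain U V where ws: "ws = U @ b # V" using assms(3) by (metis split_list)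
  define Z where "Z = V @ U"
  have r1: "rotate (length U) ws = b # Z" unfolding ws Z_def by (simp add: rotate_append)
  have "a \<in> set Z" using assms(1,2) unfolding ws Z_def by auto
  then obtain Z1 Z2 where Z: "Z = Z1 @ a # Z2" "a \<notin> set Z1" by (metis split_list_first)
  obtain M Z3 where M: "a # Z2 = M @ a # Z3" "a \<notin> set Z3" by (metis list.set_intros(1) split_list_last)
  have bM: "b \<notin> set M"
  proof
    assume "b \<in> set M"
    then obtain M' where M': "M = a # M'" "b \<in> set M'" using M(1) assms(1) by (cases M) auto
    have "subseq ([b] @ [] @ [a] @ [b] @ [a] @ []) ([b] @ Z1 @ [a] @ M' @ [a] @ Z3)"
      using M' by (intro list_emb_append_mono) (auto simp: subseq_singleton_left)
    moreover have "b # Z = [b] @ Z1 @ [a] @ M' @ [a] @ Z3" using Z M M' by simp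
    ultimately have "alt (b # Z) a b" by (simp add: alt_def)
    then show False using assms(4) r1 by (metis alt_rotate)
  qed
  have "b # Z = (b # Z1) @ (M @ [a]) @ Z3" using Z M by simp
  then have "rotate (length (b # Z1)) (b # Z) = (M @ [a]) @ (Z3 @ b # Z1)"
    by (metis append.assoc rotate_append)
  then have r3: "rotate (length (b # Z1) + length U) ws = (M @ [a]) @ (Z3 @ b # Z1)"
    using r1 by (metis rotate_rotate)
  have "b \<notin> set (M @ [a])" "a \<notin> set (Z3 @ b # Z1)" using bM M(2) Z(2) assms(1) by auto
  then show ?thesis using r3 by blast
qed

text \<open>The cyclic word of the bridges at the attachments, whose alternation graph is a tree: the last conjunct
  expresses acyclicity by the existence of vertices of degree at most one.\<close>

definition tree_word :: "'b list \<Rightarrow> bool" where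
  "tree_word ws \<longleftrightarrow> (\<forall>i\<in>set ws. 2 \<le> count_list ws i) \<and>
     (\<forall>S. S \<noteq> {} \<longrightarrow> S \<subset> set ws \<longrightarrow> (\<exists>i\<in>S. \<exists>j\<in>set ws - S. alt ws i j)) \<and>
     (\<forall>S r. S \<noteq> {} \<longrightarrow> S \<subseteq> set ws \<longrightarrow> r \<notin> S \<longrightarrow> (\<exists>k\<in>S. \<forall>a\<in>insert r S. \<forall>b\<in>insert r S.
        a \<noteq> k \<longrightarrow> b \<noteq> k \<longrightarrow> alt ws k a \<longrightarrow> alt ws k b \<longrightarrow> a = b))"

section \<open>Words with a tree of alternations\<close>

lemma tree_word_count: "tree_word ws \<Longrightarrow> i \<in> set ws \<Longrightarrow> 2 \<le> count_list ws i"
  by (simp add: tree_word_def)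

lemma tree_word_conn:
  "tree_word ws \<Longrightarrow> S \<noteq> {} \<Longrightarrow> S \<subset> set ws \<Longrightarrow> \<exists>i\<in>S. \<exists>j\<in>set ws - S. alt ws i j"
  by (simp add: tree_word_def)

lemma tree_word_acyc:
  "tree_word ws \<Longrightarrow> S \<noteq> {} \<Longrightarrow> S \<subseteq> set ws \<Longrightarrow> r \<notin> S \<Longrightarrow> \<exists>k\<in>S. \<forall>a\<in>insert r S. \<forall>b\<in>insert r S.
     a \<noteq> k \<longrightarrow> b \<noteq> k \<longrightarrow> alt ws k a \<longrightarrow> alt ws k b \<longrightarrow> a = b"
  by (simp add: tree_word_def)

lemma tree_word_transfer:
  assumes "tree_word ws" "set ws' = set ws" "\<And>i. i \<in> set ws' \<Longrightarrow> 2 \<le> count_list ws' i"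
    and eq: "\<And>a b. a \<noteq> b \<Longrightarrow> alt ws' a b \<longleftrightarrow> alt ws a b"
  shows "tree_word ws'"
  unfolding tree_word_def
proof (intro conjI allI impI ballI)
  fix S assume "S \<noteq> {}" "S \<subset> set ws'"
  then obtain i j where "i \<in> S" "j \<in> set ws - S" "alt ws i j"
    using assms(1,2) unfolding tree_word_def by metis
  moreover from this have "alt ws' i j" using eq[of i j] by blast
  ultimately show "\<exists>i\<in>S. \<exists>j\<in>set ws' - S. alt ws' i j" using assms(2) by blast
next
  fix S r assume "S \<noteq> {}" "S \<subseteq> set ws'" "r \<notin> S"
  then obtain k where k: "k \<in> S" "\<forall>a\<in>insert r S. \<forall>b\<in>insert r S.
        a \<noteq> k \<longrightarrow> b \<noteq> k \<longrightarrow> alt ws k a \<longrightarrow> alt ws k b \<longrightarrow> a = b"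
    using assms(1,2) unfolding tree_word_def by metis
  then have "\<forall>a\<in>insert r S. \<forall>b\<in>insert r S.
        a \<noteq> k \<longrightarrow> b \<noteq> k \<longrightarrow> alt ws' k a \<longrightarrow> alt ws' k b \<longrightarrow> a = b"
    using eq by metis
  then show "\<exists>k\<in>S. \<forall>a\<in>insert r S. \<forall>b\<in>insert r S.
        a \<noteq> k \<longrightarrow> b \<noteq> k \<longrightarrow> alt ws' k a \<longrightarrow> alt ws' k b \<longrightarrow> a = b" using k(1) by blast
qed (use assms(3) in auto)

lemma count_list_rotate [simp]: "count_list (rotate n ws) i = count_list ws i"
  by (metis add.commute append_take_drop_id count_list_append rotate_drop_take)

lemma tree_word_rotate: "tree_word ws \<Longrightarrow> tree_word (rotate n ws)"
  by (rule tree_word_transfer[of ws]) (auto simp: tree_word_def)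

definition leaf :: "'b list \<Rightarrow> 'b \<Rightarrow> 'b \<Rightarrow> bool" where
  "leaf ws s r \<longleftrightarrow> s \<noteq> r \<and> alt ws s r \<and> (\<forall>k\<in>set ws. k \<noteq> s \<longrightarrow> alt ws s k \<longrightarrow> k = r)"

text \<open>\<open>s\<close> alternates with \<open>r\<close> only, as it occurs only on the two
  sides of one \<open>r\<close>. It is thus a leaf of the alternation graph, and deleting it leaves
  a tree.\<close>

lemma tree_word_leaf_removed:
  assumes t: "tree_word (s # r # s # Q)" and s: "s \<noteq> r" "s \<notin> set Q" and r: "r \<in> set Q"
  shows "tree_word (r # Q)"
proof -
  let ?ws = "s # r # s # Q"
  have alt_eq: "alt ?ws a b \<longleftrightarrow> alt (r # Q) a b" if "a \<noteq> b" "a \<noteq> s" "b \<noteq> s" for a b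
    using that by (simp add: alt_def)
  have lf: "k = r" if "alt ?ws s k" "k \<noteq> s" for k
  proof (rule ccontr)
    assume "k \<noteq> r"
    then have "subseq [k, s, k] Q \<or> subseq [k, s, k, s] Q" using that s by (auto simp: alt_def split: if_splits)
    then show False using s(2) subseq_set by fastforce
  qed
  show ?thesis
    unfolding tree_word_def
  proof (intro conjI allI impI ballI)
    fix i assume i: "i \<in> set (r # Q)"
    then have "2 \<le> count_list ?ws i" using t by (auto simp: tree_word_def)
    moreover have "i \<noteq> s" using i s by auto
    ultimately show "2 \<le> count_list (r # Q) i" by (auto split: if_splits)
  next
    fix S assume S: "S \<noteq> {}" "S \<subset> set (r # Q)"
    \<comment> \<open>Putting \<open>s\<close> on the side of \<open>r\<close> ensures that the
      alternating pair across the cut does not involve \<open>s\<close>.\<close>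
    define S' where "S' = (if r \<in> S then insert s S else S)"
    have sS: "s \<notin> S" using S(2) s by auto
    have "S' \<noteq> {}" "S' \<subset> set ?ws" using S sS s by (auto simp: S'_def)
    then obtain i j where ij: "i \<in> S'" "j \<in> set ?ws - S'" "alt ?ws i j"
      using t unfolding tree_word_def by metis
    have "i \<noteq> j" using ij by blast
    have "j \<noteq> s"
    proof
      assume "j = s"
      then have "r \<notin> S" using ij(2) by (auto simp: S'_def split: if_splits)
      then have "i = r" using lf[of i] ij alt_commute[of ?ws] \<open>j = s\<close> \<open>i \<noteq> j\<close> by blast
      then show False using \<open>r \<notin> S\<close> ij(1) by (simp add: S'_def)
    qed
    moreover have "i \<noteq> s"
    proof
      assume "i = s"
      then have "r \<in> S" using ij(1) sS by (auto simp: S'_def split: if_splits)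
      moreover have "j = r" using lf[of j] ij \<open>i = s\<close> \<open>j \<noteq> s\<close> by blast
      ultimately show False using ij(2) by (auto simp: S'_def)
    qed
    ultimately have "i \<in> S" "j \<in> set (r # Q) - S" "alt (r # Q) i j"
      using ij alt_eq \<open>i \<noteq> j\<close> by (auto simp: S'_def split: if_splits)
    then show "\<exists>i\<in>S. \<exists>j\<in>set (r # Q) - S. alt (r # Q) i j" by blast
  next
    fix S x assume S: "S \<noteq> {}" "S \<subseteq> set (r # Q)" "x \<notin> S"
    then have "S \<subseteq> set ?ws" by auto
    then obtain k where k: "k \<in> S" "\<forall>a\<in>insert x S. \<forall>b\<in>insert x S.
        a \<noteq> k \<longrightarrow> b \<noteq> k \<longrightarrow> alt ?ws k a \<longrightarrow> alt ?ws k b \<longrightarrow> a = b"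
      using t S(1,3) unfolding tree_word_def by metis
    have ks: "k \<noteq> s" using k(1) S(2) s by auto
    have "alt ?ws k a" if "alt (r # Q) k a" "a \<noteq> k" for a
      using alt_eq[of k a] that alt_mem[OF that(1)] s ks by auto
    then show "\<exists>k\<in>S. \<forall>a\<in>insert x S. \<forall>b\<in>insert x S.
        a \<noteq> k \<longrightarrow> b \<noteq> k \<longrightarrow> alt (r # Q) k a \<longrightarrow> alt (r # Q) k b \<longrightarrow> a = b"
      using k by (intro bexI[of _ k]) blast+
  qed
qed

text \<open>One disjunct for each of \<open>family_base\<close>, \<open>family_duplicate\<close>,
  \<open>family_cross\<close> and \<open>family_interleave\<close>.\<close>

definition reducible :: "'b list \<Rightarrow> bool" where
  "reducible ws \<longleftrightarrow> (\<exists>n a. rotate n ws = [a, a]) \<or>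
     (\<exists>n a Q. rotate n ws = a # a # Q \<and> Q \<noteq> [] \<and> tree_word (a # Q)) \<or>
     (\<exists>n s r Q. rotate n ws = s # r # s # Q \<and> s \<noteq> r \<and> s \<notin> set Q \<and> Q \<noteq> [] \<and> tree_word (r # Q)) \<or>
     (\<exists>n s r Q. rotate n ws = s # r # s # r # s # Q \<and> s \<noteq> r \<and> tree_word (s # r # s # Q))"

lemma reducible_rotate: "reducible (rotate m ws) \<Longrightarrow> reducible ws"
  unfolding reducible_def rotate_rotate by blast

text \<open>Alternation does not see a repeated neighbour, and the occurrence in \<open>Q\<close>
  keeps the count at two.\<close>

lemma tree_word_duplicate:
  assumes "tree_word (a # a # Q)" "a \<in> set Q"
  shows "tree_word (a # Q)"
proof (rule tree_word_transfer[OF assms(1)])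
  show "alt (a # Q) x y \<longleftrightarrow> alt (a # a # Q) x y" if "x \<noteq> y" for x y
    using that by (auto simp: alt_def)
  show "2 \<le> count_list (a # Q) i" if "i \<in> set (a # Q)" for i
  proof (cases "i = a")
    case True
    have "count_list Q a \<noteq> 0" using assms(2) by (simp add: count_list_0_iff)
    then show ?thesis using True by simp
  next
    case False
    then show ?thesis using assms(1) that by (auto simp: tree_word_def)
  qed
qed auto

text \<open>The occurrence of \<open>r\<close> in \<open>Q\<close> lets \<open>s\<close> and
  \<open>r\<close> alternate in the shorter word as well; other pairs do not see the
  difference.\<close>

lemma tree_word_interleave:
  assumes "tree_word (s # r # s # r # s # Q)" "s \<noteq> r" "r \<in> set Q"
  shows "tree_word (s # r # s # Q)"
proof (rule tree_word_transfer[OF assms(1)])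
  have sub: "subseq [r] Q" using assms(3) by (simp add: subseq_singleton_left)
  show "alt (s # r # s # Q) x y \<longleftrightarrow> alt (s # r # s # r # s # Q) x y" if "x \<noteq> y" for x y
    using that assms(2) sub by (auto simp: alt_def)
  show "2 \<le> count_list (s # r # s # Q) i" if "i \<in> set (s # r # s # Q)" for i
  proof (cases "i = r \<or> i = s")
    case True
    have "count_list Q r \<noteq> 0" using assms(3) by (simp add: count_list_0_iff)
    then show ?thesis using True assms(2) by auto
  next
    case False
    then show ?thesis using assms(1) that by (auto simp: tree_word_def)
  qed
qed (use assms in auto)

lemma alt_between:
  assumes "V = P @ [s] @ g @ [s] @ W" "k \<in> set g" "k \<in> set P \<union> set W"
  shows "alt V s k"
proof (cases "k \<in> set P")
  case True
  have "subseq ([k] @ [s] @ [k] @ [s] @ []) (P @ [s] @ g @ [s] @ W)"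
    using assms(2) True by (intro list_emb_append_mono) (auto simp: subseq_singleton_left)
  then show ?thesis by (simp add: alt_def assms(1))
next
  case False
  have "subseq ([] @ [s] @ [k] @ [s] @ [k]) (P @ [s] @ g @ [s] @ W)"
    using assms(2,3) False by (intro list_emb_append_mono) (auto simp: subseq_singleton_left)
  then show ?thesis by (simp add: alt_def assms(1))
qed

lemma tree_word_reducible:
  assumes t: "tree_word ws" "ws \<noteq> []"
  shows "reducible ws"
proof (cases "\<exists>a. set ws = {a}")
  case True
  then obtain a where a: "set ws = {a}" by blast
  have "2 \<le> count_list ws a" using tree_word_count[OF t(1)] a by simp
  then obtain Q where ws: "ws = a # a # Q"
    using a by (cases ws; cases "tl ws") (auto split: if_splits)
  show ?thesis
  proof (cases "Q = []")
    case True
    then have "rotate 0 ws = [a, a]" using ws by simp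
    then show ?thesis unfolding reducible_def by blast
  next
    case False
    then have "a \<in> set Q" using a ws by (cases Q) auto
    then have "rotate 0 ws = a # a # Q \<and> Q \<noteq> [] \<and> tree_word (a # Q)"
      using tree_word_duplicate[of a Q] t ws False by simp
    then show ?thesis unfolding reducible_def by blast
  qed
next
  case False
  have leaf_of: "\<exists>r. leaf ws k r"
    if k: "k \<in> set ws" "\<And>a b. a \<noteq> k \<Longrightarrow> b \<noteq> k \<Longrightarrow> alt ws k a \<Longrightarrow> alt ws k b \<Longrightarrow> a = b" for k
  proof -
    have "{k} \<subset> set ws" using False k(1) by blast
    then obtain j where j: "j \<in> set ws - {k}" "alt ws k j"
    proof -
      have "\<exists>i\<in>{k}. \<exists>j\<in>set ws - {k}. alt ws i j"
        by (rule tree_word_conn[OF t(1) _ \<open>{k} \<subset> set ws\<close>]) simp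
      then show ?thesis using that by blast
    qed
    have "i = j" if "i \<noteq> k" "alt ws k i" for i
      by (rule k(2)) (use j that in simp_all)
    then have "leaf ws k j" using j unfolding leaf_def by auto
    then show ?thesis ..
  qed
  \<comment> \<open>Lengths of cyclic intervals that contain all occurrences of some leaf. The
    minimum is taken over all leaves and all rotations at once, which allows a comparison with a
    different leaf below.\<close>
  define ok where "ok = (\<lambda>m. \<exists>s r n X Y. rotate n ws = X @ Y \<and> leaf ws s r \<and> s \<notin> set Y \<and> length X = m)"
  have okI: "ok (length X)" if "rotate n ws = X @ Y" "leaf ws s r" "s \<notin> set Y" for n X Y s r
    unfolding ok_def using that by blast
  obtain r0 where r0: "r0 \<in> set ws" using t(2) by (cases ws) auto
  \<comment> \<open>With \<open>r0\<close> as the extra letter, the acyclicity condition speaks of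
    the whole alphabet.\<close>
  have "set ws - {r0} \<noteq> {}" using False r0 by blast
  then obtain k where k: "k \<in> set ws - {r0}" "\<forall>a\<in>insert r0 (set ws - {r0}). \<forall>b\<in>insert r0 (set ws - {r0}).
        a \<noteq> k \<longrightarrow> b \<noteq> k \<longrightarrow> alt ws k a \<longrightarrow> alt ws k b \<longrightarrow> a = b"
  proof -
    have "set ws - {r0} \<subseteq> set ws" "r0 \<notin> set ws - {r0}" by auto
    then show ?thesis
      using tree_word_acyc[OF t(1) \<open>set ws - {r0} \<noteq> {}\<close>] that by blast
  qed
  have "\<exists>r. leaf ws k r"
    by (rule leaf_of) (use k r0 alt_mem[of ws k] in \<open>auto simp: insert_absorb\<close>)
  then obtain r where "leaf ws k r" by blast
  then have "ok (length ws)" using okI[of 0 ws "[]" k r] by simp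
  then have "ok (LEAST m. ok m)" by (rule LeastI)
  then obtain s r n X Y where sr: "rotate n ws = X @ Y" "leaf ws s r" "s \<notin> set Y" "length X = (LEAST m. ok m)"
    unfolding ok_def by blast
  define V where "V = X @ Y"
  have altV: "alt V a b \<longleftrightarrow> alt ws a b" for a b using sr(1) by (metis V_def alt_rotate)
  have setV: "set V = set ws" using sr(1) by (metis V_def set_rotate)
  have tV: "tree_word V" using tree_word_rotate[OF t(1), of n] sr(1) by (simp add: V_def)
  have min: "length X \<le> length X'" if "V = Q @ X' @ P" "leaf ws s' r'" "s' \<notin> set Q" "s' \<notin> set P" for Q X' P s' r'
  proof -
    have "rotate (length Q) (rotate n ws) = X' @ (P @ Q)"
      using that(1) sr(1) by (simp add: V_def[symmetric] rotate_append)
    then have "ok (length X')" using okI[of "length Q + n" X' "P @ Q" s' r'] that(2-4) by (simp add: rotate_rotate)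
    then show ?thesis using sr(4) by (simp add: Least_le)
  qed
  have lf: "s \<noteq> r" "alt V s r" "\<And>k. k \<in> set V \<Longrightarrow> k \<noteq> s \<Longrightarrow> alt V s k \<Longrightarrow> k = r"
    using sr(2) altV setV unfolding leaf_def by blast+
  have srV: "s \<in> set V" "r \<in> set V" using alt_mem[OF lf(2)] by auto
  then have sX: "s \<in> set X" using sr(3) by (simp add: V_def)
  have hdX: "hd X = s"
  proof (rule ccontr)
    assume "hd X \<noteq> s"
    moreover obtain a X' where "X = a # X'" using sX by (cases X) auto
    ultimately show False using min[of "[a]" X' Y s r] sr(2,3) by (auto simp: V_def)
  qed
  have lastX: "last X = s"
  proof (rule ccontr)
    assume a: "last X \<noteq> s"
    moreover have "X = butlast X @ [last X]" using sX by (cases X) auto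
    moreover from this have "V = [] @ butlast X @ (last X # Y)" unfolding V_def
      by (metis append.assoc append_Cons append_Nil)
    ultimately show False using min[of "[]" "butlast X" "last X # Y" s r] sr(2,3) sX
      by (cases X) auto
  qed
  have Xsr: "k = s \<or> k = r" if k: "k \<in> set X" for k
  proof (rule ccontr)
    assume "\<not> (k = s \<or> k = r)"
    then have ks: "k \<noteq> s" "k \<noteq> r" by auto
    obtain P Q where X: "X = P @ k # Q" using k by (metis split_list)
    have "s \<in> set P" using X hdX ks by (cases P) auto
    then obtain P' g1 where P: "P = P' @ s # g1" "s \<notin> set g1" by (metis split_list_last)
    have "s \<in> set Q" using X lastX ks by (cases Q) (auto split: if_splits dest: last_in_set)
    then obtain g2 Q' where Q: "Q = g2 @ s # Q'" "s \<notin> set g2" by (metis split_list_first)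
    \<comment> \<open>The gap around \<open>k\<close> between two consecutive occurrences of
      \<open>s\<close>.\<close>
    define g where "g = g1 @ k # g2"
    define W where "W = Q' @ Y"
    have V: "V = P' @ [s] @ g @ [s] @ W" using X P Q by (simp add: V_def g_def W_def)
    have sg: "s \<notin> set g" using P(2) Q(2) ks by (simp add: g_def)
    \<comment> \<open>A letter of the gap that also occurs outside alternates with \<open>s\<close>,
      so it is the only neighbour \<open>r\<close> of the leaf.\<close>
    have only: "j \<notin> set P \<union> set W" if "j \<in> set g" "j \<noteq> r" "P = P'" for j P
    proof
      assume "j \<in> set P \<union> set W"
      then have "alt V s j" using alt_between[OF V] that by blast
      moreover have "j \<in> set V" "j \<noteq> s" using that(1) sg V by auto
      ultimately show False using lf(3) that(2) by blast
    qed
    \<comment> \<open>Letters of \<open>S\<close> live inside the gap, hence alternate neither with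
      \<open>s\<close> nor with letters that avoid the gap. All their neighbours are in
      \<open>S\<close> or equal to \<open>r\<close>, so a vertex of degree at most one there is a
      leaf of the whole word, with a shorter interval.\<close>
    define S where "S = {j \<in> set g. j \<noteq> r \<and> j \<notin> set P' \<union> set W}"
    have kS: "k \<in> S" using only[of k P'] ks by (simp add: S_def g_def)
    have SV: "S \<subseteq> set V" unfolding S_def V by auto
    have nbr: "j' \<in> insert r S" if j: "j \<in> S" "alt V j j'" "j' \<noteq> j" for j j'
    proof (rule ccontr)
      assume nS: "j' \<notin> insert r S"
      have jV: "j' \<in> set V" using alt_mem[OF j(2)] by simp
      have js: "j \<noteq> s" using j(1) sg by (auto simp: S_def)
      have "j' \<noteq> s"
      proof
        assume "j' = s"
        then have "j = r" using lf(3)[of j] js j SV alt_commute[of V] by blast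
        then show False using j(1) by (simp add: S_def)
      qed
      show False
      proof (cases "j' \<in> set g")
        case True
        then show False using only[OF True] nS by (auto simp: S_def)
      next
        case False
        have "\<not> alt ((P' @ [s]) @ g @ ([s] @ W)) j' j"
          by (rule not_alt_block) (use False j(1) js in \<open>auto simp: S_def\<close>)
        then show False using j(2) alt_commute[of V j j'] V by simp
      qed
    qed
    obtain k0 where k0: "k0 \<in> S" "\<forall>a\<in>insert r S. \<forall>b\<in>insert r S.
        a \<noteq> k0 \<longrightarrow> b \<noteq> k0 \<longrightarrow> alt V k0 a \<longrightarrow> alt V k0 b \<longrightarrow> a = b"
    proof -
      have "S \<noteq> {}" "r \<notin> S" using kS by (auto simp: S_def)
      then show ?thesis using tree_word_acyc[OF tV _ SV] that by blast
    qed
    have "\<exists>r'. leaf ws k0 r'"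
    proof (rule leaf_of)
      show "k0 \<in> set ws" using k0(1) SV setV by blast
      show "a = b" if "a \<noteq> k0" "b \<noteq> k0" "alt ws k0 a" "alt ws k0 b" for a b
        using k0(2) nbr[OF k0(1)] that altV by metis
    qed
    then obtain r' where "leaf ws k0 r'" by blast
    moreover have "k0 \<notin> set (P' @ [s])" "k0 \<notin> set ([s] @ W)"
      using k0(1) sg by (auto simp: S_def)
    moreover have "V = (P' @ [s]) @ g @ ([s] @ W)" using V by simp
    ultimately have "length X \<le> length g" using min by metis
    then show False using X P Q by (simp add: g_def)
  qed
  have rX: "r \<in> set X"
  proof (rule ccontr)
    assume "r \<notin> set X"
    then have "\<not> alt V s r" using not_alt_append[of s Y r X] sr(3) by (simp add: V_def)
    then show False using lf(2) by blast
  qed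
  \<comment> \<open>If \<open>Y\<close> is empty, cutting the circle at an \<open>r\<close> gives a
    shorter interval. Otherwise the letters of \<open>Y\<close> would not occur in \<open>X\<close>
    and alternate with nothing outside \<open>Y\<close>, against connectedness.\<close>
  have rY: "r \<in> set Y"
  proof (rule ccontr)
    assume rY: "r \<notin> set Y"
    show False
    proof (cases "Y = []")
      case True
      obtain X1 X2 where X: "X = X1 @ r # X2" using rX by (metis split_list)
      have "rotate (length (X1 @ [r]) + n) ws = (X2 @ X1) @ [r]"
        using sr(1) True X rotate_append[of "X1 @ [r]" X2] by (simp add: rotate_rotate[symmetric])
      then have "ok (length (X2 @ X1))" by (rule okI[OF _ sr(2)]) (use lf(1) in simp)
      then have "length X \<le> length (X2 @ X1)" using sr(4) by (simp add: Least_le)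
      then show False using X by simp
    next
      case False
      then have "set Y \<noteq> {}" "set Y \<subset> set V" using srV sr(3) by (auto simp: V_def)
      then obtain i j where ij: "i \<in> set Y" "j \<in> set V - set Y" "alt V i j"
        using tree_word_conn[OF tV] by metis
      have "i \<notin> set X" using Xsr[of i] ij(1) sr(3) rY by auto
      then show False using not_alt_append[of j Y i X] ij alt_commute[of V] by (auto simp: V_def)
    qed
  qed
  have "reducible V"
  proof (cases "\<exists>P a Q. X = P @ a # a # Q")
    case True
    then obtain P a Q where X: "X = P @ a # a # Q" by blast
    have a: "a \<in> set (Q @ Y @ P)"
    proof (cases "a = r")
      case False
      then have as: "a = s" using Xsr[of a] X by auto
      have "P \<noteq> [] \<or> Q \<noteq> []" using X as rX lf(1) by auto
      then show ?thesis using X as hdX lastX by (cases P; cases Q rule: rev_cases) auto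
    qed (use rY in auto)
    have r: "rotate (length P) V = a # a # (Q @ Y @ P)" using X by (simp add: V_def rotate_append)
    then have "tree_word (a # a # (Q @ Y @ P))" using tree_word_rotate[OF tV, of "length P"] by simp
    then have "tree_word (a # (Q @ Y @ P))" using tree_word_duplicate[OF _ a] by blast
    moreover have "Q @ Y @ P \<noteq> []" using a by force
    ultimately show ?thesis using r unfolding reducible_def by metis
  next
    \<comment> \<open>Without equal neighbours \<open>X\<close> alternates between \<open>s\<close>
      and \<open>r\<close>, with \<open>s\<close> at both ends and at least one \<open>r\<close>. If
      it is just \<open>s\<close>, \<open>r\<close>, \<open>s\<close>, then \<open>s\<close> does
      not occur elsewhere.\<close>
    case False
    obtain X1 where X1: "X = s # X1" using hdX sX by (cases X) auto
    then obtain x X2 where X2: "X1 = x # X2" using rX lf(1) by (cases X1) auto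
    have "x \<noteq> s" using False X1 X2 by (metis append_Nil)
    then have x: "x = r" using Xsr[of x] X1 X2 by auto
    obtain y X3 where X3: "X2 = y # X3" using lastX X1 X2 x lf(1) by (cases X2) auto
    have "y \<noteq> r" using False X1 X2 X3 x by (metis append_Cons append_Nil)
    then have y: "y = s" using Xsr[of y] X1 X2 X3 by auto
    have r0: "rotate 0 V = V" by simp
    show ?thesis
    proof (cases X3)
      case Nil
      then have V: "V = s # r # s # Y" using X1 X2 X3 x y by (simp add: V_def)
      then have "tree_word (r # Y)" using tree_word_leaf_removed tV lf(1) sr(3) rY by metis
      moreover have "Y \<noteq> []" using rY by auto
      ultimately show ?thesis using V r0 lf(1) sr(3) unfolding reducible_def by metis
    next
      case (Cons z X4)
      have "z \<noteq> s" using False X1 X2 X3 Cons x y by (metis append_Cons append_Nil)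
      then have z: "z = r" using Xsr[of z] X1 X2 X3 Cons by auto
      obtain u X5 where X5: "X4 = u # X5" using lastX X1 X2 X3 Cons z lf(1) by (cases X4) auto
      have "u \<noteq> r" using False X1 X2 X3 Cons X5 x y z by (metis append_Cons append_Nil)
      then have u: "u = s" using Xsr[of u] X1 X2 X3 Cons X5 by auto
      have V: "V = s # r # s # r # s # (X5 @ Y)" using X1 X2 X3 Cons X5 x y z u by (simp add: V_def)
      then have "tree_word (s # r # s # (X5 @ Y))" using tree_word_interleave tV lf(1) rY by (metis UnCI set_append)
      then show ?thesis using V r0 lf(1) unfolding reducible_def by metis
    qed
  qed
  then show ?thesis using sr(1) reducible_rotate[of n ws] by (simp add: V_def)
qed

section \<open>Families for all cyclic words of tree type\<close>

lemma family_attached: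
  assumes "distinct w" "set w \<subseteq> A" "tree_word (map own w)" "w \<noteq> []"
  shows "\<exists>F. family own A (set (cpairs w)) F"
  using assms
proof (induction "length w" arbitrary: w rule: less_induct)
  case less
  have red: "reducible (map own w)"
    by (rule tree_word_reducible) (use less.prems(3,4) in auto)
  have rot: "rotate n (map own w) = map own (rotate n w)" for n by (simp add: rotate_map)
  have "\<exists>v n. v = rotate n w \<and> (\<exists>F. family own A (set (cpairs v)) F)"
    using red unfolding reducible_def rot
  proof (elim disjE exE conjE)
    fix n a assume m: "map own (rotate n w) = [a, a]"
    then obtain p q where v: "rotate n w = [p, q]" "own p = a" "own q = a" by (auto simp: map_eq_Cons_conv)
    have "distinct (rotate n w)" "set (rotate n w) \<subseteq> A" using less.prems(1,2) by auto
    then have "\<exists>F. family own A (set (cpairs [p, q])) F" unfolding v(1) using v(2,3) by (intro family_base) auto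
    then show ?thesis using v(1) by metis
  next
    fix n a Q assume m: "map own (rotate n w) = a # a # Q" "Q \<noteq> []" "tree_word (a # Q)"
    then obtain t t' R where v: "rotate n w = t # t' # R" "own t = a" "own t' = a" "map own R = Q"
      by (auto simp: map_eq_Cons_conv)
    have d: "distinct (t # t' # R)" "set (t # t' # R) \<subseteq> A" "length w = length (t # t' # R)"
      using less.prems(1,2) v(1) by (metis distinct_rotate set_rotate length_rotate)+
    have "\<exists>F. family own A (set (cpairs (t # R))) F"
      by (rule less.hyps) (use d v m in auto)
    then obtain F where "family own A (set (cpairs (t # R))) F" ..
    then have "\<exists>F. family own A (set (cpairs (t # t' # R))) F"
      by (rule family_duplicate) (use d v m(2) in auto)
    then show ?thesis using v(1) by metis
  next
    fix n s r Q assume m: "map own (rotate n w) = s # r # s # Q" "s \<noteq> r" "s \<notin> set Q" "Q \<noteq> []" "tree_word (r # Q)"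
    then obtain u1 t u2 R where v: "rotate n w = u1 # t # u2 # R" "own u1 = s" "own t = r" "own u2 = s" "map own R = Q"
      by (auto simp: map_eq_Cons_conv)
    have d: "distinct (u1 # t # u2 # R)" "set (u1 # t # u2 # R) \<subseteq> A" "length w = length (u1 # t # u2 # R)"
      using less.prems(1,2) v(1) by (metis distinct_rotate set_rotate length_rotate)+
    have "\<exists>F. family own A (set (cpairs (t # R))) F"
      by (rule less.hyps) (use d v m in auto)
    then obtain F where "family own A (set (cpairs (t # R))) F" ..
    then have "\<exists>F. family own A (set (cpairs (t # u2 # R @ [u1]))) F"
      by (rule family_cross) (use d v m(2-4) in \<open>auto simp: v(5)[symmetric]\<close>)
    then have "\<exists>F. family own A (set (cpairs (u1 # t # u2 # R))) F"
      using set_cpairs_commute[of "t # u2 # R" "[u1]"] by simp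
    then show ?thesis using v(1) by metis
  next
    fix n s r Q assume m: "map own (rotate n w) = s # r # s # r # s # Q" "s \<noteq> r" "tree_word (s # r # s # Q)"
    then obtain u1 t u2 t2 u3 R where v: "rotate n w = u1 # t # u2 # t2 # u3 # R" "own u1 = s" "own t = r"
        "own u2 = s" "own t2 = r" "own u3 = s" "map own R = Q"
      by (auto simp: map_eq_Cons_conv)
    have d: "distinct (u1 # t # u2 # t2 # u3 # R)" "set (u1 # t # u2 # t2 # u3 # R) \<subseteq> A"
        "length w = length (u1 # t # u2 # t2 # u3 # R)"
      using less.prems(1,2) v(1) by (metis distinct_rotate set_rotate length_rotate)+
    have "\<exists>F. family own A (set (cpairs (u1 # t # u3 # R))) F"
      by (rule less.hyps) (use d v m in auto)
    then obtain F where "family own A (set (cpairs (t # u3 # R @ [u1]))) F"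
      using set_cpairs_commute[of "t # u3 # R" "[u1]"] by auto
    then have "\<exists>F. family own A (set (cpairs (t # u2 # t2 # u3 # R @ [u1]))) F"
      by (rule family_interleave) (use d v m(2) in auto)
    then have "\<exists>F. family own A (set (cpairs (u1 # t # u2 # t2 # u3 # R))) F"
      using set_cpairs_commute[of "t # u2 # t2 # u3 # R" "[u1]"] by simp
    then show ?thesis using v(1) by metis
  qed
  then show ?case by auto
qed

text \<open>The induction deletes the vertices that are no attachments one by one; deleting them
  does not change the word.\<close>

theorem family_exists:
  assumes "distinct w" "tree_word (map own (filter (\<lambda>v. v \<in> A) w))" "\<exists>v\<in>set w. v \<in> A"
    and "\<And>n v. n \<in> set w \<Longrightarrow> n \<notin> A \<Longrightarrow> v \<in> set w \<Longrightarrow> own v = own n \<Longrightarrow> v = n"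
  shows "\<exists>F. family own A (set (cpairs w)) F"
  using assms
proof (induction "length w" arbitrary: w rule: less_induct)
  case less
  show ?case
  proof (cases "set w \<subseteq> A")
    case True
    then have "filter (\<lambda>v. v \<in> A) w = w" by (simp add: filter_id_conv subset_iff)
    then show ?thesis using family_attached[of w A own] less.prems True by fastforce
  next
    case False
    then obtain n P Q where n: "n \<notin> A" "w = P @ n # Q" by (metis split_list subsetI)
    let ?w = "P @ Q"
    have fw: "filter (\<lambda>v. v \<in> A) ?w = filter (\<lambda>v. v \<in> A) w" using n by simp
    obtain v where v: "v \<in> set w" "v \<in> A" using less.prems(3) by blast
    \<comment> \<open>Every letter occurs at least twice, so two vertices survive the deletion of
      \<open>n\<close>, and \<open>R\<close> below is not empty.\<close>
    have "2 \<le> count_list (map own (filter (\<lambda>v. v \<in> A) w)) (own v)"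
      by (rule tree_word_count[OF less.prems(2)]) (use v in auto)
    then have "2 \<le> length (filter (\<lambda>v. v \<in> A) ?w)"
      using count_le_length[of "map own (filter (\<lambda>v. v \<in> A) w)" "own v"] fw by simp
    then have len: "2 \<le> length (Q @ P)" using length_filter_le[of "\<lambda>v. v \<in> A" ?w] by simp
    obtain R t where R: "Q @ P = R @ [t]" using len by (metis list.size(3) not_numeral_le_zero rev_exhaust)
    have "\<exists>F. family own A (set (cpairs ?w)) F"
    proof (rule less.hyps)
      show "length ?w < length w" "distinct ?w" using n less.prems(1) by auto
      show "tree_word (map own (filter (\<lambda>v. v \<in> A) ?w))" using less.prems(2) fw by simp
      show "\<exists>v\<in>set ?w. v \<in> A" using v n by auto
      show "v = m" if "m \<in> set ?w" "m \<notin> A" "v \<in> set ?w" "own v = own m" for m v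
        by (rule less.prems(4)) (use that n in auto)
    qed
    then obtain F where "family own A (set (cpairs (t # R))) F"
      using set_cpairs_commute[of P Q] set_cpairs_commute[of R "[t]"] R by auto
    moreover have dR: "distinct (n # R @ [t])" "set (R @ [t]) \<subseteq> set w"
      using less.prems(1) n R[symmetric] by auto
    moreover have "R \<noteq> []" using len R by (cases R) auto
    moreover have "own n \<notin> own ` set (t # R)"
    proof
      assume "own n \<in> own ` set (t # R)"
      then obtain v where "v \<in> set (t # R)" "own n = own v" by (rule imageE)
      then have "v = n" using less.prems(4)[of n v] n dR(2) by auto
      then show False using dR(1) \<open>v \<in> set (t # R)\<close> by auto
    qed
    ultimately have "\<exists>F. family own A (set (cpairs (t # n # R))) F"
      using n(1) by (intro family_insert) auto
    moreover have "set (cpairs (t # n # R)) = set (cpairs w)"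
      using set_cpairs_commute[of "[t]" "n # R"] set_cpairs_commute[of P "n # Q"] n(2) R[symmetric] by simp
    ultimately show ?thesis by simp
  qed
qed

section \<open>Overlapping bridges\<close>

abbreviation undir :: "('a \<times> 'a) set \<Rightarrow> 'a set set" where
  "undir R \<equiv> (\<lambda>(u, v). {u, v}) ` R"

lemma edges_underlying: "edges (underlying R) = undir R"
  by (auto simp: underlying_def)

lemma verts_underlying: "verts (underlying R) = Field R"
  by (simp add: underlying_def)

section \<open>Cycles and paths as lists\<close>

lemma is_dicycle_iff:
  "is_dicycle R \<longleftrightarrow> (\<exists>w. distinct w \<and> length w \<ge> 3 \<and> R = set (cpairs w))"
  unfolding is_dicycle_def set_cpairs_conv_nth ..

lemma path_edges: "{{xs ! i, xs ! Suc i} | i. Suc i < length xs} = undir (segs xs)"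
proof -
  have "segs xs = {(xs ! i, xs ! Suc i) | i. Suc i < length xs}"
    by (cases xs) (auto simp: set_zip)
  then show ?thesis by auto
qed

lemma segs_neq: "distinct w \<Longrightarrow> (a, b) \<in> segs w \<Longrightarrow> a \<noteq> b"
proof (induction w)
  case (Cons x w)
  then show ?case by (cases w) auto
qed simp

lemma cpairs_neq:
  assumes "distinct w" "length w \<ge> 2" "(a, b) \<in> set (cpairs w)"
  shows "a \<noteq> b"
proof -
  obtain x y w' where w: "w = x # y # w'" using assms(2) by (cases w; cases "tl w") auto
  have "(a, b) = (x, y) \<or> (a, b) \<in> segs (y # w') \<or> (a, b) = (last (y # w'), x)"
    using assms(3) unfolding w by (auto simp: cpairs_Cons)
  moreover have "last (y # w') \<noteq> x" using assms(1) last_in_set[of "y # w'"] unfolding w by (metis distinct.simps(2) list.distinct(1))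
  ultimately show ?thesis using assms(1) segs_neq[of "y # w'" a b] unfolding w by auto
qed

text \<open>This fails for two vertices, where the cyclic list runs back along the same
  edge.\<close>

lemma cpairs_antisym:
  assumes "distinct w" "length w \<ge> 3" "(a, b) \<in> set (cpairs w)"
  shows "(b, a) \<notin> set (cpairs w)"
proof
  assume ba: "(b, a) \<in> set (cpairs w)"
  obtain U V where w: "w = U @ a # V" using cpairs_mem[OF assms(3)] by (metis split_list)
  have "length (V @ U) \<ge> 2" using assms(2) w by simp
  then obtain x y Z where vu: "V @ U = x # y # Z" by (cases "V @ U"; cases "tl (V @ U)") auto
  have c: "set (cpairs w) = set (cpairs (a # x # y # Z))"
    using set_cpairs_commute[of U "a # V"] w vu by simp
  have d: "distinct (a # x # y # Z)" using assms(1) w vu by (auto simp: vu[symmetric])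
  define l where "l = last (x # y # Z)"
  have cp: "set (cpairs (a # x # y # Z)) = {(a, x), (l, a)} \<union> segs (x # y # Z)"
    using cpairs_Cons[of "x # y # Z" a] by (auto simp: l_def)
  have lm: "l \<in> set (x # y # Z)" unfolding l_def by (rule last_in_set) simp
  have nm: "(a, z) \<notin> segs (x # y # Z)" "(z, a) \<notin> segs (x # y # Z)" for z
    using d segs_mem[of _ _ "x # y # Z"] by (metis distinct.simps(2))+
  have "b = x \<or> b = a" using assms(3) nm(1) unfolding c cp by auto
  moreover have "b = l \<or> b = a" using ba nm(2) unfolding c cp by auto
  moreover have "b \<noteq> a" using assms cpairs_neq by fastforce
  ultimately have "b = x" "b = last (y # Z)" by (auto simp: l_def)
  then show False using d last_in_set[of "y # Z"] by auto
qed

lemma undir_inj: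
  assumes "distinct w" "length w \<ge> 3" "(a, b) \<in> set (cpairs w)" "(c, d) \<in> set (cpairs w)" "{a, b} = {c, d}"
  shows "a = c \<and> b = d"
  using cpairs_antisym[OF assms(1-3)] assms(4,5) by (auto simp: doubleton_eq_iff)

lemma undir_graph:
  assumes "finite V" "\<And>u v. (u, v) \<in> R \<Longrightarrow> u \<in> V \<and> v \<in> V \<and> u \<noteq> v"
  shows "is_graph (V, undir R)"
  unfolding is_graph_def
proof (intro conjI ballI)
  fix e assume "e \<in> edges (V, undir R)"
  then obtain u v where "(u, v) \<in> R" "e = {u, v}" by auto
  then show "e \<subseteq> verts (V, undir R)" "card e = 2" using assms(2)[of u v] by auto
qed (use assms(1) in auto)

lemma underlying_is_graph:
  assumes "distinct w" "length w \<ge> 2"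
  shows "is_graph (underlying (set (cpairs w)))"
proof -
  have "underlying (set (cpairs w)) = (set w, undir (set (cpairs w)))"
    by (intro prod_eqI) (simp_all add: edges_underlying verts_underlying Field_cpairs)
  moreover have "is_graph (set w, undir (set (cpairs w)))"
  proof (rule undir_graph)
    show "u \<in> set w \<and> v \<in> set w \<and> u \<noteq> v" if "(u, v) \<in> set (cpairs w)" for u v
      using cpairs_neq[OF assms that] cpairs_mem[OF that] by simp
  qed simp
  ultimately show ?thesis by simp
qed

lemma path_graph:
  assumes "distinct xs" "xs \<noteq> []"
  shows "is_path (set xs, undir (segs xs)) \<and> is_graph (set xs, undir (segs xs))"
proof
  show "is_path (set xs, undir (segs xs))"
    unfolding is_path_def path_edges[symmetric] using assms by blast
  show "is_graph (set xs, undir (segs xs))"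
  proof (rule undir_graph)
    show "u \<in> set xs \<and> v \<in> set xs \<and> u \<noteq> v" if "(u, v) \<in> segs xs" for u v
      using segs_neq[OF assms(1) that] segs_mem[OF that] by simp
  qed simp
qed

section \<open>Overlap of bridges is alternation of their attachments\<close>

lemma overlap_commute: "overlap L B1 B2 \<longleftrightarrow> overlap L B2 B1"
proof -
  have "\<not> overlap L Y X" if "\<not> overlap L X Y" for X Y
  proof -
    from that obtain L1 L2 where "is_path L1 \<and> is_path L2 \<and> subgraph L1 L \<and> subgraph L2 L \<and>
      edges L1 \<union> edges L2 = edges L \<and> edges L1 \<inter> edges L2 = {} \<and>
      attachments L X \<subseteq> verts L1 \<and> attachments L Y \<subseteq> verts L2" unfolding overlap_def by blast
    then show ?thesis unfolding overlap_def not_not by (intro exI[of _ L2] exI[of _ L1]) auto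
  qed
  then show ?thesis by blast
qed

text \<open>The two paths partition the edges and so share their ends. The second path is therefore
  \<open>Y\<close> together with the last and the first vertex of \<open>X\<close>, and these differ
  because \<open>X\<close> has two vertices.\<close>

lemma not_overlap_split:
  assumes vs: "distinct vs" "length vs \<ge> 3" "L = underlying (set (cpairs vs))"
    and split: "rotate n vs = X @ Y" "attachments L B1 \<subseteq> set X" "attachments L B2 \<subseteq> set Y"
    and "length X \<ge> 2" "Y \<noteq> []"
  shows "\<not> overlap L B1 B2"
proof -
  let ?Y = "last X # Y @ [hd X]"
  have ne: "X \<noteq> []" using assms(7) by auto
  have d: "distinct (X @ Y)" using vs(1) split(1) by (metis distinct_rotate)
  have len: "length (X @ Y) \<ge> 3" using vs(2) split(1) by (metis length_rotate)
  have c: "set (cpairs vs) = set (cpairs (X @ Y))" using split(1) by (metis set_cpairs_rotate)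
  have cX: "cpairs (X @ Y) = zip X (tl X) @ ((last X, hd Y) # zip Y (tl Y) @ [(last Y, hd X)])"
    using cpairs_append[OF ne assms(8)] by simp
  have sY: "segs ?Y = set ((last X, hd Y) # zip Y (tl Y) @ [(last Y, hd X)])"
    using zip_tl_append[of "last X # Y" "[hd X]"] assms(8) by (cases Y) auto
  have "distinct (cpairs (X @ Y))" using d map_fst_cpairs[of "X @ Y"] by (metis distinct_map)
  then have dis: "segs X \<inter> segs ?Y = {}" unfolding cX sY by (simp only: distinct_append)
  have un: "set (cpairs vs) = segs X \<union> segs ?Y" unfolding c cX sY by (simp only: set_append)
  have "hd X \<noteq> last X"
    using assms(7) d by (cases X) (auto simp: last_in_set)
  then have dY: "distinct ?Y" using d hd_in_set[OF ne] last_in_set[OF ne] by auto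
  have fL: "verts L = set X \<union> set Y" using vs(3) c by (simp add: verts_underlying Field_cpairs)
  have eL: "edges L = undir (segs X) \<union> undir (segs ?Y)" using vs(3) un by (simp add: edges_underlying image_Un)
  let ?L1 = "(set X, undir (segs X))" and ?L2 = "(set ?Y, undir (segs ?Y))"
  have p: "is_path ?L1" "is_graph ?L1" using path_graph[of X] d ne by auto
  have p2: "is_path ?L2" "is_graph ?L2" using path_graph[OF dY] by auto
  have s: "subgraph ?L1 L" "subgraph ?L2 L"
    unfolding subgraph_def using p(2) p2(2) fL eL ne by (auto simp: hd_in_set last_in_set)
  have "undir (segs X) \<inter> undir (segs ?Y) = {}"
  proof (rule ccontr)
    assume "undir (segs X) \<inter> undir (segs ?Y) \<noteq> {}"
    then obtain a b a' b' where "(a, b) \<in> segs X" "(a', b') \<in> segs ?Y" "{a, b} = {a', b'}" by auto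
    moreover from this have "a = a' \<and> b = b'" using undir_inj[OF vs(1,2), of a b a' b'] un by blast
    ultimately show False using dis by blast
  qed
  then have "edges ?L1 \<inter> edges ?L2 = {}" "edges ?L1 \<union> edges ?L2 = edges L" using eL by auto
  moreover have "attachments L B2 \<subseteq> verts ?L2" using split(3) by auto
  moreover have "attachments L B1 \<subseteq> verts ?L1" using split(2) by auto
  ultimately show ?thesis unfolding overlap_def using p(1) p2(1) s by blast
qed

lemma path_closed:
  assumes "\<And>x y. (x, y) \<in> segs xs \<Longrightarrow> x \<in> P \<longleftrightarrow> y \<in> P" "a \<in> set xs" "c \<in> set xs" "a \<in> P"
  shows "c \<in> P"
proof -
  have "(\<forall>x\<in>set xs. x \<in> P) \<or> (\<forall>x\<in>set xs. x \<notin> P)"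
    using assms(1)
  proof (induction xs)
    case (Cons x xs)
    show ?case
    proof (cases xs)
      case (Cons y ys)
      then have "(\<forall>x\<in>set xs. x \<in> P) \<or> (\<forall>x\<in>set xs. x \<notin> P)" using Cons.IH Cons.prems by simp
      moreover have "x \<in> P \<longleftrightarrow> y \<in> P" using Cons.prems[of x y] Cons by simp
      ultimately show ?thesis using Cons by auto
    qed auto
  qed simp
  then show ?thesis using assms(2-4) by blast
qed

lemma path_vertex_edge:
  assumes "b \<in> set xs" "d \<in> set xs" "b \<noteq> d"
  shows "\<exists>x. (b, x) \<in> segs xs \<or> (x, b) \<in> segs xs"
  using assms(1)
proof -
  obtain U V where xs: "xs = U @ b # V" using assms(1) by (metis split_list)
  show ?thesis
  proof (cases "U = []")
    case True
    then have "V \<noteq> []" using assms xs by auto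
    then show ?thesis using True xs by (cases V) auto
  next
    case False
    then show ?thesis using zip_tl_append[OF False, of "b # V"] xs by auto
  qed
qed

text \<open>If \<open>L1\<close>, \<open>L2\<close> were a partition with \<open>a, c\<close> on \<open>L1\<close> and \<open>b, d\<close> on \<open>L2\<close>, then \<open>L2\<close> would use an
  edge at \<open>b\<close> and an edge at \<open>d\<close>; removing these from the cycle separates \<open>a\<close> from \<open>c\<close>.\<close>

lemma overlap_interlaced:
  assumes L: "L = underlying (set (cpairs (b # U @ d # W)))" and vs: "distinct (b # U @ d # W)"
    and ac: "a \<in> set U" "c \<in> set W" "{a, c} \<subseteq> attachments L B1" "{b, d} \<subseteq> attachments L B2"
  shows "overlap L B1 B2"
  unfolding overlap_def
proof
  assume "\<exists>L1 L2. is_path L1 \<and> is_path L2 \<and> subgraph L1 L \<and> subgraph L2 L \<and>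
          edges L1 \<union> edges L2 = edges L \<and> edges L1 \<inter> edges L2 = {} \<and>
          attachments L B1 \<subseteq> verts L1 \<and> attachments L B2 \<subseteq> verts L2"
  then obtain L1 L2 where LL: "is_path L1" "is_path L2" "edges L1 \<union> edges L2 = edges L"
    "edges L1 \<inter> edges L2 = {}" "attachments L B1 \<subseteq> verts L1" "attachments L B2 \<subseteq> verts L2" by blast
  obtain xs where xs: "L1 = (set xs, undir (segs xs))"
    using LL(1) unfolding is_path_def path_edges by blast
  obtain ys where ys: "L2 = (set ys, undir (segs ys))"
    using LL(2) unfolding is_path_def path_edges by blast
  have U: "U \<noteq> []" "W \<noteq> []" using ac by auto
  have cyc: "set (cpairs (b # U @ d # W)) =
      {(b, hd U), (last U, d), (d, hd W), (last W, b)} \<union> segs U \<union> segs W"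
    using U cpairs_Cons[of "U @ d # W" b] zip_tl_append[of U "d # W"] zip_tl_append[of "[d]" W] by auto
  have eL: "edges L = undir ({(b, hd U), (last U, d), (d, hd W), (last W, b)} \<union> segs U \<union> segs W)"
    unfolding L edges_underlying cyc ..
  have bd: "b \<in> set ys" "d \<in> set ys" "b \<noteq> d" using LL(6) ac(4) ys vs by auto
  have uL: "undir (segs ys) \<subseteq> edges L" using LL(3) ys by auto
  have nodes: "hd U \<in> set U" "last U \<in> set U" "hd W \<in> set W" "last W \<in> set W" using U by auto
  have "{b, hd U} \<in> edges L2 \<or> {b, last W} \<in> edges L2"
  proof -
    obtain x where "(b, x) \<in> segs ys \<or> (x, b) \<in> segs ys" using path_vertex_edge[OF bd] by blast
    then have x: "{b, x} \<in> edges L2" unfolding ys by (auto simp: insert_commute image_iff)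
    then have "{b, x} \<in> edges L" using uL ys by auto
    then have "x = hd U \<or> x = last W"
      unfolding eL using vs nodes segs_mem[of _ _ U] segs_mem[of _ _ W] by (auto simp: doubleton_eq_iff)
    then show ?thesis using x by auto
  qed
  moreover have "{d, last U} \<in> edges L2 \<or> {d, hd W} \<in> edges L2"
  proof -
    obtain x where "(d, x) \<in> segs ys \<or> (x, d) \<in> segs ys" using path_vertex_edge[OF bd(2,1)] bd(3) by blast
    then have x: "{d, x} \<in> edges L2" unfolding ys by (auto simp: insert_commute image_iff)
    then have "{d, x} \<in> edges L" using uL ys by auto
    then have "x = last U \<or> x = hd W"
      unfolding eL using vs nodes segs_mem[of _ _ U] segs_mem[of _ _ W] by (auto simp: doubleton_eq_iff)
    then show ?thesis using x by auto
  qed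
  moreover
  let ?Z = "{(b, hd U), (last U, d), (d, hd W), (last W, b)} \<union> segs U \<union> segs W"
  \<comment> \<open>\<open>b\<close> joins the side of \<open>U\<close> unless its edge to
    \<open>U\<close> is in \<open>L2\<close>, and likewise \<open>d\<close>. Then every edge of the
    cycle across the cut \<open>P\<close> is in \<open>L2\<close>, so \<open>L1\<close> stays on one
    side.\<close>
  define P where "P = set U \<union> (if {b, hd U} \<in> edges L2 then {} else {b}) \<union>
    (if {d, last U} \<in> edges L2 then {} else {d})"
  have mP: "hd U \<in> P" "last U \<in> P" "hd W \<notin> P" "last W \<notin> P" "b \<in> P \<longleftrightarrow> {b, hd U} \<notin> edges L2"
    "d \<in> P \<longleftrightarrow> {d, last U} \<notin> edges L2"
    using nodes vs bd(3) unfolding P_def by auto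
  have mU: "x \<in> set U \<Longrightarrow> x \<in> P" "x \<in> set W \<Longrightarrow> x \<notin> P" for x using vs unfolding P_def by auto
  ultimately have Pc: "u \<in> P \<longleftrightarrow> v \<in> P" if "(u, v) \<in> ?Z" "{u, v} \<notin> edges L2" for u v
    using that mP mU segs_mem[of u v U] segs_mem[of u v W]
    by (elim UnE insertE emptyE) (auto simp: insert_commute)
  have "x \<in> P \<longleftrightarrow> y \<in> P" if "(x, y) \<in> segs xs" for x y
  proof -
    have e1: "{x, y} \<in> edges L1" using that xs by auto
    then have n2: "{x, y} \<notin> edges L2" using LL(4) by blast
    have "{x, y} \<in> edges L" using e1 LL(3) by blast
    then obtain p where p: "{x, y} = (\<lambda>(u, v). {u, v}) p" "p \<in> ?Z" unfolding eL by (rule imageE)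
    obtain u v where "p = (u, v)" by (cases p)
    then have uv: "(u, v) \<in> ?Z" "{x, y} = {u, v}" using p by simp_all
    then have "u \<in> P \<longleftrightarrow> v \<in> P" using Pc n2 by metis
    then show ?thesis using uv(2) by (auto simp: doubleton_eq_iff)
  qed
  then have closed: "(x, y) \<in> segs xs \<Longrightarrow> x \<in> P \<longleftrightarrow> y \<in> P" for x y .
  have "a \<in> set xs" "c \<in> set xs" using LL(5) ac(3) xs by auto
  then have "c \<in> P" using path_closed[of xs P a c, OF closed] mU(1)[OF ac(1)] by blast
  then show False using mU(2)[OF ac(2)] by blast
qed

lemma subseq_mapE:
  assumes "subseq l (map f w)"
  obtains w' where "subseq w' w" "l = map f w'"
proof -
  have "\<exists>w'. subseq w' w \<and> l = map f w'"
    using assms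
  proof (induction w arbitrary: l)
    case (Cons a w)
    show ?case
    proof (cases l)
      case (Cons x l')
      show ?thesis
      proof (cases "x = f a")
        case True
        then have "subseq l' (map f w)" using Cons.prems Cons by simp
        then obtain w' where "subseq w' w" "l' = map f w'" using Cons.IH by blast
        then show ?thesis using True Cons by (intro exI[of _ "a # w'"]) simp
      next
        case False
        then have "subseq l (map f w)" using Cons.prems Cons by simp
        then obtain w' where "subseq w' w" "l = map f w'" using Cons.IH by blast
        then show ?thesis by (intro exI[of _ w']) auto
      qed
    qed (intro exI[of _ "[]"], simp)
  qed (intro exI[of _ "[]"], simp)
  then show ?thesis using that by blast
qed

text \<open>If the classes do not alternate, the circle splits into two intervals; having two
  attachments makes the interval of \<open>B1\<close> long enough for
  \<open>not_overlap_split\<close>. If they alternate, the circle is rotated to start at an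
  attachment of \<open>B2\<close>, which is the form of \<open>overlap_interlaced\<close>.\<close>

lemma overlap_iff_alt:
  assumes vs: "distinct vs" "length vs \<ge> 3" "L = underlying (set (cpairs vs))"
    and own: "\<And>v. v \<in> set vs \<Longrightarrow> own v = i1 \<longleftrightarrow> v \<in> attachments L B1"
      "\<And>v. v \<in> set vs \<Longrightarrow> own v = i2 \<longleftrightarrow> v \<in> attachments L B2"
    and i: "i1 \<noteq> i2" and card: "card (attachments L B1) \<ge> 2" "card (attachments L B2) \<ge> 2"
  shows "overlap L B1 B2 \<longleftrightarrow> alt (map own vs) i1 i2"
proof
  assume o: "overlap L B1 B2"
  have att: "attachments L B \<subseteq> set vs" for B
    using vs(3) by (auto simp: attachments_def verts_underlying Field_cpairs)
  have i12: "i1 \<in> set (map own vs)" "i2 \<in> set (map own vs)"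
  proof -
    have "attachments L B1 \<noteq> {}" "attachments L B2 \<noteq> {}" using card by auto
    then show "i1 \<in> set (map own vs)" "i2 \<in> set (map own vs)" using own att by (fastforce simp: image_iff)+
  qed
  show "alt (map own vs) i1 i2"
  proof (rule ccontr)
    assume "\<not> alt (map own vs) i1 i2"
    then obtain n X Y where XY: "rotate n (map own vs) = X @ Y" "i2 \<notin> set X" "i1 \<notin> set Y"
      using not_alt_split[OF i i12] by blast
    then have "map own (rotate n vs) = X @ Y" by (simp add: rotate_map)
    then obtain X' Y' where v: "rotate n vs = X' @ Y'" "map own X' = X" "map own Y' = Y"
      by (auto simp: map_eq_append_conv)
    have sv: "set vs = set X' \<union> set Y'" using v(1) by (metis set_append set_rotate)
    have a1: "attachments L B1 \<subseteq> set X'"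
    proof
      fix v assume a: "v \<in> attachments L B1"
      then have "own v = i1" "v \<in> set vs" using own(1) att by blast+
      then show "v \<in> set X'" using XY(3) v(3) sv by force
    qed
    have a2: "attachments L B2 \<subseteq> set Y'"
    proof
      fix v assume a: "v \<in> attachments L B2"
      then have "own v = i2" "v \<in> set vs" using own(2) att by blast+
      then show "v \<in> set Y'" using XY(2) v(2) sv by force
    qed
    have "2 \<le> length X'" using card(1) card_mono[OF _ a1] card_length[of X'] by simp
    moreover have "Y' \<noteq> []" using a2 card(2) by auto
    ultimately show False using not_overlap_split[OF vs v(1) a1 a2] o by blast
  qed
next
  assume "alt (map own vs) i1 i2"
  then have "\<exists>b U d W. set (cpairs (b # U @ d # W)) = set (cpairs vs) \<and> distinct (b # U @ d # W) \<and>
    own b = i2 \<and> own d = i2 \<and> (\<exists>a\<in>set U. own a = i1) \<and> (\<exists>c\<in>set W. own c = i1)"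
    unfolding alt_def
  proof
    assume "subseq [i1, i2, i1, i2] (map own vs)"
    then obtain w where w: "subseq w vs" "[i1, i2, i1, i2] = map own w" by (rule subseq_mapE)
    then obtain a b c d where abcd: "subseq [a, b, c, d] vs" "own a = i1" "own b = i2" "own c = i1" "own d = i2"
      by (auto simp: Cons_eq_map_conv)
    from abcd(1) obtain P V1 where V1: "vs = P @ a # V1" "subseq [b, c, d] V1" by (auto dest: list_emb_ConsD)
    from V1(2) obtain P1 V2 where V2: "V1 = P1 @ b # V2" "subseq [c, d] V2" by (auto dest: list_emb_ConsD)
    from V2(2) obtain P2 V3 where V3: "V2 = P2 @ c # V3" "subseq [d] V3" by (auto dest: list_emb_ConsD)
    from V3(2) obtain P3 P4 where V4: "V3 = P3 @ d # P4" by (auto dest: list_emb_ConsD)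
    have e: "vs = (P @ a # P1) @ (b # (P2 @ c # P3) @ d # P4)" using V1 V2 V3 V4 by simp
    let ?w = "b # (P2 @ c # P3) @ d # (P4 @ P @ a # P1)"
    have "set (cpairs ?w) = set (cpairs vs)"
      using set_cpairs_commute[of "b # (P2 @ c # P3) @ d # P4" "P @ a # P1"] unfolding e by simp
    moreover have "distinct ?w" using vs(1) unfolding e by auto
    ultimately show ?thesis using abcd(2-5)
      by (rule_tac exI[of _ b], rule_tac exI[of _ "P2 @ c # P3"], rule_tac exI[of _ d],
          rule_tac exI[of _ "P4 @ P @ a # P1"]) auto
  next
    assume "subseq [i2, i1, i2, i1] (map own vs)"
    then obtain w where w: "subseq w vs" "[i2, i1, i2, i1] = map own w" by (rule subseq_mapE)
    then obtain b a d c where abcd: "subseq [b, a, d, c] vs" "own a = i1" "own b = i2" "own c = i1" "own d = i2"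
      by (auto simp: Cons_eq_map_conv)
    from abcd(1) obtain P V1 where V1: "vs = P @ b # V1" "subseq [a, d, c] V1" by (auto dest: list_emb_ConsD)
    from V1(2) obtain P1 V2 where V2: "V1 = P1 @ a # V2" "subseq [d, c] V2" by (auto dest: list_emb_ConsD)
    from V2(2) obtain P2 V3 where V3: "V2 = P2 @ d # V3" "subseq [c] V3" by (auto dest: list_emb_ConsD)
    from V3(2) have c: "c \<in> set V3" by (simp add: subseq_singleton_left)
    have e: "vs = P @ (b # (P1 @ a # P2) @ d # V3)" using V1 V2 V3 by simp
    let ?w = "b # (P1 @ a # P2) @ d # (V3 @ P)"
    have "set (cpairs ?w) = set (cpairs vs)"
      using set_cpairs_commute[of "b # (P1 @ a # P2) @ d # V3" P] unfolding e by simp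
    moreover have "distinct ?w" using vs(1) unfolding e by auto
    ultimately show ?thesis using abcd(2-5) c
      by (rule_tac exI[of _ b], rule_tac exI[of _ "P1 @ a # P2"], rule_tac exI[of _ d],
          rule_tac exI[of _ "V3 @ P"]) auto
  qed
  then obtain b U d W a c where w: "set (cpairs (b # U @ d # W)) = set (cpairs vs)" "distinct (b # U @ d # W)"
    "own b = i2" "own d = i2" "a \<in> set U" "own a = i1" "c \<in> set W" "own c = i1" by blast
  have "set (b # U @ d # W) = set vs" using w(1) Field_cpairs by metis
  then have "{a, c} \<subseteq> attachments L B1" "{b, d} \<subseteq> attachments L B2" using own w(3-8) by auto
  then show "overlap L B1 B2" using overlap_interlaced[of L b U d W a c B1 B2] w vs(3) by simp
qed

section \<open>From the overlap tree to a tree word\<close>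

lemma cycle_subgraph:
  assumes H: "is_graph H" and xs: "distinct xs" "length xs \<ge> 3"
    and e: "\<And>x y. (x, y) \<in> set (cpairs xs) \<Longrightarrow> {x, y} \<in> edges H"
  shows "\<exists>C. is_cycle C \<and> subgraph C H"
proof -
  let ?R = "set (cpairs xs)"
  have "is_cycle (underlying ?R)" unfolding is_cycle_def is_dicycle_iff using xs by blast
  moreover have "edges (underlying ?R) \<subseteq> edges H" unfolding edges_underlying using e by auto
  moreover have "verts (underlying ?R) \<subseteq> verts H"
    unfolding verts_underlying
  proof
    fix x assume "x \<in> Field ?R"
    then obtain y where "(x, y) \<in> ?R \<or> (y, x) \<in> ?R" by (auto simp: Field_def)
    then have "{x, y} \<in> edges H" using e[of x y] e[of y x] by (auto simp: insert_commute)
    then show "x \<in> verts H" using H unfolding is_graph_def by blast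
  qed
  moreover have "is_graph (underlying ?R)" by (rule underlying_is_graph) (use xs in auto)
  ultimately show ?thesis unfolding subgraph_def by blast
qed

text \<open>Otherwise a longest path in \<open>S\<close> and \<open>r\<close> could be closed up to a cycle at an end different from \<open>r\<close>.\<close>

lemma acyclic_small_degree:
  assumes H: "is_graph H" "\<nexists>C. is_cycle C \<and> subgraph C H"
    and S: "S \<subseteq> verts H" "S \<noteq> {}"
  shows "\<exists>k\<in>S. \<forall>a\<in>insert r S. \<forall>b\<in>insert r S. {k, a} \<in> edges H \<longrightarrow> {k, b} \<in> edges H \<longrightarrow> a = b"
proof (rule ccontr)
  assume "\<not> ?thesis"
  then have two: "\<exists>a\<in>insert r S. \<exists>b\<in>insert r S. {k, a} \<in> edges H \<and> {k, b} \<in> edges H \<and> a \<noteq> b" if "k \<in> S" for k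
    using that by blast
  have fin: "finite (insert r S)" using H(1) S(1) finite_subset unfolding is_graph_def by blast
  have irr: "{x, x} \<notin> edges H" for x using H(1) unfolding is_graph_def by fastforce
  define path where "path = (\<lambda>xs. distinct xs \<and> length xs \<ge> 2 \<and> set xs \<subseteq> insert r S \<and>
    (\<forall>(x, y)\<in>segs xs. {x, y} \<in> edges H))"
  obtain k where k: "k \<in> S" using S(2) by blast
  then obtain a where "a \<in> insert r S" "{k, a} \<in> edges H" using two by blast
  then have "path [k, a]" using k irr[of k] by (auto simp: path_def)
  moreover have "length xs < Suc (card (insert r S))" if "path xs" for xs
    using that card_mono[OF fin, of "set xs"] distinct_card[of xs] by (auto simp: path_def)
  ultimately obtain xs where xs: "path xs" "\<And>ys. path ys \<Longrightarrow> length ys \<le> length xs"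
    using ex_has_greatest_nat[of path "[k, a]" length "Suc (card (insert r S))"] by blast
  have rev_path: "path (rev ys)" if "path ys" for ys
  proof -
    have "(x, y) \<in> segs ys" if "(y, x) \<in> segs (rev ys)" for x y ys
      using that
    proof (induction ys)
      case (Cons z ys)
      show ?case
      proof (cases "ys = []")
        case False
        then have "segs (rev (z # ys)) = insert (hd ys, z) (segs (rev ys))"
          using zip_tl_append[of "rev ys" "[z]"] by (auto simp: last_rev)
        then show ?thesis using Cons False by (cases ys) auto
      qed (use Cons in simp)
    qed simp
    then show ?thesis using that by (fastforce simp: path_def insert_commute)
  qed
  \<comment> \<open>The ends of a path with at least two vertices differ, so one of them is not
    \<open>r\<close>; reversing the path puts it in front.\<close>
  obtain ys where ys: "path ys" "hd ys \<in> S" "length ys = length xs"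
  proof (cases "hd xs \<in> S")
    case True
    then show ?thesis using that xs(1) by blast
  next
    case False
    obtain x y zs where xyz: "xs = x # y # zs" using xs(1) unfolding path_def by (cases xs; cases "tl xs") auto
    have "last xs \<in> set xs" "last xs = last (y # zs)" "last (y # zs) \<in> set (y # zs)"
      unfolding xyz by (rule last_in_set, simp) (simp, rule last_in_set, simp)
    then have "hd xs = r" "last xs \<in> insert r S" "last xs \<noteq> x"
      using False xs(1) xyz unfolding path_def by auto
    then have "hd (rev xs) \<in> S" using xyz by (simp only: hd_rev) simp
    then show ?thesis using that[of "rev xs"] rev_path[OF xs(1)] by simp
  qed
  obtain x y zs where xyz: "ys = x # y # zs" using ys(1) unfolding path_def by (cases ys; cases "tl ys") auto
  have inys: "a \<in> set ys" if "a \<in> insert r S" "{x, a} \<in> edges H" for a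
  proof (rule ccontr)
    assume "a \<notin> set ys"
    then have "path (a # ys)" using ys(1) that xyz by (auto simp: path_def insert_commute)
    then show False using xs(2) ys(3) by fastforce
  qed
  obtain a b where "a \<in> insert r S" "b \<in> insert r S" "{x, a} \<in> edges H" "{x, b} \<in> edges H" "a \<noteq> b"
    using two[of x] ys(2) xyz by auto
  \<comment> \<open>By maximality all neighbours of \<open>x\<close> in question are on the path.
    Only one of the two can be its second vertex \<open>y\<close>; the other one closes a
    cycle.\<close>
  then obtain c where c: "c \<in> insert r S" "{x, c} \<in> edges H" "c \<noteq> y" by metis
  have "c \<noteq> x" using irr[of x] c(2) by auto
  then have "c \<in> set zs" using inys[OF c(1,2)] xyz c(3) by auto
  then obtain U V where zs: "zs = U @ c # V" by (metis split_list)
  let ?c = "x # y # U @ [c]"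
  have sub: "ys = ?c @ V" using xyz zs by simp
  have "segs ?c \<subseteq> segs ys"
    using zip_tl_append[of ?c V] sub by (cases "V = []") auto
  then have e: "(u, v) \<in> segs ?c \<Longrightarrow> {u, v} \<in> edges H" for u v using ys(1) unfolding path_def by blast
  have cc: "set (cpairs ?c) = insert (c, x) (segs ?c)"
    using cpairs_eq[of ?c] by auto
  have "\<exists>C. is_cycle C \<and> subgraph C H"
  proof (rule cycle_subgraph[OF H(1)])
    show "distinct ?c" using ys(1) sub by (auto simp: path_def)
    show "length ?c \<ge> 3" by simp
    show "{u, v} \<in> edges H" if "(u, v) \<in> set (cpairs ?c)" for u v
      using that e c(2) unfolding cc by (auto simp: insert_commute)
  qed
  then show False using H(2) by blast
qed

lemma count_list_map:
  "distinct w \<Longrightarrow> count_list (map f w) i = card {v \<in> set w. f v = i}"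
proof (induction w)
  case (Cons x w)
  have "{v \<in> set (x # w). f v = i} = (if f x = i then insert x else id) {v \<in> set w. f v = i}" by auto
  then show ?case using Cons by auto
qed simp

lemma alt_filter:
  assumes "P i" "P j"
  shows "alt (filter P ws) i j \<longleftrightarrow> alt ws i j"
proof -
  have "subseq l (filter P ws) \<longleftrightarrow> subseq l ws" if "filter P l = l" for l
  proof
    assume "subseq l (filter P ws)"
    then show "subseq l ws" using subseq_filter_left subseq_order.order_trans by blast
  next
    assume "subseq l ws"
    then show "subseq l (filter P ws)" using that subseq_filter by metis
  qed
  then show ?thesis using assms by (simp add: alt_def)
qed

lemma rtrancl_crossing:
  assumes "(u, v) \<in> r\<^sup>*" "u \<in> S" "v \<notin> S"
  shows "\<exists>x y. (x, y) \<in> r \<and> x \<in> S \<and> y \<notin> S"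
  using assms by (induction rule: rtrancl_induct) auto

text \<open>The counts come from two attachments per bridge, the cuts from connectedness of the
  overlap graph, and the last condition from the absence of cycles.\<close>

lemma overlap_tree_word:
  fixes own :: "'a \<Rightarrow> 'b + 'a graph" and \<B> :: "'a graph set"
  assumes vs: "distinct vs" "length vs \<ge> 3" "L = underlying (set (cpairs vs))"
    and own: "\<And>v B. v \<in> set vs \<Longrightarrow> B \<in> \<B> \<Longrightarrow> own v = Inr B \<longleftrightarrow> v \<in> attachments L B"
      "\<And>v B. own v = Inr B \<Longrightarrow> B \<in> \<B>"
    and card: "\<And>B. B \<in> \<B> \<Longrightarrow> card (attachments L B) \<ge> 2"
    and H: "is_tree H" "verts H = \<B>"
      "edges H = {{B1, B2} | B1 B2. B1 \<in> \<B> \<and> B2 \<in> \<B> \<and> B1 \<noteq> B2 \<and> overlap L B1 B2}"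
  shows "tree_word (map own (filter (\<lambda>v. \<exists>B. own v = Inr B) vs))"
proof -
  let ?w = "filter (\<lambda>v. \<exists>B. own v = Inr B) vs"
  let ?ws = "map own ?w"
  have att: "attachments L B \<subseteq> set vs" for B
    using vs(3) by (auto simp: attachments_def verts_underlying Field_cpairs)
  have alt_iff: "alt ?ws (Inr B1) (Inr B2) \<longleftrightarrow> {B1, B2} \<in> edges H"
    if "B1 \<in> \<B>" "B2 \<in> \<B>" "B1 \<noteq> B2" for B1 B2
  proof -
    have ws: "?ws = filter (\<lambda>i. \<exists>B. i = Inr B) (map own vs)" by (simp add: filter_map comp_def)
    have "alt ?ws (Inr B1) (Inr B2) \<longleftrightarrow> alt (map own vs) (Inr B1) (Inr B2)"
      unfolding ws by (rule alt_filter) blast+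
    also have "\<dots> \<longleftrightarrow> overlap L B1 B2"
      by (rule overlap_iff_alt[OF vs, symmetric]) (use own card that in auto)
    also have "\<dots> \<longleftrightarrow> {B1, B2} \<in> edges H"
    proof
      assume "overlap L B1 B2"
      then show "{B1, B2} \<in> edges H" unfolding H(3) using that by blast
    next
      assume "{B1, B2} \<in> edges H"
      then show "overlap L B1 B2"
        unfolding H(3) using overlap_commute[of L B1 B2] by (auto simp: doubleton_eq_iff)
    qed
    finally show ?thesis .
  qed
  have set_ws: "set ?ws = Inr ` \<B>"
  proof
    show "set ?ws \<subseteq> Inr ` \<B>" using own(2) by auto
    show "Inr ` \<B> \<subseteq> set ?ws"
    proof
      fix i :: "'b + 'a graph" assume "i \<in> Inr ` \<B>"
      then obtain B where B: "B \<in> \<B>" "i = Inr B" by auto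
      then obtain v where "v \<in> attachments L B" using card[OF B(1)] by fastforce
      then have "v \<in> set vs" "own v = Inr B" using att own(1) B(1) by blast+
      then show "i \<in> set ?ws" using B(2) by force
    qed
  qed
  have conn: "connected_graph H" and acyc: "\<nexists>C. is_cycle C \<and> subgraph C H"
    using H(1) unfolding is_tree_def by auto
  then have gr: "is_graph H" unfolding connected_graph_def by simp
  show ?thesis
    unfolding tree_word_def
  proof (intro conjI allI impI ballI)
    fix i assume "i \<in> set ?ws"
    then obtain B where B: "B \<in> \<B>" "i = Inr B" unfolding set_ws by auto
    have "{v \<in> set ?w. own v = i} = attachments L B"
      unfolding set_filter B(2) using own(1)[OF _ B(1)] att[of B] by blast
    then show "2 \<le> count_list ?ws i" using count_list_map[of ?w own i] vs(1) card[OF B(1)] by simp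
  next
    fix S :: "('b + 'a graph) set" assume "S \<noteq> {}" "S \<subset> set ?ws"
    then obtain B B' where B: "Inr B \<in> S" "B \<in> \<B>" "Inr B' \<notin> S" "B' \<in> \<B>" unfolding set_ws by blast
    then have "(B, B') \<in> (adj H)\<^sup>*" using conn H(2) unfolding connected_graph_def by blast
    then obtain x y where xy: "(x, y) \<in> adj H" "Inr x \<in> S" "Inr y \<notin> S"
      using rtrancl_crossing[of B B' "adj H" "{B. Inr B \<in> S}"] B by auto
    then have e: "{x, y} \<in> edges H" by (simp add: adj_def)
    then have "x \<in> \<B>" "y \<in> \<B>" "x \<noteq> y" unfolding H(3) using xy by (auto simp: doubleton_eq_iff)
    then show "\<exists>i\<in>S. \<exists>j\<in>set ?ws - S. alt ?ws i j"
      using alt_iff[of x y] e xy(2,3) unfolding set_ws by blast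
  next
    fix S :: "('b + 'a graph) set" and r assume S: "S \<noteq> {}" "S \<subseteq> set ?ws" "r \<notin> S"
    define S' where "S' = {B. Inr B \<in> S}"
    have SS': "S = Inr ` S'" "S' \<subseteq> \<B>" using S(2) unfolding set_ws S'_def by auto
    \<comment> \<open>If \<open>r\<close> is no bridge, any value will do for
      \<open>r'\<close>.\<close>
    have r': "\<exists>r'. \<forall>B. r = Inr B \<longrightarrow> B = r'" by (cases r) auto
    then obtain r' where r': "\<And>B. r = Inr B \<Longrightarrow> B = r'" by blast
    have "S' \<noteq> {}" using S(1) SS' by auto
    then obtain k where k: "k \<in> S'" "\<forall>a\<in>insert r' S'. \<forall>b\<in>insert r' S'. {k, a} \<in> edges H \<longrightarrow> {k, b} \<in> edges H \<longrightarrow> a = b"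
      using acyclic_small_degree[OF gr acyc, of S' r'] SS'(2) H(2) by blast
    have nb: "\<exists>B. a = Inr B \<and> B \<in> insert r' S' \<and> {k, B} \<in> edges H"
      if "a \<in> insert r S" "a \<noteq> Inr k" "alt ?ws (Inr k) a" for a
    proof -
      have "a \<in> set ?ws" using alt_mem[OF that(3)] by simp
      then obtain B where B: "a = Inr B" "B \<in> \<B>" unfolding set_ws by auto
      then have "{k, B} \<in> edges H" using alt_iff[of k B] k(1) SS'(2) that(2,3) by blast
      moreover have "B \<in> insert r' S'" using that(1) B(1) r'[of B] SS'(1) by auto
      ultimately show ?thesis using B(1) by blast
    qed
    show "\<exists>k\<in>S. \<forall>a\<in>insert r S. \<forall>b\<in>insert r S. a \<noteq> k \<longrightarrow> b \<noteq> k \<longrightarrow> alt ?ws k a \<longrightarrow> alt ?ws k b \<longrightarrow> a = b"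
    proof (intro bexI[of _ "Inr k"] ballI impI)
      show "Inr k \<in> S" using k(1) SS'(1) by simp
      fix a b
      assume ab: "a \<in> insert r S" "b \<in> insert r S" "a \<noteq> Inr k" "b \<noteq> Inr k" "alt ?ws (Inr k) a" "alt ?ws (Inr k) b"
      from nb[OF ab(1,3,5)] obtain A where A: "a = Inr A" "A \<in> insert r' S'" "{k, A} \<in> edges H" by blast
      from nb[OF ab(2,4,6)] obtain B where B: "b = Inr B" "B \<in> insert r' S'" "{k, B} \<in> edges H" by blast
      show "a = b" using k(2) A B by blast
    qed
  qed
qed

section \<open>Paths and cuts in bridges\<close>

lemma rtrancl_path:
  assumes "(x, y) \<in> r\<^sup>*"
  shows "\<exists>p. distinct p \<and> p \<noteq> [] \<and> hd p = x \<and> last p = y \<and> segs p \<subseteq> r"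
  using assms
proof (induction rule: rtrancl_induct)
  case base
  show ?case by (intro exI[of _ "[x]"]) simp
next
  case (step y z)
  then obtain p where p: "distinct p" "p \<noteq> []" "hd p = x" "last p = y" "segs p \<subseteq> r" by blast
  show ?case
  proof (cases "z \<in> set p")
    case True
    then obtain U V where U: "p = (U @ [z]) @ V" by (metis append.assoc append_Cons append_Nil split_list)
    have "segs (U @ [z]) \<subseteq> segs p"
    proof (cases "V = []")
      case False
      then show ?thesis using zip_tl_append[of "U @ [z]" V] unfolding U by auto
    qed (simp add: U)
    moreover have "hd (U @ [z]) = x" using p(3) unfolding U by (cases U) auto
    ultimately show ?thesis using p(1,5) U by (intro exI[of _ "U @ [z]"]) auto
  next
    case False
    have "segs (p @ [z]) = insert (y, z) (segs p)"
      using zip_tl_append[OF p(2), of "[z]"] p(4) by simp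
    then show ?thesis using p step(2) False by (intro exI[of _ "p @ [z]"]) auto
  qed
qed

text \<open>Adding the edge keeps \<open>D\<close> connected, so by maximality it was there
  already.\<close>

lemma component_edge:
  assumes D: "component D K" and K: "is_graph K" and x: "x \<in> verts D" "{x, y} \<in> edges K"
  shows "y \<in> verts D \<and> {x, y} \<in> edges D"
proof -
  let ?D = "(insert y (verts D), insert {x, y} (edges D))"
  have s: "subgraph D K" and c: "connected_graph D" using D by (auto simp: component_def)
  have gD: "is_graph D" using s by (simp add: subgraph_def)
  have xy: "{x, y} \<subseteq> verts K" "card {x, y} = 2" using K x(2) unfolding is_graph_def by auto
  have g: "is_graph ?D" using gD x(1) xy unfolding is_graph_def by auto
  have "adj D \<subseteq> adj ?D" by (auto simp: adj_def)
  then have r: "(u, v) \<in> (adj ?D)\<^sup>*" if "u \<in> verts D" "v \<in> verts D" for u v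
    using c that rtrancl_mono unfolding connected_graph_def by blast
  have e: "(x, y) \<in> adj ?D" "(y, x) \<in> adj ?D" by (auto simp: adj_def insert_commute)
  have "(u, v) \<in> (adj ?D)\<^sup>*" if "u \<in> insert y (verts D)" "v \<in> insert y (verts D)" for u v
  proof -
    have "(u, x) \<in> (adj ?D)\<^sup>*" using that(1) e(2) r x(1) by blast
    moreover have "(x, v) \<in> (adj ?D)\<^sup>*" using that(2) e(1) r x(1) by blast
    ultimately show ?thesis by simp
  qed
  then have "connected_graph ?D" using g unfolding connected_graph_def by auto
  moreover have "subgraph ?D K" using s g x(2) xy unfolding subgraph_def by auto
  moreover have "subgraph D ?D" using gD unfolding subgraph_def by auto
  ultimately have "?D = D" using D unfolding component_def by blast
  then show ?thesis by (metis fst_conv snd_conv insertI1)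
qed

lemma edge_component:
  assumes K: "is_graph K" and x: "x \<in> verts K"
  shows "\<exists>D. component D K \<and> x \<in> verts D"
proof -
  let ?V = "{y. (x, y) \<in> (adj K)\<^sup>*}"
  let ?D = "(?V, {e \<in> edges K. e \<subseteq> ?V})"
  have KV: "\<And>u v. (u, v) \<in> adj K \<Longrightarrow> u \<in> verts K \<and> v \<in> verts K"
    using K unfolding is_graph_def adj_def by blast
  have V: "?V \<subseteq> verts K"
  proof
    fix y assume "y \<in> ?V"
    then have "(x, y) \<in> (adj K)\<^sup>*" by simp
    then show "y \<in> verts K" by (cases rule: rtranclE) (use x KV in auto)
  qed
  have g: "is_graph ?D" using K V finite_subset unfolding is_graph_def by auto
  have sym: "sym (adj K)" by (auto simp: sym_def adj_def insert_commute)
  have step: "(y, z) \<in> adj ?D" if "y \<in> ?V" "(y, z) \<in> adj K" for y z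
  proof -
    have "z \<in> ?V" using that by (simp add: rtrancl_into_rtrancl)
    then show ?thesis using that by (simp add: adj_def)
  qed
  have fromx: "(x, y) \<in> (adj ?D)\<^sup>*" if "(x, y) \<in> (adj K)\<^sup>*" for y
    using that
  proof (induction rule: rtrancl_induct)
    case (step y z)
    then show ?case using \<open>\<And>y z. y \<in> ?V \<Longrightarrow> (y, z) \<in> adj K \<Longrightarrow> (y, z) \<in> adj ?D\<close>[of y z]
      by (simp add: rtrancl_into_rtrancl)
  qed simp
  have symD: "sym ((adj ?D)\<^sup>*)" by (rule sym_rtrancl) (auto simp: sym_def adj_def insert_commute)
  have "connected_graph ?D"
    unfolding connected_graph_def
  proof (intro conjI ballI)
    fix u v assume "u \<in> verts ?D" "v \<in> verts ?D"
    then have "(x, u) \<in> (adj ?D)\<^sup>*" "(x, v) \<in> (adj ?D)\<^sup>*" using fromx by auto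
    then show "(u, v) \<in> (adj ?D)\<^sup>*" using symD by (meson rtrancl_trans symE)
  qed (use g in auto)
  moreover have "subgraph ?D K" using g V unfolding subgraph_def by auto
  moreover have "D' = ?D" if D': "subgraph D' K" "connected_graph D'" "subgraph ?D D'" for D'
  proof -
    have xD: "x \<in> verts D'" using D'(3) unfolding subgraph_def by auto
    have "adj D' \<subseteq> adj K" using D'(1) unfolding subgraph_def adj_def by auto
    then have vD: "verts D' \<subseteq> ?V" using D'(2) xD rtrancl_mono unfolding connected_graph_def by blast
    have "verts D' = ?V" using vD D'(3) unfolding subgraph_def by auto
    moreover have "edges D' = {e \<in> edges K. e \<subseteq> ?V}"
    proof
      show "edges D' \<subseteq> {e \<in> edges K. e \<subseteq> ?V}"
        using D'(1) vD unfolding subgraph_def is_graph_def by blast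
      show "{e \<in> edges K. e \<subseteq> ?V} \<subseteq> edges D'" using D'(3) unfolding subgraph_def by auto
    qed
    ultimately show ?thesis by (intro prod_eqI) simp_all
  qed
  ultimately have "component ?D K" unfolding component_def by blast
  then show ?thesis by (intro exI[of _ ?D]) simp
qed

lemma delete_verts_simps:
  "verts (delete_verts G X) = verts G - X"
  "edges (delete_verts G X) = {e \<in> edges G. e \<subseteq> verts G - X}"
  by (auto simp: delete_verts_def induced_subgraph_def)

lemma is_graph_delete: "is_graph G \<Longrightarrow> is_graph (delete_verts G X)"
  unfolding is_graph_def delete_verts_simps by auto

section \<open>Edges and paths of bridges\<close>

lemma bridge_cases:
  assumes "B \<in> bridges G L"
  obtains (chord) u v where "B = ({u, v}, {{u, v}})" "{u, v} \<in> edges G - edges L" "u \<in> verts L" "v \<in> verts L"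
  | (comp) D F where "B = (verts D \<union> \<Union>F, edges D \<union> F)" "component D (delete_verts G (verts L))"
      "F = {e \<in> edges G. e \<inter> verts D \<noteq> {} \<and> e \<inter> verts L \<noteq> {}}"
  using assms unfolding bridges_def by blast

lemma edge_doubleton: "is_graph G \<Longrightarrow> e \<in> edges G \<Longrightarrow> \<exists>u v. e = {u, v} \<and> u \<noteq> v \<and> u \<in> verts G \<and> v \<in> verts G"
  unfolding is_graph_def by (metis card_2_iff insert_subset)

lemma comp_off:
  assumes "component D (delete_verts G (verts L))"
  shows "verts D \<subseteq> verts G - verts L" "edges D \<subseteq> edges G" "is_graph D" "connected_graph D"
  using assms unfolding component_def subgraph_def delete_verts_simps by auto

text \<open>The other end is in the same component, or it is on the cycle and the edge is one of
  those added to the component.\<close>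

lemma bridge_edge_off:
  assumes G: "is_graph G" and B: "B \<in> bridges G L" and x: "x \<in> verts B - verts L" "{x, y} \<in> edges G"
  shows "{x, y} \<in> edges B \<and> y \<in> verts B"
  using B
proof (cases rule: bridge_cases)
  case (comp D F)
  have "verts G - verts L \<subseteq> verts G - verts L" by simp
  have xD: "x \<in> verts D"
  proof (rule ccontr)
    assume "x \<notin> verts D"
    then obtain e where e: "e \<in> edges G" "x \<in> e" "e \<inter> verts D \<noteq> {}" "e \<inter> verts L \<noteq> {}"
      using x(1) comp(1,3) by auto
    obtain u v where "e = {u, v}" using edge_doubleton[OF G e(1)] by blast
    then show False using e x(1) \<open>x \<notin> verts D\<close> comp_off(1)[OF comp(2)] by auto
  qed
  show ?thesis
  proof (cases "y \<in> verts L")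
    case True
    then have "{x, y} \<in> F" using xD x(2) comp(3) by auto
    then show ?thesis using comp(1) by auto
  next
    case False
    obtain u v where "{x, y} = {u, v}" "u \<in> verts G" "v \<in> verts G" using edge_doubleton[OF G x(2)] by blast
    then have "{x, y} \<in> edges (delete_verts G (verts L))"
      using x False unfolding delete_verts_simps by (auto simp: doubleton_eq_iff)
    then have "y \<in> verts D \<and> {x, y} \<in> edges D"
      using component_edge[OF comp(2) is_graph_delete[OF G] xD] by blast
    then show ?thesis using comp(1) by auto
  qed
qed (use x in auto)

lemma bridge_graph:
  assumes G: "is_graph G" "is_graph L" and B: "B \<in> bridges G L"
  shows "verts B \<subseteq> verts G \<and> edges B \<subseteq> edges G - edges L \<and> (\<forall>e\<in>edges B. e \<subseteq> verts B)"
  using B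
proof (cases rule: bridge_cases)
  case (chord u v)
  then show ?thesis using G(1) unfolding is_graph_def by auto
next
  case (comp D F)
  have ne: "e \<subseteq> verts L" if "e \<in> edges L" for e using G(2) that unfolding is_graph_def by blast
  note off = comp_off[OF comp(2)]
  have D: "e \<subseteq> verts D \<and> e \<noteq> {}" if "e \<in> edges D" for e
    using off(3) that unfolding is_graph_def by fastforce
  have "edges D \<inter> edges L = {}" using D ne off(1) by blast
  moreover have "F \<inter> edges L = {}" using ne off(1) comp(3) by blast
  moreover have "\<Union>F \<subseteq> verts G" using comp(3) G(1) unfolding is_graph_def by blast
  moreover have "F \<subseteq> edges G" using comp(3) by blast
  moreover have "\<forall>e\<in>edges D \<union> F. e \<subseteq> verts D \<union> \<Union>F" using D by blast
  ultimately show ?thesis using comp(1) off(1,2) by auto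
qed

lemma edge_in_bridge:
  assumes G: "is_graph G" "is_graph L" and e: "e \<in> edges G - edges L"
  shows "\<exists>B\<in>bridges G L. e \<in> edges B"
proof -
  obtain u v where uv: "e = {u, v}" "u \<noteq> v" "u \<in> verts G" "v \<in> verts G" using edge_doubleton[OF G(1)] e by blast
  have *: ?thesis if "x \<in> e" "x \<notin> verts L" for x
  proof -
    have "x \<in> verts (delete_verts G (verts L))" using that uv unfolding delete_verts_simps by auto
    then obtain D where D: "component D (delete_verts G (verts L))" "x \<in> verts D"
      using edge_component[OF is_graph_delete[OF G(1)]] by blast
    let ?F = "{e \<in> edges G. e \<inter> verts D \<noteq> {} \<and> e \<inter> verts L \<noteq> {}}"
    let ?B = "(verts D \<union> \<Union>?F, edges D \<union> ?F)"
    have B: "?B \<in> bridges G L" unfolding bridges_def using D(1) by blast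
    from that(1) obtain y where y: "e = {x, y}" unfolding uv(1) by (auto simp: insert_commute)
    have "x \<in> verts ?B - verts L" using that(2) D(2) by simp
    then have "{x, y} \<in> edges ?B" using bridge_edge_off[OF G(1) B, of x y] e y by blast
    then show ?thesis using B y by blast
  qed
  show ?thesis
  proof (cases "u \<in> verts L \<and> v \<in> verts L")
    case True
    have "({u, v}, {{u, v}}) \<in> bridges G L"
      unfolding bridges_def by (rule UnI1) (use e uv(1) True in blast)
    then show ?thesis using uv(1) by (intro bexI[of _ "({u, v}, {{u, v}})"]) simp_all
  next
    case False
    then show ?thesis using *[of u] *[of v] uv(1) by auto
  qed
qed

text \<open>Enter the component from \<open>u\<close>, cross it, and leave it towards
  \<open>v\<close>; for a chord the interior is empty.\<close>

lemma bridge_path: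
  assumes G: "is_graph G" and B: "B \<in> bridges G L"
    and uv: "u \<in> attachments L B" "v \<in> attachments L B" "u \<noteq> v"
  shows "\<exists>p. distinct p \<and> set p \<subseteq> verts B - verts L \<and> undir (segs (u # p @ [v])) \<subseteq> edges B"
  using B
proof (cases rule: bridge_cases)
  case (chord a b)
  then have "{u, v} = {a, b}" using uv by (auto simp: attachments_def)
  then show ?thesis using chord(1) by (intro exI[of _ "[]"]) auto
next
  case (comp D F)
  note off = comp_off[OF comp(2)]
  have nb: "\<exists>x'\<in>verts D. {x, x'} \<in> F" if "x \<in> attachments L B" for x
  proof -
    have "x \<in> verts L" "x \<notin> verts D" "x \<in> verts B" using that off(1) by (auto simp: attachments_def)
    then obtain e where e: "e \<in> F" "x \<in> e" using comp(1) by auto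
    obtain a b where "e = {a, b}" using edge_doubleton[OF G] e(1) comp(3) by blast
    then show ?thesis using e comp(3) \<open>x \<notin> verts D\<close> by (auto simp: insert_commute)
  qed
  obtain u' v' where u': "u' \<in> verts D" "{u, u'} \<in> F" "v' \<in> verts D" "{v, v'} \<in> F"
    using nb uv(1,2) by metis
  then have "(u', v') \<in> (adj D)\<^sup>*" using off(4) unfolding connected_graph_def by blast
  then obtain p where p: "distinct p" "p \<noteq> []" "hd p = u'" "last p = v'" "segs p \<subseteq> adj D"
    using rtrancl_path by metis
  have "\<forall>x\<in>set p. x \<in> verts D"
  proof
    fix x assume "x \<in> set p"
    show "x \<in> verts D"
    proof (rule path_closed[OF _ hd_in_set[OF p(2)] \<open>x \<in> set p\<close>])
      fix a b assume "(a, b) \<in> segs p"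
      then have "{a, b} \<in> edges D" using p(5) by (auto simp: adj_def)
      then have "{a, b} \<subseteq> verts D" using off(3) unfolding is_graph_def by blast
      then show "a \<in> verts D \<longleftrightarrow> b \<in> verts D" by simp
    qed (use p(3) u'(1) in simp)
  qed
  then have "set p \<subseteq> verts B - verts L" using comp(1) off(1) by auto
  moreover have "segs (u # p @ [v]) = {(u, u'), (v', v)} \<union> segs p"
  proof -
    have "segs (u # p @ [v]) = insert (u, u') (segs (p @ [v]))" using p(2,3) by (cases p) auto
    also have "segs (p @ [v]) = insert (v', v) (segs p)" using zip_tl_append[OF p(2), of "[v]"] p(4) by simp
    finally show ?thesis by auto
  qed
  moreover have "undir (segs p) \<subseteq> edges D" using p(5) by (auto simp: adj_def)
  moreover have "{u, u'} \<in> edges B" "{v', v} \<in> edges B" using u' comp(1) by (auto simp: insert_commute)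
  ultimately have "undir (segs (u # p @ [v])) \<subseteq> edges B" using comp(1) by auto
  then show ?thesis using p(1) \<open>set p \<subseteq> verts B - verts L\<close> by blast
qed

section \<open>Edges of tree bridges as cuts\<close>

lemma tree_edge_separates:
  assumes t: "is_tree B" and e: "e \<in> edges B" "e = {a, b}"
  shows "(a, b) \<notin> {(x, y). {x, y} \<in> edges B - {e}}\<^sup>*"
proof
  assume "(a, b) \<in> {(x, y). {x, y} \<in> edges B - {e}}\<^sup>*"
  then obtain p where p: "distinct p" "p \<noteq> []" "hd p = a" "last p = b"
      "segs p \<subseteq> {(x, y). {x, y} \<in> edges B - {e}}"
    using rtrancl_path by metis
  have gB: "is_graph B" using t by (simp add: is_tree_def connected_graph_def)
  have ab: "a \<noteq> b" using gB e unfolding is_graph_def by fastforce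
  obtain q where q: "p = a # q" using p(2,3) by (cases p) auto
  then obtain x q' where q': "q = x # q'" using ab p(4) by (cases q) auto
  have "q' \<noteq> []" using p(4,5) q q' e(2) by auto
  then have len: "length p \<ge> 3" using q q' by (cases q') auto
  have "\<exists>C. is_cycle C \<and> subgraph C B"
  proof (rule cycle_subgraph[OF gB p(1) len])
    fix x y assume "(x, y) \<in> set (cpairs p)"
    then have "(x, y) \<in> segs p \<or> (x, y) = (b, a)" using cpairs_eq[OF p(2)] p(3,4) by auto
    then show "{x, y} \<in> edges B" using p(5) e by (auto simp: insert_commute)
  qed
  then show False using t by (simp add: is_tree_def)
qed

text \<open>Deleting \<open>e\<close> from the tree separates its ends, and \<open>W\<close> is the
  side of \<open>a\<close>. If the side of one end contained no attachment, deleting the other end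
  from \<open>G\<close> would separate it from the rest of the cycle, against
  2-connectedness.\<close>

lemma bridge_edge_cut:
  assumes G: "two_connected G" and L: "is_graph L" "verts L \<subseteq> verts G" "card (verts L) \<ge> 3"
    and B: "B \<in> bridges G L" "is_tree B" and e: "e \<in> edges B"
  shows "\<exists>W. (\<exists>u\<in>attachments L B. u \<in> W) \<and> (\<exists>v\<in>attachments L B. v \<notin> W) \<and>
    (\<forall>x y. {x, y} \<in> edges B \<longrightarrow> {x, y} \<noteq> e \<longrightarrow> (x \<in> W \<longleftrightarrow> y \<in> W))"
proof -
  have gG: "is_graph G" using G by (simp add: two_connected_def connected_graph_def)
  note bg = bridge_graph[OF gG L(1) B(1)]
  have "e \<in> edges G" using bg e by blast
  from edge_doubleton[OF gG this] obtain a b where ab: "e = {a, b}" "a \<noteq> b" "a \<in> verts G" "b \<in> verts G"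
    by blast
  define r where "r = {(x, y). {x, y} \<in> edges B - {e}}"
  have reach: "\<exists>u\<in>attachments L B. (c, u) \<in> r\<^sup>*"
    if cd: "e = {c, d}" "c \<noteq> d" "c \<in> verts G" "d \<in> verts G" for c d
  proof (rule ccontr)
    assume no: "\<not> ?thesis"
    define W where "W = {x. (c, x) \<in> r\<^sup>*}"
    have cB: "c \<in> verts B" using bg e cd(1) by auto
    have WB: "W \<subseteq> verts B"
    proof
      fix x assume "x \<in> W"
      then have "(c, x) \<in> r\<^sup>*" by (simp add: W_def)
      then show "x \<in> verts B" by (cases rule: rtranclE) (use cB bg in \<open>auto simp: r_def\<close>)
    qed
    have WL: "W \<inter> verts L = {}" using no WB by (auto simp: W_def attachments_def)
    have "verts L - {d} \<noteq> {}"
    proof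
      assume "verts L - {d} = {}"
      then have "verts L \<subseteq> {d}" by blast
      then have "card (verts L) \<le> card {d}" by (intro card_mono) auto
      then show False using L(3) by simp
    qed
    then obtain l where l: "l \<in> verts L" "l \<noteq> d" by blast
    have "connected_graph (delete_verts G {d})" using G cd(4) by (simp add: two_connected_def)
    moreover have "c \<in> verts (delete_verts G {d})" "l \<in> verts (delete_verts G {d})"
      using cd l L(2) unfolding delete_verts_simps by auto
    ultimately have "(c, l) \<in> (adj (delete_verts G {d}))\<^sup>*" unfolding connected_graph_def by blast
    moreover have "c \<in> W" "l \<notin> W" using WL l(1) by (auto simp: W_def)
    ultimately obtain x y where xy: "(x, y) \<in> adj (delete_verts G {d})" "x \<in> W" "y \<notin> W"
      using rtrancl_crossing[of c l _ W] by blast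
    then have E: "{x, y} \<in> edges G" "x \<noteq> d" "y \<noteq> d" unfolding adj_def delete_verts_simps by auto
    have "x \<in> verts B - verts L" using xy(2) WB WL by blast
    then have "{x, y} \<in> edges B" using bridge_edge_off[OF gG B(1) _ E(1)] by simp
    moreover have "{x, y} \<noteq> e" using E cd(1) by (auto simp: doubleton_eq_iff)
    ultimately have "(x, y) \<in> r" by (simp add: r_def)
    then have "y \<in> W" using xy(2) unfolding W_def by (simp add: rtrancl_into_rtrancl)
    then show False using xy(3) by simp
  qed
  define W where "W = {x. (a, x) \<in> r\<^sup>*}"
  have "sym (r\<^sup>*)" by (rule sym_rtrancl) (auto simp: sym_def r_def insert_commute)
  obtain u where u: "u \<in> attachments L B" "(a, u) \<in> r\<^sup>*" using reach[OF ab] by blast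
  obtain v where v: "v \<in> attachments L B" "(b, v) \<in> r\<^sup>*"
    using reach[of b a] ab by (auto simp: insert_commute)
  have "(a, v) \<notin> r\<^sup>*"
  proof
    assume "(a, v) \<in> r\<^sup>*"
    moreover have "(v, b) \<in> r\<^sup>*" using v(2) \<open>sym (r\<^sup>*)\<close> by (meson symE)
    ultimately have "(a, b) \<in> r\<^sup>*" by simp
    then show False using tree_edge_separates[OF B(2) e ab(1)] by (simp add: r_def)
  qed
  moreover have "x \<in> W \<longleftrightarrow> y \<in> W" if "{x, y} \<in> edges B" "{x, y} \<noteq> e" for x y
  proof -
    have "(x, y) \<in> r" "(y, x) \<in> r" using that by (auto simp: r_def insert_commute)
    then show ?thesis unfolding W_def by (auto intro: rtrancl_into_rtrancl)
  qed
  moreover have "u \<in> W" using u(2) by (simp add: W_def)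
  ultimately show ?thesis using u(1) v(1) by (intro exI[of _ W] conjI bexI[of _ u] bexI[of _ v]) (simp_all add: W_def)
qed

text \<open>The cut at any edge of the bridge has attachments on both sides. A component may be a
  single vertex; connectedness of \<open>G\<close> then provides the edge.\<close>

lemma bridge_two_attachments:
  assumes G: "two_connected G" and L: "is_graph L" "verts L \<subseteq> verts G" "card (verts L) \<ge> 3"
    and B: "B \<in> bridges G L" "is_tree B"
  shows "card (attachments L B) \<ge> 2"
proof -
  have gG: "is_graph G" using G by (simp add: two_connected_def connected_graph_def)
  have "\<exists>e. e \<in> edges B"
    using B(1)
  proof (cases rule: bridge_cases)
    case (comp D F)
    obtain x where x: "x \<in> verts D" using comp_off(4)[OF comp(2)] unfolding connected_graph_def by blast
    then have xG: "x \<in> verts B - verts L" "x \<in> verts G" using comp(1) comp_off(1)[OF comp(2)] by auto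
    obtain l where "l \<in> verts L" using L(3) by fastforce
    then have "(x, l) \<in> (adj G)\<^sup>*" "x \<noteq> l"
      using G xG L(2) unfolding two_connected_def connected_graph_def by (blast, auto simp: xG)
    then obtain y where "(x, y) \<in> adj G" by (meson converse_rtranclE)
    then have "{x, y} \<in> edges B" using bridge_edge_off[OF gG B(1) xG(1)] by (simp add: adj_def)
    then show ?thesis by blast
  qed auto
  then obtain e where e: "e \<in> edges B" by blast
  obtain u v where "u \<in> attachments L B" "v \<in> attachments L B" "u \<noteq> v"
    using bridge_edge_cut[OF G L B e] by blast
  moreover have "finite (attachments L B)" using L(1) by (auto simp: attachments_def is_graph_def)
  ultimately show ?thesis using card_mono[of "attachments L B" "{u, v}"] by auto
qed

text \<open>A trivial chord contributes its single vertex, so that blocks are never empty and always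
  run from \<open>u\<close> to \<open>v\<close>.\<close>

definition block :: "('a \<Rightarrow> 'a \<Rightarrow> 'a list) \<Rightarrow> 'a \<Rightarrow> 'a \<Rightarrow> 'a list" where
  "block ip u v = (if u = v then [u] else u # ip u v @ [v])"

text \<open>Indexed by the chords: the segments of the circuit do not appear as blocks but arise as
  the steps from one block to the next.\<close>

definition walk :: "('a \<Rightarrow> 'a \<Rightarrow> 'a list) \<Rightarrow> 'a dirseg list \<Rightarrow> 'a list" where
  "walk ip xs = concat (map (\<lambda>(d, d'). block ip (tgt d) (src d')) (cpairs xs))"

lemma block_simps [simp]: "block ip u v \<noteq> []" "hd (block ip u v) = u" "last (block ip u v) = v"
  by (auto simp: block_def)

lemma cpairs_cpairs:
  assumes "(p, p') \<in> set (cpairs (cpairs xs))"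
  shows "snd p = fst p'"
proof -
  obtain i where i: "i < length xs" "p = cpairs xs ! i" "p' = cpairs xs ! (Suc i mod length xs)"
    using assms by (auto simp: set_cpairs_conv_nth)
  moreover have "Suc i mod length xs < length xs" using i(1) by (intro mod_less_divisor) auto
  ultimately show ?thesis by (simp add: cpairs_nth)
qed

lemma arcs_walk:
  "set (cpairs (walk ip xs)) = (\<Union>(u, v)\<in>chords xs. segs (block ip u v)) \<union> (\<lambda>d. (src d, tgt d)) ` set xs"
proof -
  let ?b = "\<lambda>(d, d'). block ip (tgt d) (src d')"
  have "set (cpairs (walk ip xs)) = (\<Union>b\<in>set (map ?b (cpairs xs)). segs b) \<union>
     (\<lambda>(b, b'). (last b, hd b')) ` set (cpairs (map ?b (cpairs xs)))"
    unfolding walk_def by (rule set_cpairs_concat) auto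
  also have "(\<Union>b\<in>set (map ?b (cpairs xs)). segs b) = (\<Union>(u, v)\<in>chords xs. segs (block ip u v))"
    unfolding chords_def by (auto split: prod.splits)
  also have "(\<lambda>(b, b'). (last b, hd b')) ` set (cpairs (map ?b (cpairs xs))) =
      (\<lambda>(p, p'). (src (snd p), tgt (fst p'))) ` set (cpairs (cpairs xs))"
    unfolding cpairs_map set_map image_image by (rule image_cong) (auto split: prod.splits)
  also have "\<dots> = (\<lambda>d. (src d, tgt d)) ` set xs"
  proof
    show "(\<lambda>(p, p'). (src (snd p), tgt (fst p'))) ` set (cpairs (cpairs xs)) \<subseteq> (\<lambda>d. (src d, tgt d)) ` set xs"
    proof (rule image_subsetI)
      fix z assume z: "z \<in> set (cpairs (cpairs xs))"
      obtain p p' where pp: "z = (p, p')" by (cases z)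
      have "fst p' \<in> set xs" using cpairs_mem[of p p'] cpairs_mem[of "fst p'" "snd p'" xs] z pp by auto
      then show "(\<lambda>(p, p'). (src (snd p), tgt (fst p'))) z \<in> (\<lambda>d. (src d, tgt d)) ` set xs"
        using cpairs_cpairs[of p p' xs] z pp by auto
    qed
    show "(\<lambda>d. (src d, tgt d)) ` set xs \<subseteq> (\<lambda>(p, p'). (src (snd p), tgt (fst p'))) ` set (cpairs (cpairs xs))"
    proof (rule image_subsetI)
      fix d assume "d \<in> set xs"
      then obtain d0 where "(d0, d) \<in> set (cpairs xs)" using cpairs_pred by metis
      then obtain p' where p': "((d0, d), p') \<in> set (cpairs (cpairs xs))" using cpairs_succ by metis
      then have "fst p' = d" using cpairs_cpairs[OF p'] by simp
      then show "(src d, tgt d) \<in> (\<lambda>(p, p'). (src (snd p), tgt (fst p'))) ` set (cpairs (cpairs xs))"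
        using p' by (force simp: image_iff)
    qed
  qed
  finally show ?thesis .
qed

lemma set_walk: "set (walk ip xs) = (\<Union>(u, v)\<in>chords xs. set (block ip u v))"
  unfolding walk_def chords_def by (auto split: prod.splits)

lemma distinct_walk:
  assumes "distinct xs" "\<And>u v. (u, v) \<in> chords xs \<Longrightarrow> distinct (block ip u v)"
    and "\<And>d d' e e'. (d, d') \<in> set (cpairs xs) \<Longrightarrow> (e, e') \<in> set (cpairs xs) \<Longrightarrow> d \<noteq> e \<Longrightarrow>
      set (block ip (tgt d) (src d')) \<inter> set (block ip (tgt e) (src e')) = {}"
  shows "distinct (walk ip xs)"
proof -
  have d: "distinct (cpairs xs)" using assms(1) by (metis distinct_map map_fst_cpairs)
  have "distinct (map id (walk ip xs))"
    unfolding walk_def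
  proof (rule distinct_map_concat[OF d])
    show "distinct (map id ((\<lambda>(d, d'). block ip (tgt d) (src d')) x))" if "x \<in> set (cpairs xs)" for x
    proof -
      obtain d d' where x: "x = (d, d')" by (cases x rule: prod.exhaust)
      show ?thesis using assms(2)[OF chordsI[of d d' xs]] that x by simp
    qed
    show "id a \<noteq> id b" if xy: "x \<in> set (cpairs xs)" "y \<in> set (cpairs xs)" "x \<noteq> y"
      "a \<in> set ((\<lambda>(d, d'). block ip (tgt d) (src d')) x)" "b \<in> set ((\<lambda>(d, d'). block ip (tgt d) (src d')) y)" for x y a b
    proof -
      obtain d d' e e' where p: "x = (d, d')" "y = (e, e')" by (cases x; cases y)
      have "d \<noteq> e" using cpairs_unique_succ[of id xs d d' e e'] assms(1) xy(1-3) p by auto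
      then show ?thesis using assms(3)[of d d' e e'] xy p by auto
    qed
  qed
  then show ?thesis by simp
qed

lemma length_ge_3_if_two_edges:
  assumes "e1 \<in> undir (set (cpairs w))" "e2 \<in> undir (set (cpairs w))" "e1 \<noteq> e2"
  shows "length w \<ge> 3"
proof (rule ccontr)
  assume "\<not> length w \<ge> 3"
  then consider "w = []" | x where "w = [x]" | x y where "w = [x, y]"
    by (cases w; cases "tl w"; cases "tl (tl w)") auto
  then show False using assms by cases (auto simp: cpairs_def insert_commute)
qed

section \<open>Realisation by dicycles\<close>

lemma undirI: "(x, y) \<in> r \<Longrightarrow> {x, y} \<in> undir r"
  using imageI[of "(x, y)" r "\<lambda>(u, v). {u, v}"] by (simp only: prod.case)

lemma segs_rev: "segs (rev p) = (segs p)\<inverse>"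
proof (induction p)
  case (Cons z p)
  show ?case
  proof (cases "p = []")
    case False
    then have "segs (rev (z # p)) = insert (hd p, z) (segs (rev p))"
      using zip_tl_append[of "rev p" "[z]"] by (auto simp: last_rev)
    then show ?thesis using Cons False by (cases p) auto
  qed simp
qed simp

lemma undir_converse: "undir (r\<inverse>) = undir r"
  by (auto simp: insert_commute image_iff)

lemma undir_dirseg: "{src d, tgt d} = (\<lambda>(u, v). {u, v}) (fst d)"
  by (cases d; cases "fst d"; cases "snd d") auto

lemma undir_dirsegs: "undir ((\<lambda>d. (src d, tgt d)) ` D) = undir (fst ` D)"
  by (simp only: image_image prod.case undir_dirseg)

lemma image_UN_pairs: "g ` (\<Union>(u, v)\<in>C. S u v) = {f. \<exists>u v. (u, v) \<in> C \<and> f \<in> g ` S u v}"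
  by blast

lemma is_cycle_edge_induced:
  assumes "distinct w" "length w \<ge> 3"
  shows "is_cycle (edge_induced (undir (set (cpairs w))))"
proof -
  have "\<Union> (undir (set (cpairs w))) = Field (set (cpairs w))" by (auto simp: Field_def)
  then have "edge_induced (undir (set (cpairs w))) = underlying (set (cpairs w))"
    by (intro prod_eqI) (simp_all add: edge_induced_def edges_underlying verts_underlying)
  then show ?thesis unfolding is_cycle_def is_dicycle_iff using assms by metis
qed

text \<open>Here \<open>vs\<close> lists all vertices of the cycle, so a segment is one edge. The
  class of a path \<open>ip u v\<close> is that of its ends, which keeps the paths of different
  bridges disjoint; \<open>single\<close> leaves only trivial chords at vertices outside
  \<open>A\<close>.\<close>

locale realisation =
  fixes vs :: "'a list" and own :: "'a \<Rightarrow> 'b" and A :: "'a set" and F :: "'a dirseg list set"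
    and ip :: "'a \<Rightarrow> 'a \<Rightarrow> 'a list"
  assumes vs: "distinct vs" "length vs \<ge> 3"
    and fam: "family own A (set (cpairs vs)) F"
    and single: "\<And>n v. n \<in> set vs \<Longrightarrow> n \<notin> A \<Longrightarrow> v \<in> set vs \<Longrightarrow> own v = own n \<Longrightarrow> v = n"
    and ip: "\<And>u v. u \<in> A \<Longrightarrow> v \<in> A \<Longrightarrow> u \<in> set vs \<Longrightarrow> v \<in> set vs \<Longrightarrow> own u = own v \<Longrightarrow> u \<noteq> v \<Longrightarrow>
      distinct (ip u v) \<and> set (ip u v) \<inter> set vs = {} \<and> (\<forall>x\<in>set (ip u v). own x = own u) \<and>
      undir (segs (u # ip u v @ [v])) \<inter> undir (set (cpairs vs)) = {}"
begin

abbreviation "cyc \<equiv> set (cpairs vs)"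

definition at :: "'a dirseg \<Rightarrow> 'a \<Rightarrow> bool" where "at d v \<longleftrightarrow> src d = v \<or> tgt d = v"

lemma dirseg_mem: "d \<in> cyc \<times> UNIV \<Longrightarrow> src d \<in> set vs \<and> tgt d \<in> set vs \<and> src d \<noteq> tgt d"
proof -
  assume d: "d \<in> cyc \<times> UNIV"
  obtain a b c where "d = ((a, b), c)" by (metis surj_pair)
  then show ?thesis
    using d cpairs_mem[of a b vs] cpairs_neq[of vs a b] vs by (cases c) auto
qed

lemma F_mem: "xs \<in> F \<Longrightarrow> d \<in> set xs \<Longrightarrow> d \<in> cyc \<times> UNIV"
  by (rule family_mem[OF fam])

text \<open>Only one segment starts and only one ends at a vertex.\<close>

lemma at_two:
  assumes "d1 \<in> cyc \<times> UNIV" "d2 \<in> cyc \<times> UNIV" "d3 \<in> cyc \<times> UNIV" "at d1 v" "at d2 v" "at d3 v"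
  shows "fst d1 = fst d2 \<or> fst d1 = fst d3 \<or> fst d2 = fst d3"
proof -
  have *: "fst d \<in> cyc \<and> (fst (fst d) = v \<or> snd (fst d) = v)" if "d \<in> cyc \<times> UNIV" "at d v" for d
    using that by (auto simp: at_def src_def tgt_def split: if_splits)
  have out: "s = s'" if s: "s \<in> cyc" "s' \<in> cyc" "fst s = v" "fst s' = v" for s s'
  proof -
    obtain b b' where "s = (v, b)" "s' = (v, b')" using s(3,4) by (cases s; cases s') simp
    then show ?thesis using cpairs_unique_succ[of id vs v b v b'] vs(1) s(1,2) by simp
  qed
  have inn: "s = s'" if s: "s \<in> cyc" "s' \<in> cyc" "snd s = v" "snd s' = v" for s s'
  proof -
    obtain a a' where "s = (a, v)" "s' = (a', v)" using s(3,4) by (cases s; cases s') simp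
    then show ?thesis using cpairs_unique_pred[of id vs a v a' v] vs(1) s(1,2) by simp
  qed
  show ?thesis using *[OF assms(1,4)] *[OF assms(2,5)] *[OF assms(3,6)] out inn by metis
qed

lemma chord_mem:
  assumes "xs \<in> F" "(u, v) \<in> chords xs"
  shows "\<exists>d\<in>set xs. \<exists>d'\<in>set xs. (d, d') \<in> set (cpairs xs) \<and> tgt d = u \<and> src d' = v"
  using assms(2) cpairs_mem unfolding chords_def by fastforce

lemma chord_props:
  assumes "xs \<in> F" "(u, v) \<in> chords xs"
  shows "u \<in> set vs \<and> v \<in> set vs \<and> own u = own v \<and> (u = v \<longleftrightarrow> u \<notin> A) \<and> (u \<noteq> v \<longrightarrow> u \<in> A \<and> v \<in> A)"
proof -
  obtain d d' where d: "d \<in> set xs" "d' \<in> set xs" "(d, d') \<in> set (cpairs xs)" "tgt d = u" "src d' = v"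
    using chord_mem[OF assms] by blast
  then have m: "u \<in> set vs" "v \<in> set vs" using dirseg_mem[OF F_mem[OF assms(1)]] by blast+
  have l: "lnk own A u v" using circ_lnk[OF family_circ[OF fam assms(1)] d(3)] d(4,5) by simp
  then have "u \<noteq> v \<longrightarrow> v \<in> A" using single[OF m(2) _ m(1)] by (auto simp: lnk_def)
  then show ?thesis using l m by (auto simp: lnk_def)
qed

lemma chord_unique:
  assumes "xs \<in> F" "(u, v) \<in> chords xs" "(u', v') \<in> chords xs" "own u = own u'"
  shows "u = u' \<and> v = v'"
proof -
  note c = family_circ[OF fam assms(1)]
  obtain d d' where d: "d \<in> set xs" "(d, d') \<in> set (cpairs xs)" "tgt d = u" "src d' = v"
    using chord_mem[OF assms(1,2)] by blast
  obtain e e' where e: "e \<in> set xs" "(e, e') \<in> set (cpairs xs)" "tgt e = u'" "src e' = v'"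
    using chord_mem[OF assms(1,3)] by blast
  have "own (tgt d) = own (tgt e)" unfolding d(3) e(3) by (rule assms(4))
  then have "d = e" by (rule circ_tgt_inj[OF c d(1) e(1)])
  then have "d' = e'" using cpairs_unique_succ[of id xs d d' e e'] circ_distinct[OF c] d(2) e(2) by simp
  then show ?thesis using \<open>d = e\<close> d e by simp
qed

lemma block_props:
  assumes "xs \<in> F" "(u, v) \<in> chords xs"
  shows "distinct (block ip u v) \<and> (\<forall>x\<in>set (block ip u v). own x = own u) \<and>
    set (block ip u v) \<inter> set vs = {u, v} \<and> undir (segs (block ip u v)) \<inter> undir cyc = {}"
proof (cases "u = v")
  case True
  then show ?thesis using chord_props[OF assms] by (auto simp: block_def)
next
  case False
  then have uv: "u \<in> A" "v \<in> A" "u \<in> set vs" "v \<in> set vs" "own u = own v"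
    using chord_props[OF assms] by auto
  have b: "block ip u v = u # ip u v @ [v]" using False by (simp add: block_def)
  have i: "distinct (ip u v)" "set (ip u v) \<inter> set vs = {}" "\<forall>x\<in>set (ip u v). own x = own u"
    "undir (segs (u # ip u v @ [v])) \<inter> undir cyc = {}"
    using ip[OF uv False] by blast+
  have "u \<notin> set (ip u v)" "v \<notin> set (ip u v)" using i(2) uv(3,4) by blast+
  then have "distinct (block ip u v)" unfolding b using i(1) False by simp
  moreover have "\<forall>x\<in>set (block ip u v). own x = own u" unfolding b using i(3) uv(5) by simp
  moreover have "set (block ip u v) \<inter> set vs = {u, v}" unfolding b using i(2) uv(3,4) by auto
  ultimately show ?thesis unfolding b using i(4) by blast
qed

text \<open>The blocks of different chords lie in different classes, as the circuit passes each
  class once.\<close>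

lemma distinct_walk_circ:
  assumes xs: "xs \<in> F"
  shows "distinct (walk ip xs)"
proof (rule distinct_walk)
  note c = family_circ[OF fam xs]
  show "distinct xs" by (rule circ_distinct[OF c])
  show "distinct (block ip u v)" if "(u, v) \<in> chords xs" for u v using block_props[OF xs that] by simp
  show "set (block ip (tgt d) (src d')) \<inter> set (block ip (tgt e) (src e')) = {}"
    if "(d, d') \<in> set (cpairs xs)" "(e, e') \<in> set (cpairs xs)" "d \<noteq> e" for d d' e e'
  proof -
    have "own (tgt d) \<noteq> own (tgt e)"
      using circ_tgt_inj[OF c, of d e] cpairs_mem[OF that(1)] cpairs_mem[OF that(2)] that(3) by auto
    moreover have "\<forall>x\<in>set (block ip (tgt d) (src d')). own x = own (tgt d)"
      "\<forall>x\<in>set (block ip (tgt e) (src e')). own x = own (tgt e)"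
      using block_props[OF xs chordsI[OF that(1)]] block_props[OF xs chordsI[OF that(2)]] by simp_all
    ultimately show ?thesis by (metis disjoint_iff)
  qed
qed

definition arcs :: "'a dirseg list \<Rightarrow> ('a \<times> 'a) set" where "arcs xs = set (cpairs (walk ip xs))"

definition chord_edges :: "'a dirseg list \<Rightarrow> 'a set set" where
  "chord_edges xs = {f. \<exists>u v. (u, v) \<in> chords xs \<and> f \<in> undir (segs (block ip u v))}"

lemma undir_arcs: "undir (arcs xs) = chord_edges xs \<union> undir (fst ` set xs)"
  unfolding arcs_def arcs_walk image_Un undir_dirsegs image_UN_pairs chord_edges_def ..

lemma chord_edges_off: "xs \<in> F \<Longrightarrow> chord_edges xs \<inter> undir cyc = {}"
proof -
  assume xs: "xs \<in> F"
  show ?thesis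
  proof (rule equals0I)
    fix e assume "e \<in> chord_edges xs \<inter> undir cyc"
    then have e: "e \<in> chord_edges xs" "e \<in> undir cyc" by (rule IntD1, rule IntD2)
    from e(1) obtain u v where uv: "(u, v) \<in> chords xs" "e \<in> undir (segs (block ip u v))"
      unfolding chord_edges_def by (elim CollectE exE conjE)
    have "undir (segs (block ip u v)) \<inter> undir cyc = {}" using block_props[OF xs uv(1)] by simp
    then show False using IntI[OF uv(2) e(2)] by simp
  qed
qed

lemma chord_edges_neq: "xs \<in> F \<Longrightarrow> e \<in> chord_edges xs \<Longrightarrow> f \<in> undir cyc \<Longrightarrow> e \<noteq> f"
  by (metis IntI chord_edges_off empty_iff)

lemma chord_edges_nonempty: "xs \<in> F \<Longrightarrow> \<exists>e. e \<in> chord_edges xs"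
proof -
  assume xs: "xs \<in> F"
  obtain u v where uv: "(u, v) \<in> chords xs" "u \<noteq> v"
    using family_circ[OF fam xs] unfolding circ_def by blast
  obtain x p where "block ip u v = u # x # p" using uv(2) unfolding block_def by (cases "ip u v") auto
  then have "{u, x} \<in> undir (segs (block ip u v))" by (auto simp: image_iff)
  with uv(1) show ?thesis unfolding chord_edges_def by (intro exI CollectI conjI)
qed

lemma F_nonempty: "xs \<in> F \<Longrightarrow> xs \<noteq> []"
  using family_circ[OF fam] unfolding circ_def chords_def by fastforce

lemma length_walk: "xs \<in> F \<Longrightarrow> length (walk ip xs) \<ge> 3"
proof -
  assume xs: "xs \<in> F"
  obtain e where e: "e \<in> chord_edges xs" using chord_edges_nonempty[OF xs] by blast
  obtain d where d: "d \<in> set xs" using F_nonempty[OF xs] by (cases xs) auto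
  let ?f = "(\<lambda>(u, v). {u, v}) (fst d)"
  have "fst d \<in> cyc" using F_mem[OF xs d] by auto
  then have "?f \<in> undir cyc" by (rule imageI)
  then have "e \<noteq> ?f" by (rule chord_edges_neq[OF xs e])
  moreover have "e \<in> undir (arcs xs)" "?f \<in> undir (arcs xs)" unfolding undir_arcs using e d by auto
  ultimately show ?thesis using length_ge_3_if_two_edges unfolding arcs_def by metis
qed

lemma is_dicycle_arcs: "xs \<in> F \<Longrightarrow> is_dicycle (arcs xs)"
  unfolding is_dicycle_iff arcs_def using distinct_walk_circ length_walk by blast

text \<open>The cocircuit is realised in the same way, with the paths of the chords of
  \<open>xs\<close>. It has to be checked that no vertex repeats and that every proper chord is
  taken; then the edges are the chord paths and the remaining edges of the cycle, which is the
  symmetric difference.\<close>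

lemma sym_diff_cycle:
  assumes xs: "xs \<in> F"
  shows "is_cycle (sym_diff_graph (underlying cyc) (underlying (arcs xs)))"
proof -
  note c = family_circ[OF fam xs]
  obtain zs where zs: "cocirc cyc xs zs" using family_cocirc[OF fam xs] by blast
  have zfst: "fst ` set zs = cyc - fst ` set xs" using zs by (simp add: cocirc_def)
  have zmem: "d \<in> cyc \<times> UNIV" "fst d \<notin> fst ` set xs" if "d \<in> set zs" for d
  proof -
    have "fst d \<in> cyc - fst ` set xs" using imageI[OF that, of fst] zfst by simp
    then show "d \<in> cyc \<times> UNIV" "fst d \<notin> fst ` set xs" by (cases d; auto)+
  qed
  have zinj: "d = e" if "d \<in> set zs" "e \<in> set zs" "fst d = fst e" for d e
    using zs that by (auto simp: cocirc_def distinct_map inj_on_def)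
  have noloop: "src d \<noteq> tgt d" if "d \<in> set zs" for d using dirseg_mem[OF zmem(1)[OF that]] by simp
  \<comment> \<open>Of the two segments at a vertex met by \<open>xs\<close>, one is used by
    \<open>xs\<close>, so at most one is left for \<open>zs\<close>.\<close>
  have one: "d = e" if "d0 \<in> set xs" "at d0 v" "d \<in> set zs" "e \<in> set zs" "at d v" "at e v" for d0 d e v
  proof -
    have "fst d0 \<noteq> fst d" "fst d0 \<noteq> fst e" using zmem(2)[OF that(3)] zmem(2)[OF that(4)] imageI[OF that(1), of fst] by metis+
    then have "fst d = fst e" using at_two[OF F_mem[OF xs that(1)] zmem(1) zmem(1)] that by blast
    then show ?thesis using zinj that by blast
  qed
  \<comment> \<open>Going straight on takes two segments of \<open>zs\<close>, so it happens only at
    vertices that \<open>xs\<close> does not meet.\<close>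
  have straight: "\<not> at d0 (tgt d)" if "(d, d') \<in> set (cpairs zs)" "tgt d = src d'" "d0 \<in> set xs" for d d' d0
  proof
    assume "at d0 (tgt d)"
    then have "d = d'" using one[OF that(3), of "tgt d" d d'] cpairs_mem[OF that(1)] that(2) by (auto simp: at_def)
    then show False using noloop cpairs_mem[OF that(1)] that(2) by metis
  qed
  have used: "\<exists>d0\<in>set xs. at d0 u" "\<exists>d0\<in>set xs. at d0 v" if "(u, v) \<in> chords xs" for u v
    using chord_mem[OF xs that] by (auto simp: at_def)
  have zlink: "tgt d = src d' \<or> (tgt d, src d') \<in> chords xs \<or> (src d', tgt d) \<in> chords xs"
    if "(d, d') \<in> set (cpairs zs)" for d d'
  proof -
    have z: "\<forall>(u, v)\<in>chords zs. zlnk (chords xs) u v" using zs by (simp add: cocirc_def)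
    have "zlnk (chords xs) (tgt d) (src d')" using bspec[OF z chordsI[OF that]] by simp
    then show ?thesis by (simp add: zlnk_def)
  qed
  \<comment> \<open>The cocircuit may run through a chord against its direction in
    \<open>xs\<close>, and then follows the reversed path.\<close>
  define ip' where "ip' = (\<lambda>u v. if (u, v) \<in> chords xs then ip u v else rev (ip v u))"
  have block': "set (block ip' u v) = set (block ip a b) \<and> distinct (block ip' u v) \<and>
      undir (segs (block ip' u v)) = undir (segs (block ip a b))"
    if "(a, b) \<in> chords xs" "a \<noteq> b" "(u, v) = (a, b) \<or> (u, v) = (b, a)" for a b u v
  proof (cases "(u, v) = (a, b)")
    case True
    then have "block ip' u v = block ip a b" using that(1) by (simp add: block_def ip'_def)
    then show ?thesis using block_props[OF xs that(1)] by simp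
  next
    case False
    then have uv: "u = b" "v = a" using that(3) by auto
    have "(b, a) \<notin> chords xs"
    proof
      assume "(b, a) \<in> chords xs"
      then have "a = b" using chord_unique[OF xs that(1)] chord_props[OF xs that(1)] by metis
      then show False using that(2) by simp
    qed
    then have "block ip' u v = rev (block ip a b)" using that(2) by (simp add: block_def ip'_def uv)
    then show ?thesis
      using block_props[OF xs that(1)] by (simp add: segs_rev undir_converse)
  qed
  have zblock: "\<exists>a b. (a, b) \<in> chords xs \<and> a \<noteq> b \<and> {a, b} = {tgt d, src d'} \<and>
      set (block ip' (tgt d) (src d')) = set (block ip a b) \<and> distinct (block ip' (tgt d) (src d')) \<and>
      undir (segs (block ip' (tgt d) (src d'))) = undir (segs (block ip a b))"
    if "(d, d') \<in> set (cpairs zs)" "tgt d \<noteq> src d'" for d d'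
  proof -
    from zlink[OF that(1)] that(2) consider "(tgt d, src d') \<in> chords xs" | "(src d', tgt d) \<in> chords xs"
      by blast
    then show ?thesis
    proof cases
      case 1
      show ?thesis
        by (intro exI conjI, rule 1) (use block'[OF 1 that(2) disjI1[OF refl]] that(2) in simp_all)
    next
      case 2
      show ?thesis
        by (intro exI conjI, rule 2)
          (use block'[OF 2 that(2)[symmetric] disjI2[OF refl]] that(2) in \<open>simp_all add: doubleton_eq_iff\<close>)
    qed
  qed
  have zset: "\<exists>a b. (a, b) \<in> chords xs \<and> {a, b} = {tgt d, src d'} \<and>
      set (block ip' (tgt d) (src d')) = set (block ip a b)"
    if p: "(d, d') \<in> set (cpairs zs)" "tgt d \<noteq> src d'" for d d'
  proof -
    from zblock[OF p] obtain a b where "(a, b) \<in> chords xs" "{a, b} = {tgt d, src d'}"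
      "set (block ip' (tgt d) (src d')) = set (block ip a b)" by (elim exE conjE)
    then show ?thesis by (intro exI conjI)
  qed
  let ?w = "walk ip' zs"
  have dis: "distinct ?w"
  proof (rule distinct_walk)
    show "distinct zs" using zs by (auto simp: cocirc_def distinct_map)
    show "distinct (block ip' u v)" if uv: "(u, v) \<in> chords zs" for u v
    proof -
      obtain d d' where d: "(d, d') \<in> set (cpairs zs)" "tgt d = u" "src d' = v"
        using uv unfolding chords_def by auto
      show ?thesis
      proof (cases "u = v")
        case False
        then show ?thesis using zblock[OF d(1)] d(2,3) by auto
      qed (simp add: block_def)
    qed
    show "set (block ip' (tgt d) (src d')) \<inter> set (block ip' (tgt e) (src e')) = {}"
      if p: "(d, d') \<in> set (cpairs zs)" and q: "(e, e') \<in> set (cpairs zs)" and de: "d \<noteq> e" for d d' e e'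
    proof -
      have m: "d \<in> set zs" "d' \<in> set zs" "e \<in> set zs" "e' \<in> set zs" using cpairs_mem p q by metis+
      \<comment> \<open>A chord path meets the cycle only at its two ends, both of which are met by
        \<open>xs\<close>; the cocircuit goes straight at neither.\<close>
      have mixed: "tgt d1 \<notin> set (block ip' (tgt d2) (src d2'))"
        if p1: "(d1, d1') \<in> set (cpairs zs)" "tgt d1 = src d1'" and p2: "(d2, d2') \<in> set (cpairs zs)" "tgt d2 \<noteq> src d2'"
        for d1 d1' d2 d2'
      proof
        assume t: "tgt d1 \<in> set (block ip' (tgt d2) (src d2'))"
        from zset[OF p2] obtain a b where ab: "(a, b) \<in> chords xs"
          "set (block ip' (tgt d2) (src d2')) = set (block ip a b)" by (elim exE conjE)
        have "d1 \<in> set zs" using cpairs_mem[OF p1(1)] by simp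
        then have "tgt d1 \<in> set vs" using dirseg_mem[OF zmem(1)] by blast
        then have "tgt d1 \<in> set (block ip a b) \<inter> set vs" using t ab(2) by simp
        moreover have "set (block ip a b) \<inter> set vs = {a, b}" using block_props[OF xs ab(1)] by simp
        ultimately have "tgt d1 = a \<or> tgt d1 = b" by simp
        then have "\<exists>d0\<in>set xs. at d0 (tgt d1)" using used[OF ab(1)] by metis
        then show False using straight[OF p1] by metis
      qed
      show ?thesis
      proof (cases "tgt d = src d'")
        case True
        show ?thesis
        proof (cases "tgt e = src e'")
          case False
          then show ?thesis using mixed[OF p True q False] True by (simp add: block_def)
        next
          case e: True
          have "tgt d \<noteq> tgt e"
          proof
            assume te: "tgt d = tgt e"
            then have "fst d = fst d' \<or> fst d = fst e \<or> fst d' = fst e"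
              using at_two[OF zmem(1)[OF m(1)] zmem(1)[OF m(2)] zmem(1)[OF m(3)], of "tgt d"] True
              by (auto simp: at_def)
            then have "d = d' \<or> d = e \<or> d' = e" using zinj m by blast
            then show False using noloop[OF m(1)] noloop[OF m(3)] True te de by metis
          qed
          then show ?thesis using True e by (simp add: block_def)
        qed
      next
        case False
        show ?thesis
        proof (cases "tgt e = src e'")
          case True
          then show ?thesis using mixed[OF q True p False] by (simp add: block_def)
        next
          case e: False
          obtain a b where ab: "(a, b) \<in> chords xs" "{a, b} = {tgt d, src d'}"
            "set (block ip' (tgt d) (src d')) = set (block ip a b)" using zset[OF p False] by (elim exE conjE)
          obtain a' b' where ab': "(a', b') \<in> chords xs" "{a', b'} = {tgt e, src e'}"
            "set (block ip' (tgt e) (src e')) = set (block ip a' b')" using zset[OF q e] by (elim exE conjE)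
          show ?thesis
          proof (rule ccontr)
            assume "\<not> ?thesis"
            then obtain x where "x \<in> set (block ip a b)" "x \<in> set (block ip a' b')"
              unfolding ab(3) ab'(3) by blast
            moreover have "\<forall>x\<in>set (block ip a b). own x = own a" "\<forall>x\<in>set (block ip a' b'). own x = own a'"
              using block_props[OF xs ab(1)] block_props[OF xs ab'(1)] by simp_all
            ultimately have "own a = own a'" by metis
            \<comment> \<open>A common vertex forces both blocks to come from the same chord of
              \<open>xs\<close>. Each end of it meets only one segment of \<open>zs\<close>, so the
              chord cannot be taken twice.\<close>
            then have "a = a'" "b = b'" using chord_unique[OF xs ab(1) ab'(1)] by simp_all
            then have eq: "{tgt d, src d'} = {tgt e, src e'}" using ab(2) ab'(2) by simp
            have us: "\<exists>d0\<in>set xs. at d0 x" if "x \<in> {tgt d, src d'}" for x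
              using used[OF ab(1)] that ab(2) by (auto simp: doubleton_eq_iff)
            show False
            proof (cases "tgt e = tgt d")
              case True
              then show False using us[of "tgt d"] one[of _ "tgt d" d e] m de by (auto simp: at_def)
            next
              case False
              then have te: "tgt e = src d'" using eq by (auto simp: doubleton_eq_iff)
              then have "d' = e" using us[of "src d'"] one[of _ "src d'" d' e] m by (auto simp: at_def)
              then show False using noloop[OF m(3)] te by simp
            qed
          qed
        qed
      qed
    qed
  qed
  \<comment> \<open>At the attachment \<open>u\<close> the circuit uses one of the two segments, so
    \<open>zs\<close> has the other one. It cannot go straight there, and the only chord of
    \<open>xs\<close> at \<open>u\<close> is the given one.\<close>
  have cover: "(u, v) \<in> chords zs \<or> (v, u) \<in> chords zs" if uv: "(u, v) \<in> chords xs" "u \<noteq> v" for u v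
  proof -
    have uA: "u \<in> A" "u \<in> set vs" "own u = own v" using chord_props[OF xs uv(1)] uv(2) by auto
    obtain d0 where d0: "d0 \<in> set xs" "at d0 u" using used(1)[OF uv(1)] by blast
    obtain x y where xy: "(x, u) \<in> cyc" "(u, y) \<in> cyc" using cpairs_pred cpairs_succ uA(2) by metis
    have only: "d = d0" if "d \<in> set xs" "at d u" for d
      using circ_one_visit[OF c that(1) d0(1) uA(1)] that(2) d0(2) unfolding at_def by metis
    have atf: "at d u" if "fst d = (x, u) \<or> fst d = (u, y)" for d
      using that by (auto simp: at_def src_def tgt_def)
    have "\<exists>s\<in>{(x, u), (u, y)}. s \<notin> fst ` set xs"
    proof (rule ccontr)
      assume "\<not> ?thesis"
      then have "(x, u) \<in> fst ` set xs" "(u, y) \<in> fst ` set xs" by simp_all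
      then obtain d1 d2 where d12: "d1 \<in> set xs" "(x, u) = fst d1" "d2 \<in> set xs" "(u, y) = fst d2"
        by (elim imageE)
      have "d1 = d0" "d2 = d0" using only[OF d12(1)] only[OF d12(3)] atf d12(2,4) by metis+
      then have "(x, u) = (u, y)" using d12(2,4) by simp
      then show False using cpairs_neq[OF vs(1) _ xy(1)] vs(2) by simp
    qed
    then obtain s where s: "s \<in> {(x, u), (u, y)}" "s \<notin> fst ` set xs" by (elim bexE)
    then have "s \<in> fst ` set zs" unfolding zfst using xy by auto
    then obtain d where ds: "s = fst d" "d \<in> set zs" by (rule imageE)
    then have d: "d \<in> set zs" "at d u" using atf s(1) by auto
    have partner: "z = v" if z: "(u, z) \<in> chords xs \<or> (z, u) \<in> chords xs" "u \<noteq> z" for z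
      using z(1)
    proof
      assume "(u, z) \<in> chords xs"
      then show ?thesis using chord_unique[OF xs uv(1) _ refl] by metis
    next
      assume zu: "(z, u) \<in> chords xs"
      then have "own u = own z" using chord_props[OF xs zu] by simp
      then show ?thesis using chord_unique[OF xs uv(1) zu] z(2) by simp
    qed
    show ?thesis
    proof (cases "tgt d = u")
      case True
      obtain d' where d': "(d, d') \<in> set (cpairs zs)" using cpairs_succ d(1) by metis
      have ne: "u \<noteq> src d'" using straight[OF d' _ d0(1)] d0(2) True by metis
      have "src d' = v" by (rule partner[OF _ ne]) (use zlink[OF d'] True ne in simp)
      then show ?thesis using chordsI[OF d'] True by simp
    next
      case False
      then have su: "src d = u" using d(2) by (simp add: at_def)
      obtain d' where d': "(d', d) \<in> set (cpairs zs)" using cpairs_pred d(1) by metis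
      have ne: "u \<noteq> tgt d'" using straight[OF d' _ d0(1)] d0(2) su by metis
      have "tgt d' = v" by (rule partner[OF _ ne]) (use zlink[OF d'] su ne in auto)
      then show ?thesis using chordsI[OF d'] su by simp
    qed
  qed
  have K: "{f. \<exists>u v. (u, v) \<in> chords zs \<and> f \<in> undir (segs (block ip' u v))} = chord_edges xs"
    (is "?K = _")
  proof
    show "?K \<subseteq> chord_edges xs"
    proof
      fix f assume "f \<in> ?K"
      then obtain u v where uv: "(u, v) \<in> chords zs" "f \<in> undir (segs (block ip' u v))"
        by (elim CollectE exE conjE)
      from uv(1) obtain d d' where dd: "(d, d') \<in> set (cpairs zs)" "u = tgt d" "v = src d'"
        unfolding chords_def by auto
      have d: "(d, d') \<in> set (cpairs zs)" "f \<in> undir (segs (block ip' (tgt d) (src d')))"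
        using dd uv(2) by simp_all
      then have "tgt d \<noteq> src d'" by (auto simp: block_def)
      then obtain a b where "(a, b) \<in> chords xs" "f \<in> undir (segs (block ip a b))"
        using zblock[OF d(1) \<open>tgt d \<noteq> src d'\<close>] d(2) by (elim exE conjE) simp
      then show "f \<in> chord_edges xs" unfolding chord_edges_def by (intro CollectI exI conjI)
    qed
    show "chord_edges xs \<subseteq> ?K"
    proof
      fix f assume "f \<in> chord_edges xs"
      then obtain a b where ab: "(a, b) \<in> chords xs" "f \<in> undir (segs (block ip a b))"
        unfolding chord_edges_def by (elim CollectE exE conjE)
      then have ne: "a \<noteq> b" by (auto simp: block_def)
      obtain u v where uv: "(u, v) \<in> chords zs" "(u, v) = (a, b) \<or> (u, v) = (b, a)"
        using cover[OF ab(1) ne] by blast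
      then have "f \<in> undir (segs (block ip' u v))" using block'[OF ab(1) ne uv(2)] ab(2) by simp
      with uv(1) show "f \<in> ?K" by (intro CollectI exI conjI)
    qed
  qed
  have E: "undir (set (cpairs ?w)) = chord_edges xs \<union> undir (fst ` set zs)"
    unfolding arcs_walk image_Un undir_dirsegs image_UN_pairs K ..
  have injR: "inj_on (\<lambda>(u, v). {u, v}) cyc"
    using undir_inj[OF vs] unfolding inj_on_def by auto
  have xsR: "fst ` set xs \<subseteq> cyc" using F_mem[OF xs] by force
  have "undir (fst ` set zs) = undir cyc - undir (fst ` set xs)"
    unfolding zfst by (rule inj_on_image_set_diff[OF injR Diff_subset xsR])
  moreover have "(U - (K \<union> X)) \<union> ((K \<union> X) - U) = K \<union> (U - X)" if "X \<subseteq> U" "K \<inter> U = {}"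
    for U X K :: "'a set set" using that by blast
  from this[OF image_mono[OF xsR] chord_edges_off[OF xs]]
  have "(undir cyc - undir (arcs xs)) \<union> (undir (arcs xs) - undir cyc) =
      chord_edges xs \<union> (undir cyc - undir (fst ` set xs))"
    unfolding undir_arcs .
  ultimately have sd: "(undir cyc - undir (arcs xs)) \<union> (undir (arcs xs) - undir cyc) = undir (set (cpairs ?w))"
    unfolding E by simp
  obtain f where f: "f \<in> chord_edges xs" using chord_edges_nonempty[OF xs] by blast
  obtain d where d: "d \<in> set zs" using zs by (cases zs) (auto simp: cocirc_def)
  let ?g = "(\<lambda>(u, v). {u, v}) (fst d)"
  have "fst d \<in> cyc" using zmem(1)[OF d] by auto
  then have "?g \<in> undir cyc" by (rule imageI)
  then have "f \<noteq> ?g" by (rule chord_edges_neq[OF xs f])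
  moreover have "f \<in> undir (set (cpairs ?w))" "?g \<in> undir (set (cpairs ?w))" unfolding E using f d by auto
  ultimately have "length ?w \<ge> 3" using length_ge_3_if_two_edges by metis
  then show ?thesis
    unfolding sym_diff_graph_def edges_underlying sd by (rule is_cycle_edge_induced[OF dis])
qed

section \<open>Counting dicycles through an edge\<close>

lemma F_disjoint: "xs \<in> F \<Longrightarrow> ys \<in> F \<Longrightarrow> d \<in> set xs \<Longrightarrow> d \<in> set ys \<Longrightarrow> xs = ys"
proof -
  assume a: "xs \<in> F" "ys \<in> F" "d \<in> set xs" "d \<in> set ys"
  have "\<forall>xs\<in>F. \<forall>ys\<in>F. xs \<noteq> ys \<longrightarrow> set xs \<inter> set ys = {}" using fam by (simp add: family_def)
  then show ?thesis using a by blast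
qed

lemma F_cover: "d \<in> cyc \<times> UNIV \<Longrightarrow> \<exists>xs\<in>F. d \<in> set xs"
  using family_Union[OF fam] by blast

text \<open>Disjoint nonempty circuits are determined by their sets of directed segments, of which
  there are finitely many.\<close>

lemma finite_F: "finite F"
proof (rule finite_imageD)
  show "finite (set ` F)"
    by (rule finite_subset[of _ "Pow (cyc \<times> UNIV)"]) (use F_mem in blast, simp)
  show "inj_on set F"
  proof (rule inj_onI)
    fix xs ys assume xy: "xs \<in> F" "ys \<in> F" "set xs = set ys"
    then obtain d where "d \<in> set xs" using F_nonempty[OF xy(1)] by (cases xs) auto
    then show "xs = ys" using F_disjoint xy by metis
  qed
qed

lemma dirseg_eqI:
  assumes "d \<in> cyc \<times> UNIV" "d' \<in> cyc \<times> UNIV" "src d = src d'" "tgt d = tgt d'"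
  shows "d = d'"
proof -
  obtain a b c where d: "d = ((a, b), c)" by (metis surj_pair)
  obtain a' b' c' where d': "d' = ((a', b'), c')" by (metis surj_pair)
  show ?thesis
    using assms cpairs_antisym[OF vs, of a b] unfolding d d' by (cases c; cases c') auto
qed

lemma arcs_undir: "(x, y) \<in> arcs xs \<Longrightarrow> {x, y} \<in> undir (arcs xs)"
  by (rule undirI)

lemma arcsE:
  assumes "(x, y) \<in> arcs xs"
  obtains "{x, y} \<in> chord_edges xs" | d where "d \<in> set xs" "src d = x" "tgt d = y"
proof -
  from assms consider u v where "(u, v) \<in> chords xs" "(x, y) \<in> segs (block ip u v)"
    | d where "d \<in> set xs" "(x, y) = (src d, tgt d)"
    unfolding arcs_def arcs_walk by blast
  then show ?thesis
  proof cases
    case 1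
    have "{x, y} \<in> undir (segs (block ip u v))" using 1(2) by (rule undirI)
    with 1(1) have "{x, y} \<in> chord_edges xs" unfolding chord_edges_def by (intro CollectI exI conjI)
    then show ?thesis by (rule that(1))
  next
    case 2
    then show ?thesis using that(2) by simp
  qed
qed

lemma seg_arc: "d \<in> set xs \<Longrightarrow> (src d, tgt d) \<in> arcs xs"
  unfolding arcs_def arcs_walk by blast

lemma dirseg_undir: "d \<in> cyc \<times> UNIV \<Longrightarrow> {src d, tgt d} \<in> undir cyc"
proof -
  assume "d \<in> cyc \<times> UNIV"
  then have "fst d \<in> cyc" by auto
  then show ?thesis unfolding undir_dirseg by (rule imageI)
qed

lemma arc_iff: "xs \<in> F \<Longrightarrow> d \<in> cyc \<times> UNIV \<Longrightarrow> (src d, tgt d) \<in> arcs xs \<longleftrightarrow> d \<in> set xs"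
proof
  assume xs: "xs \<in> F" and d: "d \<in> cyc \<times> UNIV" and a: "(src d, tgt d) \<in> arcs xs"
  from a show "d \<in> set xs"
  proof (rule arcsE)
    assume "{src d, tgt d} \<in> chord_edges xs"
    then show ?thesis using chord_edges_neq[OF xs _ dirseg_undir[OF d]] by blast
  next
    fix d' assume "d' \<in> set xs" "src d' = src d" "tgt d' = tgt d"
    then show ?thesis using dirseg_eqI[OF F_mem[OF xs] d] by metis
  qed
qed (rule seg_arc)

lemma arcs_inj: "inj_on arcs F"
proof (rule inj_onI)
  fix xs ys assume xy: "xs \<in> F" "ys \<in> F" "arcs xs = arcs ys"
  then obtain d where d: "d \<in> set xs" using F_nonempty[OF xy(1)] by (cases xs) auto
  then have "d \<in> set ys" using arc_iff F_mem xy by metis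
  then show "xs = ys" using F_disjoint xy(1,2) d by metis
qed

lemma verts_arcs: "verts (underlying (arcs xs)) = set (walk ip xs)"
  by (simp add: verts_underlying arcs_def Field_cpairs)

lemma dicycles_through_iff: "dicycles_through (arcs ` F) e = arcs ` {xs \<in> F. e \<in> undir (arcs xs)}"
  unfolding dicycles_through_def edges_underlying by blast

text \<open>The two orientations of the segment lie in two different circuits, as no circuit repeats
  a segment.\<close>

lemma through_cycle_edge:
  assumes "(u, v) \<in> cyc"
  shows "card (dicycles_through (arcs ` F) {u, v}) = 2"
proof -
  let ?d = "\<lambda>c. ((u, v), c)"
  obtain x1 x2 where x: "x1 \<in> F" "?d True \<in> set x1" "x2 \<in> F" "?d False \<in> set x2"
    using F_cover[of "?d True"] F_cover[of "?d False"] assms by auto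
  have ne: "x1 \<noteq> x2"
    using circ_fst_inj[OF family_circ[OF fam x(1)], of "?d True" "?d False"] x by auto
  have S: "{xs \<in> F. {u, v} \<in> undir (arcs xs)} = {x1, x2}"
  proof
    show "{x1, x2} \<subseteq> {xs \<in> F. {u, v} \<in> undir (arcs xs)}"
      using x arcs_undir[OF seg_arc[OF x(2)]] arcs_undir[OF seg_arc[OF x(4)]] by (simp add: insert_commute)
    show "{xs \<in> F. {u, v} \<in> undir (arcs xs)} \<subseteq> {x1, x2}"
    proof
      fix xs assume "xs \<in> {xs \<in> F. {u, v} \<in> undir (arcs xs)}"
      then have xs: "xs \<in> F" "{u, v} \<in> undir (arcs xs)" by auto
      have uvR: "{u, v} \<in> undir cyc" using imageI[OF assms, of "\<lambda>(u, v). {u, v}"] by simp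
      have "{u, v} \<in> undir (fst ` set xs)"
        using xs(2) chord_edges_neq[OF xs(1) _ uvR] unfolding undir_arcs by blast
      then obtain d where d: "d \<in> set xs" "{u, v} = (\<lambda>(u, v). {u, v}) (fst d)" by (elim imageE) simp
      have "fst d \<in> cyc" using F_mem[OF xs(1) d(1)] by auto
      then have "fst d = (u, v)"
        using undir_inj[OF vs assms, of "fst (fst d)" "snd (fst d)"] d(2) by (cases "fst d") auto
      then have "d = ?d True \<or> d = ?d False" by (cases d) auto
      then show "xs \<in> {x1, x2}" using F_disjoint xs(1) x d(1) by blast
    qed
  qed
  have "arcs x1 \<noteq> arcs x2" using inj_onD[OF arcs_inj _ x(1,3)] ne by blast
  then show ?thesis unfolding dicycles_through_iff S by simp
qed

text \<open>\<open>W\<close> will be one side of the cut that \<open>e\<close> makes in its bridge.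
  Two links leave \<open>W\<close> and two leave its complement; since a circuit passes the class
  \<open>i\<close> only once, these four links belong to four circuits.\<close>

lemma through_chord_edge:
  assumes W: "\<exists>u\<in>set vs \<inter> A. own u = i \<and> u \<in> W" "\<exists>v\<in>set vs \<inter> A. own v = i \<and> v \<notin> W"
    and e: "\<And>xs u v. xs \<in> F \<Longrightarrow> (u, v) \<in> chords xs \<Longrightarrow> own u = i \<Longrightarrow> (u \<in> W \<longleftrightarrow> v \<notin> W) \<Longrightarrow>
      e \<in> undir (arcs xs)"
  shows "card (dicycles_through (arcs ` F) e) \<ge> 4"
proof -
  define P where "P = {p \<in> links F. own (tgt (fst p)) = i}"
  have "spread {v \<in> set vs \<inter> A. own v = i} P"
    using fam unfolding family_def P_def Field_cpairs by simp
  then have sp: "\<exists>p\<in>P. \<exists>p'\<in>P. p \<noteq> p' \<and> tgt (fst p) \<in> X \<and> src (snd p) \<notin> X \<and> tgt (fst p') \<in> X \<and> src (snd p') \<notin> X"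
    if "{v \<in> set vs \<inter> A. own v = i} \<inter> X \<noteq> {}" "\<not> {v \<in> set vs \<inter> A. own v = i} \<subseteq> X" for X
    using that unfolding spread_def by simp
  obtain p1 p2 where p: "p1 \<in> P" "p2 \<in> P" "p1 \<noteq> p2" "tgt (fst p1) \<in> W" "src (snd p1) \<notin> W"
    "tgt (fst p2) \<in> W" "src (snd p2) \<notin> W"
    using sp[of W] W by blast
  obtain p3 p4 where q: "p3 \<in> P" "p4 \<in> P" "p3 \<noteq> p4" "tgt (fst p3) \<notin> W" "src (snd p3) \<in> W"
    "tgt (fst p4) \<notin> W" "src (snd p4) \<in> W"
    using sp[of "- W"] W by blast
  have "\<forall>p\<in>P. \<exists>xs. xs \<in> F \<and> p \<in> set (cpairs xs)" unfolding P_def links_def by blast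
  then obtain h where h: "\<And>p. p \<in> P \<Longrightarrow> h p \<in> F \<and> p \<in> set (cpairs (h p))" by metis
  have inj: "p = p'" if "p \<in> P" "p' \<in> P" "h p = h p'" for p p'
  proof -
    have m: "p \<in> set (cpairs (h p))" "p' \<in> set (cpairs (h p))" "h p \<in> F" using h that by metis+
    note c = family_circ[OF fam m(3)]
    obtain d d' e e' where pp: "p = (d, d')" "p' = (e, e')" by (cases p; cases p')
    have "own (tgt d) = own (tgt e)" using that(1,2) pp by (simp add: P_def)
    then have "d = e" using circ_tgt_inj[OF c] cpairs_mem m(1,2) pp by metis
    then show ?thesis
      using cpairs_unique_succ[of id "h p" d d' e e'] circ_distinct[OF c] m(1,2) pp by simp
  qed
  let ?S = "{p1, p2, p3, p4}"
  have SP: "?S \<subseteq> P" using p q by simp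
  have "p1 \<noteq> p3" "p1 \<noteq> p4" "p2 \<noteq> p3" "p2 \<noteq> p4" using p(4,6) q(4,6) by auto
  then have c4: "card ?S = 4" using p(3) q(3) by simp
  have ih: "inj_on (arcs \<circ> h) ?S"
  proof (rule inj_onI)
    fix x y assume xy: "x \<in> ?S" "y \<in> ?S" "(arcs \<circ> h) x = (arcs \<circ> h) y"
    then have "x \<in> P" "y \<in> P" using SP by blast+
    moreover from this have "h x = h y" using h inj_onD[OF arcs_inj, of "h x" "h y"] xy(3) by simp
    ultimately show "x = y" by (rule inj)
  qed
  have "(arcs \<circ> h) ` ?S \<subseteq> dicycles_through (arcs ` F) e"
  proof (rule image_subsetI)
    fix p assume pS: "p \<in> ?S"
    then have pP: "p \<in> P" using SP by blast
    obtain d d' where pp: "p = (d, d')" by (cases p)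
    have "(tgt d, src d') \<in> chords (h p)" using chordsI h[OF pP] pp by metis
    moreover have "own (tgt d) = i" using pP pp by (simp add: P_def)
    moreover have "tgt d \<in> W \<longleftrightarrow> src d' \<notin> W" using pS p(4-7) q(4-7) pp by auto
    ultimately have "e \<in> undir (arcs (h p))" using e h[OF pP] by blast
    then show "(arcs \<circ> h) p \<in> dicycles_through (arcs ` F) e"
      unfolding dicycles_through_iff using h[OF pP] by (simp only: comp_apply) blast
  qed
  moreover have "finite (dicycles_through (arcs ` F) e)" unfolding dicycles_through_iff using finite_F by simp
  ultimately have "card ((arcs \<circ> h) ` ?S) \<le> card (dicycles_through (arcs ` F) e)" by (rule card_mono[rotated])
  then show ?thesis using card_image[OF ih] c4 by simp
qed

text \<open>A circuit that meets the class does so by one proper chord, whose path meets the cycle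
  in its two ends only.\<close>

lemma attachments_visited:
  assumes xs: "xs \<in> F"
  shows "card (set (walk ip xs) \<inter> {v \<in> set vs \<inter> A. own v = i}) \<in> {0, 2}"
proof -
  let ?S = "set (walk ip xs) \<inter> {v \<in> set vs \<inter> A. own v = i}"
  have mem: "\<exists>u v. (u, v) \<in> chords xs \<and> (x = u \<or> x = v) \<and> own u = i \<and> u \<noteq> v" if "x \<in> ?S" for x
  proof -
    obtain u v where uv: "(u, v) \<in> chords xs" "x \<in> set (block ip u v)" using \<open>x \<in> ?S\<close> unfolding set_walk by auto
    have "x = u \<or> x = v" "own u = own x" using block_props[OF xs uv(1)] uv(2) that by auto
    then show ?thesis using uv(1) chord_props[OF xs uv(1)] that by auto
  qed
  show ?thesis
  proof (cases "?S = {}")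
    case False
    then obtain x where "x \<in> ?S" by blast
    from mem[OF this] obtain u v where uv: "(u, v) \<in> chords xs" "own u = i" "u \<noteq> v" by blast
    have "u \<in> set (walk ip xs)" "v \<in> set (walk ip xs)"
      using uv(1) unfolding set_walk block_def by (auto intro!: bexI[of _ "(u, v)"])
    then have "{u, v} \<subseteq> ?S" using chord_props[OF xs uv(1)] uv by auto
    moreover have "?S \<subseteq> {u, v}"
    proof
      fix x assume "x \<in> ?S"
      from mem[OF this] obtain u' v' where uv': "(u', v') \<in> chords xs" "x = u' \<or> x = v'" "own u' = i" by blast
      then have "u = u'" "v = v'" using chord_unique[OF xs uv(1) uv'(1)] uv(2) by auto
      then show "x \<in> {u, v}" using uv'(2) by blast
    qed
    ultimately have "?S = {u, v}" by blast
    then show ?thesis using uv(3) by simp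
  qed simp
qed

section \<open>Types at attachments\<close>

lemma leaves_cycle:
  assumes xs: "xs \<in> F" and d: "d \<in> set xs" and x: "x \<in> A"
  shows "src d = x \<Longrightarrow> \<exists>b. (b, x) \<in> arcs xs \<and> {x, b} \<in> chord_edges xs"
    and "tgt d = x \<Longrightarrow> \<exists>b. (x, b) \<in> arcs xs \<and> {x, b} \<in> chord_edges xs"
proof -
  have *: "(a, b) \<in> arcs xs \<and> {a, b} \<in> chord_edges xs \<and> {b, a} \<in> chord_edges xs"
    if "(u, v) \<in> chords xs" "(a, b) \<in> segs (block ip u v)" for u v a b
  proof -
    have "(a, b) \<in> arcs xs" unfolding arcs_def arcs_walk using that by blast
    moreover have "{a, b} \<in> undir (segs (block ip u v))" using that(2) by (rule undirI)
    with that(1) have "{a, b} \<in> chord_edges xs" unfolding chord_edges_def by (intro CollectI exI conjI)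
    ultimately show ?thesis by (simp add: insert_commute)
  qed
  show "\<exists>b. (b, x) \<in> arcs xs \<and> {x, b} \<in> chord_edges xs" if sx: "src d = x"
  proof -
    obtain d0 where "(d0, d) \<in> set (cpairs xs)" using cpairs_pred d by metis
    then have c: "(tgt d0, x) \<in> chords xs" using chordsI sx by metis
    then have "tgt d0 \<noteq> x" using chord_props[OF xs c] x by auto
    then have "(last (tgt d0 # ip (tgt d0) x), x) \<in> segs (block ip (tgt d0) x)"
      using zip_tl_append[of "tgt d0 # ip (tgt d0) x" "[x]"] by (simp add: block_def)
    then show ?thesis using *[OF c] by blast
  qed
  show "\<exists>b. (x, b) \<in> arcs xs \<and> {x, b} \<in> chord_edges xs" if tx: "tgt d = x"
  proof -
    obtain d' where "(d, d') \<in> set (cpairs xs)" using cpairs_succ d by metis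
    then have c: "(x, src d') \<in> chords xs" using chordsI tx by metis
    then have "x \<noteq> src d'" using chord_props[OF xs c] x by auto
    then have "(x, hd (ip x (src d') @ [src d'])) \<in> segs (block ip x (src d'))"
      using zip_tl_append[of "[x]" "ip x (src d') @ [src d']"] by (simp add: block_def)
    then show ?thesis using *[OF c] by blast
  qed
qed

text \<open>At an attachment a directed segment of the circuit is always accompanied by an edge off
  the cycle, namely the end of a chord path. A type therefore only asks for one directed segment,
  and every directed segment lies in exactly one circuit.\<close>

lemma type_src:
  assumes "xs \<in> F" "x \<in> A" "d \<in> cyc \<times> UNIV" "src d = x" "chord_edges xs \<subseteq> M"
  shows "(\<exists>b. {x, b} \<in> M \<and> (b, x) \<in> arcs xs \<and> (x, tgt d) \<in> arcs xs) \<longleftrightarrow> d \<in> set xs"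
  using arc_iff[OF assms(1,3)] leaves_cycle(1)[OF assms(1) _ assms(2,4)] assms(4,5) by blast

lemma type_tgt:
  assumes "xs \<in> F" "x \<in> A" "d \<in> cyc \<times> UNIV" "tgt d = x" "chord_edges xs \<subseteq> M"
  shows "(\<exists>b. {x, b} \<in> M \<and> (x, b) \<in> arcs xs \<and> (src d, x) \<in> arcs xs) \<longleftrightarrow> d \<in> set xs"
  using arc_iff[OF assms(1,3)] leaves_cycle(2)[OF assms(1) _ assms(2,4)] assms(4,5) by blast

lemma unique_type:
  assumes "d \<in> cyc \<times> UNIV" "\<And>xs. xs \<in> F \<Longrightarrow> Q (arcs xs) \<longleftrightarrow> d \<in> set xs"
  shows "\<exists>!C. C \<in> arcs ` F \<and> Q C"
proof -
  obtain xs where xs: "xs \<in> F" "d \<in> set xs" using F_cover[OF assms(1)] by blast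
  show ?thesis
  proof (rule ex1I[of _ "arcs xs"])
    show "arcs xs \<in> arcs ` F \<and> Q (arcs xs)" using xs assms(2) by blast
    show "C = arcs xs" if "C \<in> arcs ` F \<and> Q C" for C
      using that assms(2) F_disjoint[OF _ xs(1) _ xs(2)] by blast
  qed
qed

end

section \<open>From the bridges of a 2-connected graph to the required dicycles\<close>

theorem theorem5:
  fixes G L :: "'a graph"
    and R :: "('a \<times> 'a) set"
    and T :: "nat \<Rightarrow> 'a graph"
    and s :: nat
  assumes "two_connected G"
    and "is_cycle L" and "subgraph L G"
    and "orientation_of_cycle R L"
    and "bij_betw T {1..s} (bridges G L)"
    and "\<forall>k\<in>{1..s}. \<forall>l\<in>{1..s}. k \<noteq> l \<longrightarrow> verts (T k) \<inter> verts (T l) = {}"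
    and "is_tree (induced_subgraph (overlap_graph G L) (T ` {1..s}))"
    and "\<forall>k\<in>{1..s}. is_tree (T k)"
  shows "\<exists>\<C> \<subseteq> dicycles G.
    ((\<forall>e\<in>edges L. card (dicycles_through \<C> e) = 2) \<and>
     (\<forall>e\<in>edges G - edges L. card (dicycles_through \<C> e) \<ge> 4)) \<and>
    (\<forall>A\<in>\<C>. is_cycle (sym_diff_graph L (underlying A))) \<and>
    (\<forall>A\<in>\<C>. \<forall>k\<in>{1..s}. card (verts (underlying A) \<inter> attachments L (T k)) \<in> {0, 2}) \<and>
    (\<forall>i j :: bit. \<forall>x. (\<exists>k\<in>{1..s}. x \<in> attachments L (T k)) \<longrightarrow>
       (\<exists>!A. A \<in> \<C> \<and> has_type G R i j x A))"
proof -
  define \<B> where "\<B> = bridges G L"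
  have T: "T ` {1..s} = \<B>" using assms(5) by (simp add: bij_betw_def \<B>_def)
  obtain vs where vs: "distinct vs" "length vs \<ge> 3" and R: "R = set (cpairs vs)"
    using assms(4) unfolding orientation_of_cycle_def is_dicycle_iff by blast
  have L: "L = underlying R" using assms(4) by (simp add: orientation_of_cycle_def)
  then have L': "L = underlying (set (cpairs vs))" using R by simp
  have vL: "verts L = set vs" and eL: "edges L = undir R"
    by (simp_all add: L R verts_underlying edges_underlying Field_cpairs)
  have gG: "is_graph G" using assms(1) by (simp add: two_connected_def connected_graph_def)
  have gL: "is_graph L" and LG: "verts L \<subseteq> verts G" "edges L \<subseteq> edges G"
    using assms(3) by (auto simp: subgraph_def)
  have cL: "card (verts L) \<ge> 3" using vs by (simp add: vL distinct_card)
  have tree: "is_tree B" if "B \<in> \<B>" for B using that assms(8) unfolding T[symmetric] by blast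
  have disj: "verts B \<inter> verts B' = {}" if "B \<in> \<B>" "B' \<in> \<B>" "B \<noteq> B'" for B B'
  proof -
    have "B \<in> T ` {1..s}" "B' \<in> T ` {1..s}" using that(1,2) unfolding T by simp_all
    then obtain k l where kl: "k \<in> {1..s}" "B = T k" "l \<in> {1..s}" "B' = T l" by blast
    then have "k \<noteq> l" using that(3) by blast
    then show ?thesis using assms(6) kl by blast
  qed
  have B2: "card (attachments L B) \<ge> 2" if "B \<in> \<B>" for B
    using bridge_two_attachments[OF assms(1) gL LG(1) cL _ tree[OF that]] that by (simp add: \<B>_def)
  \<comment> \<open>The bridges are disjoint, so there is only one choice of \<open>B\<close>. A
    vertex on no bridge is tagged by itself and forms its own class.\<close>
  define own :: "'a \<Rightarrow> 'a + 'a graph" where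
    "own = (\<lambda>v. if \<exists>B\<in>\<B>. v \<in> verts B then Inr (SOME B. B \<in> \<B> \<and> v \<in> verts B) else Inl v)"
  have own_iff: "own v = Inr B \<longleftrightarrow> B \<in> \<B> \<and> v \<in> verts B" for v B
  proof (cases "\<exists>B\<in>\<B>. v \<in> verts B")
    case True
    define B1 where "B1 = (SOME B. B \<in> \<B> \<and> v \<in> verts B)"
    have "\<exists>B. B \<in> \<B> \<and> v \<in> verts B" using True by (simp only: Bex_def)
    then have "B1 \<in> \<B> \<and> v \<in> verts B1" unfolding B1_def by (rule someI_ex)
    then have B1: "B1 \<in> \<B>" "v \<in> verts B1" by simp_all
    have o: "own v = Inr B1" unfolding own_def B1_def using True by (rule if_P)
    have "B = B1" if "B \<in> \<B>" "v \<in> verts B" using disj[OF that(1) B1(1)] that(2) B1(2) by blast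
    then show ?thesis unfolding o using B1 by blast
  next
    case False
    then show ?thesis by (auto simp: own_def)
  qed
  have own_Inl: "own v = Inl w \<Longrightarrow> w = v" for v w by (simp add: own_def split: if_splits)
  define A where "A = {v \<in> set vs. \<exists>B. own v = Inr B}"
  have attA: "v \<in> attachments L B \<longleftrightarrow> v \<in> A \<and> own v = Inr B" if "B \<in> \<B>" for v B
  proof -
    have "own v = Inr B \<longleftrightarrow> v \<in> verts B" using own_iff that by simp
    then show ?thesis unfolding attachments_def vL A_def by blast
  qed
  define H where "H = induced_subgraph (overlap_graph G L) (T ` {1..s})"
  have "tree_word (map own (filter (\<lambda>v. \<exists>B. own v = Inr B) vs))"
  proof (rule overlap_tree_word[OF vs L', where \<B> = \<B> and H = H])
    show "is_tree H" using assms(7) by (simp add: H_def)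
    show "verts H = \<B>" unfolding H_def T induced_subgraph_def overlap_graph_def \<B>_def by simp
    show "edges H = {{B1, B2} | B1 B2. B1 \<in> \<B> \<and> B2 \<in> \<B> \<and> B1 \<noteq> B2 \<and> overlap L B1 B2}"
      unfolding H_def T induced_subgraph_def overlap_graph_def \<B>_def[symmetric] by auto
    show "own v = Inr B \<longleftrightarrow> v \<in> attachments L B" if "v \<in> set vs" "B \<in> \<B>" for v B
      using that by (simp add: own_iff attachments_def vL)
  qed (use own_iff B2 in blast)+
  moreover have "filter (\<lambda>v. \<exists>B. own v = Inr B) vs = filter (\<lambda>v. v \<in> A) vs"
    by (rule filter_cong) (auto simp: A_def)
  ultimately have tw: "tree_word (map own (filter (\<lambda>v. v \<in> A) vs))" by simp
  \<comment> \<open>A connected graph has a vertex here, so the overlap tree provides a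
    bridge.\<close>
  have "\<B> \<noteq> {}"
    using assms(7) unfolding is_tree_def connected_graph_def T induced_subgraph_def by auto
  then obtain B0 where B0: "B0 \<in> \<B>" by blast
  then have "attachments L B0 \<noteq> {}" using B2[OF B0] by auto
  then have exA: "\<exists>v\<in>set vs. v \<in> A" using attA[OF B0] by (auto simp: A_def)
  have single: "v = n" if n: "n \<in> set vs" "n \<notin> A" "own v = own n" for n v
  proof (cases "own n")
    case (Inl w)
    then show ?thesis using own_Inl[of n w] own_Inl[of v w] n(3) by simp
  next
    case (Inr B)
    then show ?thesis using n(1,2) by (auto simp: A_def)
  qed
  obtain F where F: "family own A (set (cpairs vs)) F"
    using family_exists[OF vs(1) tw exA] single by metis
  define Q where "Q = (\<lambda>u v p. \<exists>B\<in>\<B>. u \<in> verts B \<and> distinct p \<and> set p \<subseteq> verts B - verts L \<and>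
    undir (segs (u # p @ [v])) \<subseteq> edges B)"
  define ip where "ip = (\<lambda>u v. SOME p. Q u v p)"
  have Q: "Q u v (ip u v)" if uv: "u \<in> A" "v \<in> A" "own u = own v" "u \<noteq> v" for u v
  proof -
    obtain B where B: "own u = Inr B" using uv(1) by (auto simp: A_def)
    then have BB: "B \<in> \<B>" "u \<in> verts B" using own_iff by blast+
    have "u \<in> attachments L B" "v \<in> attachments L B" using attA[OF BB(1)] uv B by auto
    then obtain p where "distinct p" "set p \<subseteq> verts B - verts L" "undir (segs (u # p @ [v])) \<subseteq> edges B"
      using bridge_path[OF gG _ _ _ uv(4), of B L] BB(1) unfolding \<B>_def by blast
    then have "Q u v p" using BB unfolding Q_def by blast
    then show ?thesis unfolding ip_def by (rule someI)
  qed
  have Bg: "verts B \<subseteq> verts G \<and> edges B \<subseteq> edges G - edges L \<and> (\<forall>e\<in>edges B. e \<subseteq> verts B)" if "B \<in> \<B>" for B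
    using bridge_graph[OF gG gL] that by (simp add: \<B>_def)
  have Q': "distinct (ip u v) \<and> set (ip u v) \<subseteq> verts B - verts L \<and> undir (segs (u # ip u v @ [v])) \<subseteq> edges B"
    if uv: "u \<in> A" "v \<in> A" "own u = own v" "u \<noteq> v" "own u = Inr B" for u v B
  proof -
    obtain B' where B': "B' \<in> \<B>" "u \<in> verts B'" "distinct (ip u v)" "set (ip u v) \<subseteq> verts B' - verts L"
      "undir (segs (u # ip u v @ [v])) \<subseteq> edges B'" using Q[OF uv(1-4)] unfolding Q_def by blast
    then have "own u = Inr B'" using own_iff by blast
    then have "B' = B" using uv(5) by simp
    then show ?thesis using B' by simp
  qed
  interpret realisation vs own A F ip
  proof
    show "distinct (ip u v) \<and> set (ip u v) \<inter> set vs = {} \<and> (\<forall>x\<in>set (ip u v). own x = own u) \<and>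
        undir (segs (u # ip u v @ [v])) \<inter> undir (set (cpairs vs)) = {}"
      if uv: "u \<in> A" "v \<in> A" "own u = own v" "u \<noteq> v" for u v
    proof -
      obtain B where B: "own u = Inr B" using uv(1) by (auto simp: A_def)
      then have BB: "B \<in> \<B>" using own_iff by blast
      note q = Q'[OF uv B]
      have "\<forall>x\<in>set (ip u v). own x = own u" unfolding B own_iff using q BB by blast
      moreover have "undir (segs (u # ip u v @ [v])) \<inter> undir (set (cpairs vs)) = {}"
      proof -
        have "undir (segs (u # ip u v @ [v])) \<subseteq> edges B" using q by simp
        moreover have "edges B \<inter> edges L = {}" using Bg[OF BB] by blast
        ultimately have "undir (segs (u # ip u v @ [v])) \<inter> edges L = {}"
          by (metis Int_mono order_refl subset_empty)
        then show ?thesis by (simp only: eL R)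
      qed
      moreover have "set (ip u v) \<inter> set vs = {}" using q vL by blast
      ultimately show ?thesis using q by simp
    qed
  qed (use vs F single in auto)
  have block_edges: "undir (segs (block ip u v)) \<subseteq> edges B"
    if "xs \<in> F" "(u, v) \<in> chords xs" "own u = Inr B" for xs u v B
  proof (cases "u = v")
    case False
    then show ?thesis using Q'[of u v B] chord_props[OF that(1,2)] that(3) by (simp add: block_def)
  qed (simp add: block_def)
  have chord_edges_G: "chord_edges xs \<subseteq> edges G - edges L" if xs: "xs \<in> F" for xs
  proof
    fix e assume "e \<in> chord_edges xs"
    then obtain u v where uv: "(u, v) \<in> chords xs" "e \<in> undir (segs (block ip u v))"
      unfolding chord_edges_def by (elim CollectE exE conjE)
    then have "u \<noteq> v" by (auto simp: block_def)
    then have "u \<in> A" using chord_props[OF xs uv(1)] by blast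
    then obtain B where B: "own u = Inr B" by (auto simp: A_def)
    then have "B \<in> \<B>" using own_iff by blast
    moreover have "e \<in> edges B" using block_edges[OF xs uv(1) B] uv(2) by (rule subsetD)
    ultimately show "e \<in> edges G - edges L" using Bg by blast
  qed
  have arcs_G: "undir (arcs xs) \<subseteq> edges G" if xs: "xs \<in> F" for xs
  proof -
    have "fst ` set xs \<subseteq> set (cpairs vs)" using F_mem[OF xs] by force
    then have "undir (fst ` set xs) \<subseteq> undir (set (cpairs vs))" by (rule image_mono)
    then have "undir (fst ` set xs) \<subseteq> edges L" by (simp only: eL R)
    then have "undir (fst ` set xs) \<subseteq> edges G" using LG(2) by (rule order_trans)
    moreover have "chord_edges xs \<subseteq> edges G" using chord_edges_G[OF xs] by blast
    ultimately show ?thesis unfolding undir_arcs by (rule Un_least[rotated])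
  qed
  have dicycle: "arcs xs \<in> dicycles G" if xs: "xs \<in> F" for xs
  proof -
    have "verts (underlying (arcs xs)) \<subseteq> verts G"
    proof
      fix x assume "x \<in> verts (underlying (arcs xs))"
      then obtain y where "(x, y) \<in> arcs xs \<or> (y, x) \<in> arcs xs" by (auto simp: verts_underlying Field_def)
      then have "{x, y} \<in> edges G" using arcs_G[OF xs] undirI[of x y "arcs xs"] undirI[of y x "arcs xs"]
        by (auto simp: insert_commute)
      then show "x \<in> verts G" using gG unfolding is_graph_def by blast
    qed
    moreover have "is_graph (underlying (arcs xs))"
      unfolding arcs_def using distinct_walk_circ[OF xs] length_walk[OF xs] by (intro underlying_is_graph) auto
    ultimately show ?thesis
      unfolding dicycles_def subgraph_def using is_dicycle_arcs[OF xs] arcs_G[OF xs] by (simp add: edges_underlying)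
  qed
  have chord_cover: "card (dicycles_through (arcs ` F) e) \<ge> 4" if e: "e \<in> edges G - edges L" for e
  proof -
    obtain B where B: "B \<in> \<B>" "e \<in> edges B" using edge_in_bridge[OF gG gL e] unfolding \<B>_def by blast
    have BB: "B \<in> bridges G L" using B(1) by (simp add: \<B>_def)
    obtain W where W: "\<exists>u\<in>attachments L B. u \<in> W" "\<exists>v\<in>attachments L B. v \<notin> W"
      "\<forall>x y. {x, y} \<in> edges B \<longrightarrow> {x, y} \<noteq> e \<longrightarrow> (x \<in> W \<longleftrightarrow> y \<in> W)"
      using bridge_edge_cut[OF assms(1) gL LG(1) cL BB tree[OF B(1)] B(2)] by blast
    show ?thesis
    proof (rule through_chord_edge[where i = "Inr B" and W = W])
      show "\<exists>u\<in>set vs \<inter> A. own u = Inr B \<and> u \<in> W" "\<exists>v\<in>set vs \<inter> A. own v = Inr B \<and> v \<notin> W"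
        using W(1,2) attA[OF B(1)] by (auto simp: A_def)
      show "e \<in> undir (arcs xs)"
        if xs: "xs \<in> F" and uv: "(u, v) \<in> chords xs" "own u = Inr B" "u \<in> W \<longleftrightarrow> v \<notin> W" for xs u v
      proof (rule ccontr)
        assume no: "e \<notin> undir (arcs xs)"
        \<comment> \<open>A path in the bridge that avoids \<open>e\<close> cannot change its side
          of \<open>W\<close>.\<close>
        have "x \<in> W \<longleftrightarrow> y \<in> W" if s: "(x, y) \<in> segs (block ip u v)" for x y
        proof -
          have xy: "{x, y} \<in> undir (segs (block ip u v))" using s by (rule undirI)
          then have "{x, y} \<in> edges B" by (rule subsetD[OF block_edges[OF xs uv(1,2)]])
          moreover have "{x, y} \<in> chord_edges xs"
            unfolding chord_edges_def using uv(1) xy by (intro CollectI exI conjI)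
          then have "{x, y} \<in> undir (arcs xs)" unfolding undir_arcs by (rule UnI1)
          then have "{x, y} \<noteq> e" using no by metis
          ultimately show ?thesis using W(3) by blast
        qed
        moreover have "u \<in> set (block ip u v)" "v \<in> set (block ip u v)" by (auto simp: block_def)
        ultimately have "u \<in> W \<longleftrightarrow> v \<in> W" using path_closed[of "block ip u v" W] by blast
        then show False using uv(3) by blast
      qed
    qed
  qed
  have types: "\<exists>!C. C \<in> arcs ` F \<and> has_type G R i j x C" if x: "x \<in> A" for i j x
  proof -
    have xv: "x \<in> set vs" using x by (simp add: A_def)
    obtain y z where yz: "(x, y) \<in> R" "(z, x) \<in> R" unfolding R using cpairs_succ[OF xv] cpairs_pred[OF xv] by blast
    have nx: "next_vert R x = y"
      unfolding next_vert_def using cpairs_unique_succ[of id vs x] vs(1) yz(1) R by (intro the_equality) auto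
    have pv: "prev_vert R x = z"
      unfolding prev_vert_def using cpairs_unique_pred[of id vs _ x] vs(1) yz(2) R by (intro the_equality) auto
    have xL: "x \<in> verts (underlying R)" using xv vL L by simp
    have eR: "edges (underlying R) = edges L" by (simp add: L)
    \<comment> \<open>The directed segment that type \<open>ij\<close> asks for: \<open>i\<close>
      selects the segment after or before \<open>x\<close>, and it is directed away from
      \<open>x\<close> exactly if \<open>j = 0\<close>.\<close>
    define d :: "'a dirseg" where
      "d = (if i = 0 then ((x, y), j = 0) else ((z, x), j = 1))"
    have dR: "d \<in> set (cpairs vs) \<times> UNIV" using yz R by (auto simp: d_def)
    have "has_type G R i j x (arcs xs) \<longleftrightarrow> d \<in> set xs" if xs: "xs \<in> F" for xs
    proof (cases "i = j")
      case True
      have "j = 0 \<or> j = 1" by (cases j) auto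
      show ?thesis
        using \<open>j = 0 \<or> j = 1\<close>
      proof
        assume "j = 0"
        then show ?thesis
          using type_src[OF xs x dR _ chord_edges_G[OF xs]] True
          by (auto simp: has_type_def xL nx pv eR d_def)
      next
        assume "j = 1"
        then show ?thesis
          using type_tgt[OF xs x dR _ chord_edges_G[OF xs]] True
          by (auto simp: has_type_def xL nx pv eR d_def)
      qed
    next
      case False
      then have "i = 0 \<and> j = 1 \<or> i = 1 \<and> j = 0" by (cases i; cases j) auto
      then show ?thesis
      proof
        assume "i = 0 \<and> j = 1"
        then show ?thesis
          using type_tgt[OF xs x dR _ chord_edges_G[OF xs]]
          by (auto simp: has_type_def xL nx pv eR d_def)
      next
        assume "i = 1 \<and> j = 0"
        then show ?thesis
          using type_src[OF xs x dR _ chord_edges_G[OF xs]]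
          by (auto simp: has_type_def xL nx pv eR d_def)
      qed
    qed
    then show ?thesis by (rule unique_type[OF dR])
  qed
  have visited: "card (verts (underlying (arcs xs)) \<inter> attachments L B) \<in> {0, 2}" if "xs \<in> F" "B \<in> \<B>" for xs B
  proof -
    have "attachments L B = {v \<in> set vs \<inter> A. own v = Inr B}" using attA[OF that(2)] by (auto simp: A_def)
    then show ?thesis using attachments_visited[OF that(1), of "Inr B"] unfolding verts_arcs by simp
  qed
  show ?thesis
  proof (intro exI[of _ "arcs ` F"] conjI ballI allI impI)
    show "arcs ` F \<subseteq> dicycles G" using dicycle by blast
    show "card (dicycles_through (arcs ` F) e) = 2" if "e \<in> edges L" for e
    proof -
      from that obtain p where p: "e = (\<lambda>(u, v). {u, v}) p" "p \<in> set (cpairs vs)"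
        unfolding eL R by (rule imageE)
      then show ?thesis using through_cycle_edge by (cases p) simp
    qed
    show "4 \<le> card (dicycles_through (arcs ` F) e)" if "e \<in> edges G - edges L" for e
      using chord_cover[OF that] .
    show "is_cycle (sym_diff_graph L (underlying C))" if "C \<in> arcs ` F" for C
    proof -
      from that obtain xs where "C = arcs xs" "xs \<in> F" by (rule imageE)
      then show ?thesis unfolding L' using sym_diff_cycle by simp
    qed
    show "card (verts (underlying C) \<inter> attachments L (T k)) \<in> {0, 2}" if "C \<in> arcs ` F" "k \<in> {1..s}" for C k
    proof -
      from that(1) obtain xs where "C = arcs xs" "xs \<in> F" by (rule imageE)
      moreover have "T k \<in> \<B>" unfolding T[symmetric] using that(2) by (rule imageI)
      ultimately show ?thesis using visited by simp
    qed
    show "\<exists>!C. C \<in> arcs ` F \<and> has_type G R i j x C"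
      if "\<exists>k\<in>{1..s}. x \<in> attachments L (T k)" for i j x
    proof (rule types)
      from that obtain k where k: "k \<in> {1..s}" "x \<in> attachments L (T k)" by (elim bexE)
      have "T k \<in> \<B>" unfolding T[symmetric] using k(1) by (rule imageI)
      then show "x \<in> A" using attA k(2) by simp
    qed
  qed
qed

end
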